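(* Let $k$ be a number field Galois over $\mathbb{Q}$, with the data $A_1$, $\mathcal{S}^{new}$, $\alpha_{\mathfrak q}$ and the set $\mathcal{N}_1^{new}(k)$ as in the context (in particular every $\mathfrak q\in\mathcal{S}^{new}$ satisfies $N(\mathfrak q)\le 2|d_k|^{A_1h_k}$ and every $\alpha_{\mathfrak q}$ satisfies $H(\alpha_{\mathfrak q})\le|\mathrm{Norm}_{k/\mathbb{Q}}(\alpha_{\mathfrak q})|^{1/n_k}\exp(C_1(k)R_k)$). Then every prime $p\in\mathcal{N}_1^{new}(k)$ satisfies $$p\le C\bigl(k,\,2|d_k|^{A_1h_k}\bigr),$$ where $C(k,a)=\bigl(a^{24h_k}C_2(k)+a^{12h_k}\bigr)^{2n_k}$ for $a>0$.
   Context: Fix $k\subset\mathbb{C}$, Galois over $\mathbb{Q}$. Notation: $n_k=[k:\mathbb{Q}]$, $d_k$ the discriminant, $h_k$ the class number, $r_k$ the rank of $\mathcal{O}_k^\times$, $R_k$ the regulator, $\mathbf{Ram}(k)$ the set of primes ramified in $k$, $N(\mathfrak q)=\#(\mathcal{O}_k/\mathfrak q)$. For a place $v$ of $k$ and $\alpha\in k$: if $v$ is finite corresponding to $\mathfrak q$, $\|\alpha\|_v=N(\mathfrak q)^{-\mathrm{ord}_{\mathfrak q}(\alpha)}$ ($\|0\|_v=0$); if $v$ is real given by $\tau$, $\|\alpha\|_v=|\tau(\alpha)|$; if $v$ is complex given by $\tau$, $\|\alpha\|_v=|\tau(\alpha)|^2$. The height is $H(\alpha)=(\prod_v\max(1,\|\alpha\|_v))^{1/n_k}$.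 Fix a constant $\delta_k>0$ such that $\log H(\alpha)\ge\delta_k/n_k$ for every nonzero $\alpha\in k$ that is not a root of unity, and put $C_1(k)=\frac{r_k^{1+r_k}\delta_k^{1-r_k}}{2}$ and $C_2(k)=\exp(24n_kC_1(k)R_k)$. Let $A_1>1$ be a constant (e.g. the absolute effectively computable constant of Lagarias–Montgomery–Odlyzko's bound for the least prime in the Chebotarev density theorem). Let $\mathcal{S}^{new}$ be a nonempty finite set of primes $\mathfrak q$ of $k$, each lying over a rational prime that splits completely in $k$ and each satisfying $N(\mathfrak q)\le2|d_k|^{A_1h_k}$, such that $\mathcal{S}^{new}$ generates the ideal class group of $k$. For each $\mathfrak q\in\mathcal{S}^{new}$ let $\alpha_{\mathfrak q}\in\mathcal{O}_k\setminus\{0\}$ satisfy $\mathfrak q^{h_k}=\alpha_{\mathfrak q}\mathcal{O}_k$ and $H(\alpha_{\mathfrak q})\le|\mathrm{Norm}_{k/\mathbb{Q}}(\alpha_{\mathfrak q})|^{1/n_k}\exp(C_1(k)R_k)$. For $n\ge1$ let $\mathcal{FR}(n)=\{\beta\in\mathbb{C}:\beta^2+a\beta+n=0\text{ for some }a\in\mathbb{Z},|a|\le2\sqrt n\}$. Let $\mathcal{E}(k)=\{\sum_{\sigma\in\mathrm{Gal}(k/\mathbb{Q})}a_\sigma\sigma: a_\sigma\in\{0,8,12,16,24\}\}$, and $\alpha^{\varepsilon}=\prod_\sigma\sigma(\alpha)^{a_\sigma}$ for $\varepsilon=\sum a_\sigma\sigma$. Let $\mathcal{M}_2^{new}(k)=\{\mathrm{Norm}_{k(\beta)/\mathbb{Q}}(\alpha_{\mathfrak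 q}^{\varepsilon}-\beta^{24h_k}) : \mathfrak q\in\mathcal{S}^{new},\varepsilon\in\mathcal{E}(k),\beta\in\mathcal{FR}(N(\mathfrak q))\}\setminus\{0\}$; $\mathcal{N}_0^{new}(k)$ the set of primes dividing some element of $\mathcal{M}_2^{new}(k)$; $\mathcal{T}^{new}(k)$ the set of rational primes below some $\mathfrak q\in\mathcal{S}^{new}$, together with $2,3$; and $\mathcal{N}_1^{new}(k)=\mathcal{N}_0^{new}(k)\cup\mathcal{T}^{new}(k)\cup\mathbf{Ram}(k)$. *)

theory Defs
  imports
    "HOL-Algebra.Algebra"
    "HOL-Computational_Algebra.Computational_Algebra"
    "Jordan_Normal_Form.Determinant"
begin

section \<open>Number fields inside the complex numbers\<close>

text \<open>\<open>num_ring K\<close> is the subset \<open>K\<close> of the complex numbers with the usual operations;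
  \<open>num_ring UNIV\<close> is the field of complex numbers.\<close>

definition num_ring :: "complex set \<Rightarrow> complex ring" where
  "num_ring K = \<lparr>carrier = K, monoid.mult = (*), one = 1, ring.zero = 0, add = (+)\<rparr>"

definition number_field :: "complex set \<Rightarrow> bool" where
  "number_field K \<longleftrightarrow> subfield K (num_ring UNIV) \<and> ring.finite_dimension (num_ring UNIV) \<rat> K"

definition field_degree :: "complex set \<Rightarrow> nat" where
  "field_degree K = ring.dim (num_ring UNIV) \<rat> K"

text \<open>Maps defined on \<open>K\<close> are represented by functions that are extensional on \<open>K\<close>, so that
  equal maps are equal as functions.\<close>

definition embeddings :: "complex set \<Rightarrow> (complex \<Rightarrow> complex) set" where
  "embeddings K = Ring.ring_hom (num_ring K) (num_ring UNIV) \<inter> extensional K"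

definition Gal :: "complex set \<Rightarrow> (complex \<Rightarrow> complex) set" where
  "Gal K = {\<sigma> \<in> ring_iso (num_ring K) (num_ring K) \<inter> extensional K. \<forall>x\<in>\<rat>. \<sigma> x = x}"

definition galois_over_Q :: "complex set \<Rightarrow> bool" where
  "galois_over_Q K \<longleftrightarrow> number_field K \<and> {x \<in> K. \<forall>\<sigma>\<in>Gal K. \<sigma> x = x} = \<rat>"

definition field_norm :: "complex set \<Rightarrow> complex \<Rightarrow> complex" where
  "field_norm K x = (\<Prod>\<tau>\<in>embeddings K. \<tau> x)"

definition field_trace :: "complex set \<Rightarrow> complex \<Rightarrow> complex" where
  "field_trace K x = (\<Sum>\<tau>\<in>embeddings K. \<tau> x)"

definition adjoin :: "complex set \<Rightarrow> complex \<Rightarrow> complex set" where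
  "adjoin K \<beta> = generate_field (num_ring UNIV) (insert \<beta> K)"

definition root_of_unity :: "complex \<Rightarrow> bool" where
  "root_of_unity z \<longleftrightarrow> (\<exists>m>0. z ^ m = 1)"

section \<open>Ring of integers and discriminant\<close>

definition integers :: "complex set \<Rightarrow> complex set" where
  "integers K = {x \<in> K. algebraic_int x}"

abbreviation int_ring :: "complex set \<Rightarrow> complex ring" where
  "int_ring K \<equiv> num_ring (integers K)"

definition integral_basis :: "complex set \<Rightarrow> complex list \<Rightarrow> bool" where
  "integral_basis K bs \<longleftrightarrow> set bs \<subseteq> integers K \<and>
     (\<forall>x\<in>integers K. \<exists>!cs :: int list. length cs = length bs \<and>
        x = (\<Sum>i<length bs. of_int (cs ! i) * bs ! i))"

text \<open>The value does not depend on the chosen integral basis; it is a nonzero rational integer,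
  here regarded as a complex number.\<close>

definition discriminant :: "complex set \<Rightarrow> complex" where
  "discriminant K = (let bs = SOME bs. integral_basis K bs; n = length bs
     in det (mat n n (\<lambda>(i, j). field_trace K (bs ! i * bs ! j))))"

section \<open>Ideals, ideal classes, primes\<close>

definition fractional_ideal :: "complex set \<Rightarrow> complex set \<Rightarrow> bool" where
  "fractional_ideal K I \<longleftrightarrow> additive_subgroup I (num_ring K) \<and> I \<noteq> {0} \<and>
     (\<forall>x\<in>integers K. \<forall>y\<in>I. x * y \<in> I) \<and>
     (\<exists>d\<in>integers K - {0}. \<forall>y\<in>I. d * y \<in> integers K)"

text \<open>The multiplicative group of nonzero fractional ideals. The product of \<open>I\<close> and \<open>J\<close> is the
  set of finite sums of products \<open>x * y\<close> with \<open>x\<close> in \<open>I\<close> and \<open>y\<close> in \<open>J\<close>.\<close>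

definition ideal_group :: "complex set \<Rightarrow> complex set monoid" where
  "ideal_group K =
     \<lparr>carrier = {I. fractional_ideal K I}, monoid.mult = ideal_prod (num_ring K), one = integers K\<rparr>"

definition principal_ideal :: "complex set \<Rightarrow> complex \<Rightarrow> complex set" where
  "principal_ideal K a = {x * a | x. x \<in> integers K}"

definition principal_ideals :: "complex set \<Rightarrow> complex set set" where
  "principal_ideals K = principal_ideal K ` (K - {0})"

definition class_group :: "complex set \<Rightarrow> complex set set monoid" where
  "class_group K = ideal_group K Mod principal_ideals K"

definition ideal_class :: "complex set \<Rightarrow> complex set \<Rightarrow> complex set set" where
  "ideal_class K I = principal_ideals K #>\<^bsub>ideal_group K\<^esub> I"

definition class_number :: "complex set \<Rightarrow> nat" where
  "class_number K = Coset.order (class_group K)"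

text \<open>The primes of a number field are the nonzero prime ideals of its ring of integers.\<close>

definition primes_of :: "complex set \<Rightarrow> complex set set" where
  "primes_of K = {\<qq>. primeideal \<qq> (int_ring K) \<and> \<qq> \<noteq> {0}}"

definition ideal_norm :: "complex set \<Rightarrow> complex set \<Rightarrow> nat" where
  "ideal_norm K \<qq> = card (carrier (int_ring K Quot \<qq>))"

text \<open>\<open>ord_at K \<qq> x\<close> is the largest integer \<open>n\<close> such that \<open>x\<close> lies in the fractional ideal
  \<open>\<qq>\<close> to the power \<open>n\<close>, i.e. the exponent of \<open>\<qq>\<close> in the factorization of the fractional ideal
  generated by \<open>x\<close>. It is meaningful for nonzero \<open>x\<close> only.\<close>

definition ord_at :: "complex set \<Rightarrow> complex set \<Rightarrow> complex \<Rightarrow> int" where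
  "ord_at K \<qq> x = (GREATEST n::int. x \<in> \<qq> [^]\<^bsub>ideal_group K\<^esub> n)"

definition lies_over :: "complex set \<Rightarrow> nat \<Rightarrow> bool" where
  "lies_over \<qq> p \<longleftrightarrow> \<qq> \<inter> \<int> = {of_nat p * z | z. z \<in> \<int>}"

definition ram_index :: "complex set \<Rightarrow> complex set \<Rightarrow> nat \<Rightarrow> int" where
  "ram_index K \<qq> p = ord_at K \<qq> (of_nat p)"

text \<open>Every prime above \<open>p\<close> has ramification index 1 and residue degree 1, the latter meaning
  that its residue field has \<open>p\<close> elements.\<close>

definition splits_completely :: "complex set \<Rightarrow> nat \<Rightarrow> bool" where
  "splits_completely K p \<longleftrightarrow>
     (\<forall>\<qq>\<in>primes_of K. lies_over \<qq> p \<longrightarrow> ram_index K \<qq> p = 1 \<and> ideal_norm K \<qq> = p)"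

definition Ram :: "complex set \<Rightarrow> nat set" where
  "Ram K = {p. Factorial_Ring.prime p \<and> (\<exists>\<qq>\<in>primes_of K. lies_over \<qq> p \<and> ram_index K \<qq> p > 1)}"

section \<open>Places and heights\<close>

text \<open>An archimedean place is a set consisting of an embedding and its complex conjugate; it is a
  singleton precisely when the embedding is real.\<close>

datatype place = Finite_place "complex set" | Arch_place "(complex \<Rightarrow> complex) set"

definition arch_places :: "complex set \<Rightarrow> place set" where
  "arch_places K = (\<lambda>\<tau>. Arch_place {\<tau>, restrict (\<lambda>x. cnj (\<tau> x)) K}) ` embeddings K"

definition places :: "complex set \<Rightarrow> place set" where
  "places K = Finite_place ` primes_of K \<union> arch_places K"

fun place_abs :: "complex set \<Rightarrow> place \<Rightarrow> complex \<Rightarrow> real" where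
  "place_abs K (Finite_place \<qq>) x =
     (if x = 0 then 0 else real (ideal_norm K \<qq>) powi (- ord_at K \<qq> x))"
| "place_abs K (Arch_place V) x =
     (let \<tau> = SOME \<tau>. \<tau> \<in> V
      in if \<tau> ` K \<subseteq> \<real> then cmod (\<tau> x) else (cmod (\<tau> x))\<^sup>2)"

text \<open>All but finitely many factors are 1; the product is taken over the remaining ones.\<close>

definition height :: "complex set \<Rightarrow> complex \<Rightarrow> real" where
  "height K x = (\<Prod>v | v \<in> places K \<and> max 1 (place_abs K v x) \<noteq> 1. max 1 (place_abs K v x))
                  powr (1 / real (field_degree K))"

section \<open>Units and regulator\<close>

definition mult_independent :: "complex list \<Rightarrow> bool" where
  "mult_independent us \<longleftrightarrow>
     (\<forall>e :: nat \<Rightarrow> int. (\<Prod>i<length us. (us ! i) powi e i) = 1 \<longrightarrow> (\<forall>i<length us. e i = 0))"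

definition unit_rank :: "complex set \<Rightarrow> nat" where
  "unit_rank K = (GREATEST r. \<exists>us. length us = r \<and> set us \<subseteq> Units (int_ring K) \<and>
                                   mult_independent us)"

definition fundamental_units :: "complex set \<Rightarrow> complex list \<Rightarrow> bool" where
  "fundamental_units K us \<longleftrightarrow> set us \<subseteq> Units (int_ring K) \<and> mult_independent us \<and>
     (\<forall>u\<in>Units (int_ring K). \<exists>\<zeta>\<in>K. \<exists>e :: nat \<Rightarrow> int. root_of_unity \<zeta> \<and>
        u = \<zeta> * (\<Prod>i<length us. (us ! i) powi e i))"

text \<open>There are \<open>unit_rank K + 1\<close> archimedean places; the list \<open>vs\<close> omits one of them. The value
  depends neither on the choice of \<open>us\<close> nor on that of \<open>vs\<close>.\<close>

definition regulator :: "complex set \<Rightarrow> real" where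
  "regulator K = (let r = unit_rank K;
       us = SOME us. fundamental_units K us;
       vs = SOME vs. distinct vs \<and> length vs = r \<and> set vs \<subseteq> arch_places K
     in \<bar>det (mat r r (\<lambda>(i, j). ln (place_abs K (vs ! j) (us ! i))))\<bar>)"

section \<open>The constants and the sets of primes\<close>

definition height_gap :: "complex set \<Rightarrow> real \<Rightarrow> bool" where
  "height_gap K \<delta> \<longleftrightarrow> \<delta> > 0 \<and>
     (\<forall>x\<in>K. x \<noteq> 0 \<and> \<not> root_of_unity x \<longrightarrow> ln (height K x) \<ge> \<delta> / real (field_degree K))"

definition C1 :: "complex set \<Rightarrow> real \<Rightarrow> real" where
  "C1 K \<delta> = real (unit_rank K) ^ (1 + unit_rank K) * \<delta> powi (1 - int (unit_rank K)) / 2"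

definition C2 :: "complex set \<Rightarrow> real \<Rightarrow> real" where
  "C2 K \<delta> = exp (24 * real (field_degree K) * C1 K \<delta> * regulator K)"

definition C_bound :: "complex set \<Rightarrow> real \<Rightarrow> real \<Rightarrow> real" where
  "C_bound K \<delta> a = (a ^ (24 * class_number K) * C2 K \<delta> + a ^ (12 * class_number K))
                      ^ (2 * field_degree K)"

definition FR :: "nat \<Rightarrow> complex set" where
  "FR n = {\<beta>. \<exists>a::int. \<bar>real_of_int a\<bar> \<le> 2 * sqrt (real n) \<and>
                \<beta>\<^sup>2 + of_int a * \<beta> + of_nat n = 0}"

text \<open>An element \<open>\<Sum>a\<^sub>\<sigma>\<sigma>\<close> of the group ring is represented by its coefficient function.\<close>

definition group_ring_exps :: "complex set \<Rightarrow> ((complex \<Rightarrow> complex) \<Rightarrow> nat) set" where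
  "group_ring_exps K = (Gal K \<rightarrow>\<^sub>E {0, 8, 12, 16, 24})"

definition gr_pow :: "complex set \<Rightarrow> complex \<Rightarrow> ((complex \<Rightarrow> complex) \<Rightarrow> nat) \<Rightarrow> complex" where
  "gr_pow K x \<epsilon> = (\<Prod>\<sigma>\<in>Gal K. \<sigma> x ^ \<epsilon> \<sigma>)"

definition M2_new :: "complex set \<Rightarrow> complex set set \<Rightarrow> (complex set \<Rightarrow> complex) \<Rightarrow> complex set" where
  "M2_new K S \<alpha> =
     {field_norm (adjoin K \<beta>) (gr_pow K (\<alpha> \<qq>) \<epsilon> - \<beta> ^ (24 * class_number K)) | \<qq> \<epsilon> \<beta>.
        \<qq> \<in> S \<and> \<epsilon> \<in> group_ring_exps K \<and> \<beta> \<in> FR (ideal_norm K \<qq>)} - {0}"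

text \<open>The elements of \<open>M2_new K S \<alpha>\<close> are rational integers; divisibility is meant in the ring of
  rational integers.\<close>

definition N0_new :: "complex set \<Rightarrow> complex set set \<Rightarrow> (complex set \<Rightarrow> complex) \<Rightarrow> nat set" where
  "N0_new K S \<alpha> = {p. Factorial_Ring.prime p \<and>
     (\<exists>m\<in>M2_new K S \<alpha>. \<exists>c::int. m = of_nat p * of_int c)}"

definition T_new :: "complex set set \<Rightarrow> nat set" where
  "T_new S = {p. Factorial_Ring.prime p \<and> (\<exists>\<qq>\<in>S. lies_over \<qq> p)} \<union> {2, 3}"

definition N1_new :: "complex set \<Rightarrow> complex set set \<Rightarrow> (complex set \<Rightarrow> complex) \<Rightarrow> nat set" where
  "N1_new K S \<alpha> = N0_new K S \<alpha> \<union> T_new S \<union> Ram K"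

end

theory Submission
  imports Defs "Jordan_Normal_Form.Char_Poly"
begin

text \<open>
  Every prime is bounded separately. A prime below a member of \<open>S\<close> is the norm of that member, and
  a ramified prime divides the discriminant: if \<open>p\<close> lies in \<open>\<qq>\<close> squared and \<open>z\<close> is an element of
  the inverse of \<open>\<qq>\<close> that is not integral, then \<open>p * z\<close> lies in all conjugates of \<open>\<qq>\<close>, so the trace
  form degenerates modulo \<open>p\<close>. Passing from the discriminant to its power with exponent
  \<open>A\<^sub>1 h\<close> uses \<open>h \<ge> 1\<close>, that is the finiteness of the class group (an infinite group has order 0).

  A prime dividing a nonzero norm from \<open>k(\<beta>)\<close> is at most its absolute value, a product of at most
  \<open>2 n\<close> conjugates. In each of them \<open>\<beta>\<close> has absolute value \<open>sqrt (N \<qq>)\<close>, and the conjugate of \<open>\<alpha>\<^sup>\<epsilon>\<close> is at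
  most the 24th power of the Mahler measure of \<open>\<alpha>\<close>, which is the \<open>n\<close>-th power of its height. The height
  is controlled by the norm of \<open>\<alpha>\<close>, and this norm is at most \<open>N \<qq> ^ h\<close> by counting residues: the product
  of all conjugates of \<open>\<alpha>\<close> is a rational integer \<open>t\<close>, and modulo \<open>t\<close> there are \<open>t ^ n\<close> residues.
\<close>

section \<open>Algebraic integers\<close>

text \<open>One element z of k outside \<O> with z \<qq> inside \<O> stands in for the inverse ideal
  of \<qq>. It shows that no nonzero integer lies in all powers of \<qq>, so that
  \<open>ord_at\<close> is a genuine maximum; it compares residues of consecutive powers; and p z is
  the vector on which the trace form degenerates. Its properties rest on the finiteness of residues
  modulo a rational integer and on the determinant criterion for integrality.

  Indices of ideals are handled as upper bounds (\<open>covered\<close>); a matching lower bound is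
  proved for ideals generated by rational integers. Since k is Galois, every embedding is an
  automorphism, so norm, trace and height become expressions over one finite group.

  The shape of C: 24 is the largest coefficient in \<open>group_ring_exps\<close>; \<open>C2\<close>
  is the 24 n-th power of exp (\<open>C1\<close> R); 12 h is half of 24 h because the square of the
  absolute value of \<beta> is N \<qq>; and 2 n bounds the number of embeddings of k(\<beta>), each
  determined by its restriction to k and by one of two roots. The base of the power C is at least 2
  a with a at least 2, which absorbs the primes that do not come from norms.\<close>

definition int_span :: "complex set \<Rightarrow> complex set" where
  "int_span V = {\<Sum>y\<in>V. of_int (c y) * y | c :: complex \<Rightarrow> int. True}"

lemma int_span_I: "x = (\<Sum>y\<in>V. of_int (c y) * y) \<Longrightarrow> x \<in> int_span V"
  by (auto simp: int_span_def)

lemma int_span_E: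
  assumes "x \<in> int_span V"
  obtains c :: "complex \<Rightarrow> int" where "x = (\<Sum>y\<in>V. of_int (c y) * y)"
  using assms by (auto simp: int_span_def)

lemma int_span_add: "a \<in> int_span V \<Longrightarrow> b \<in> int_span V \<Longrightarrow> a + b \<in> int_span V"
  by (elim int_span_E, rule int_span_I[where c = "\<lambda>y. _ y + _ y"])
     (simp add: sum.distrib algebra_simps)

lemma int_span_smult: "a \<in> int_span V \<Longrightarrow> of_int k * a \<in> int_span V"
  by (elim int_span_E, rule int_span_I[where c = "\<lambda>y. k * _ y"])
     (simp add: sum_distrib_left algebra_simps)

lemma int_span_0: "0 \<in> int_span V"
  by (rule int_span_I[where c = "\<lambda>_. 0"]) simp

lemma int_span_incl: "finite V \<Longrightarrow> v \<in> V \<Longrightarrow> v \<in> int_span V"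
proof -
  assume V: "finite V" "v \<in> V"
  have "(\<Sum>y\<in>V. of_int (if y = v then 1 else 0) * y) = (\<Sum>y\<in>V. if y = v then y else 0)"
    by (rule sum.cong) auto
  also have "\<dots> = v" using V by simp
  finally show ?thesis by (intro int_span_I[where c = "\<lambda>y. if y = v then 1 else 0"]) simp
qed

lemma int_span_sum: "(\<And>i. i \<in> I \<Longrightarrow> f i \<in> int_span V) \<Longrightarrow> sum f I \<in> int_span V"
  by (induction I rule: infinite_finite_induct) (auto intro: int_span_add int_span_0)

lemma int_span_mult:
  assumes "\<And>v. v \<in> V \<Longrightarrow> z * v \<in> int_span V" "w \<in> int_span V"
  shows "z * w \<in> int_span V"
proof -
  obtain c :: "complex \<Rightarrow> int" where w: "w = (\<Sum>y\<in>V. of_int (c y) * y)"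
    using assms(2) by (rule int_span_E)
  have "z * w = (\<Sum>y\<in>V. of_int (c y) * (z * y))"
    by (simp add: w sum_distrib_left algebra_simps)
  also have "\<dots> \<in> int_span V"
    using assms(1) by (intro int_span_sum int_span_smult)
  finally show ?thesis .
qed

text \<open>The determinant trick: the vector of generators is a nonzero eigenvector of the integer
  matrix describing multiplication by \<open>z\<close>, so \<open>z\<close> is a root of its monic
  integral characteristic polynomial.\<close>

lemma algebraic_int_if_module:
  assumes V: "finite V" "\<exists>v\<in>V. v \<noteq> 0" and z: "\<And>v. v \<in> V \<Longrightarrow> z * v \<in> int_span V"
  shows "algebraic_int z"
proof -
  obtain vs where vs: "set vs = V" "distinct vs"
    using finite_distinct_list[OF V(1)] by blast
  define n where "n = length vs"
  have "\<exists>c :: complex \<Rightarrow> int. z * v = (\<Sum>y\<in>V. of_int (c y) * y)" if "v \<in> V" for v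
    using z[OF that] by (auto simp: int_span_def)
  then obtain c :: "complex \<Rightarrow> complex \<Rightarrow> int"
    where c: "\<And>v. v \<in> V \<Longrightarrow> z * v = (\<Sum>y\<in>V. of_int (c v y) * y)" by metis
  define M where "M = mat n n (\<lambda>(i, j). c (vs ! i) (vs ! j))"
  define M' where "M' = (of_int_hom.mat_hom M :: complex mat)"
  have M: "M \<in> carrier_mat n n" "M' \<in> carrier_mat n n" by (auto simp: M_def M'_def)
  define w where "w = vec n (\<lambda>i. vs ! i)"
  have sum_V: "(\<Sum>y\<in>V. f y) = (\<Sum>j<n. f (vs ! j))" for f :: "complex \<Rightarrow> complex"
    using sum.reindex_bij_betw[OF bij_betw_nth[OF vs(2) refl vs(1)[symmetric]], of f]
    by (simp add: n_def)
  have "M' *\<^sub>v w = z \<cdot>\<^sub>v w"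
  proof (rule eq_vecI)
    fix i assume "i < dim_vec (z \<cdot>\<^sub>v w)"
    then have i: "i < n" by (simp add: w_def)
    then have "vs ! i \<in> V" using vs(1) by (auto simp: n_def)
    then have "z * vs ! i = (\<Sum>j<n. of_int (c (vs ! i) (vs ! j)) * vs ! j)"
      using c sum_V by simp
    then show "(M' *\<^sub>v w) $ i = (z \<cdot>\<^sub>v w) $ i"
      using i by (simp add: M'_def M_def w_def scalar_prod_def lessThan_atLeast0)
  qed (simp add: M'_def M_def w_def)
  moreover have "w \<noteq> 0\<^sub>v n"
  proof
    assume *: "w = 0\<^sub>v n"
    obtain v where "v \<in> V" "v \<noteq> 0" using V(2) by blast
    then obtain i where "i < n" "vs ! i \<noteq> 0" using vs(1) by (metis in_set_conv_nth n_def)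
    then show False using arg_cong[OF *, of "\<lambda>x. vec_index x i"] by (simp add: w_def)
  qed
  ultimately have "eigenvalue M' z"
    unfolding eigenvalue_def eigenvector_def using M by (intro exI[of _ w]) (simp add: w_def)
  then have "poly (char_poly M') z = 0"
    using eigenvalue_root_char_poly M(2) by blast
  then have "poly (of_int_poly (char_poly M)) z = 0"
    using of_int_hom.char_poly_hom[OF M(1), where ?'a = complex] by (simp add: M'_def)
  then show ?thesis
    unfolding algebraic_int_altdef_ipoly using degree_monic_char_poly[OF M(1)] by metis
qed

lemma algebraic_int_power_reduction:
  assumes "algebraic_int (x :: complex)"
  obtains a c where "a > 0" "x ^ a = (\<Sum>i<a. of_int (c i) * x ^ i)"
proof -
  obtain p :: "int poly" where p: "poly (of_int_poly p) x = 0" "monic p"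
    using assms unfolding algebraic_int_altdef_ipoly by blast
  define a where "a = Polynomial.degree p"
  have "poly (of_int_poly p) x = (\<Sum>i\<le>a. of_int (coeff p i) * x ^ i)"
    by (simp add: poly_altdef a_def)
  also have "\<dots> = (\<Sum>i<a. of_int (coeff p i) * x ^ i) + x ^ a"
    using p(2) by (simp add: a_def lessThan_Suc_atMost[symmetric])
  finally have "x ^ a = (\<Sum>i<a. of_int (- coeff p i) * x ^ i)"
    using p(1) by (simp add: add_eq_0_iff sum_negf)
  \<comment> \<open>For a = 0 the relation would read 1 = 0.\<close>
  moreover from this have "a > 0" by (cases a) auto
  ultimately show ?thesis using that[of a "\<lambda>i. - coeff p i"] by blast
qed

text \<open>The monomials x^i y^j below the two degrees work: an overflowing power is rewritten by
  its monic relation. One module stable under both elements serves sums and products alike, and 1 is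
  its nonzero element.\<close>

lemma algebraic_int_common_module:
  assumes "algebraic_int x" "algebraic_int y"
  obtains V where "finite V" "1 \<in> V" "\<And>v. v \<in> V \<Longrightarrow> x * v \<in> int_span V"
    "\<And>v. v \<in> V \<Longrightarrow> y * v \<in> int_span V"
proof -
  obtain a c where a: "a > 0" "x ^ a = (\<Sum>i<a. of_int (c i) * x ^ i)"
    using assms(1) by (rule algebraic_int_power_reduction)
  obtain b d where b: "b > 0" "y ^ b = (\<Sum>i<b. of_int (d i) * y ^ i)"
    using assms(2) by (rule algebraic_int_power_reduction)
  define V where "V = (\<lambda>(i, j). x ^ i * y ^ j) ` ({..<a} \<times> {..<b})"
  have fin: "finite V" by (simp add: V_def)
  have mem: "x ^ i * y ^ j \<in> V" if "i < a" "j < b" for i j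
    using that by (auto simp: V_def)
  show ?thesis
  proof (rule that[of V])
    show "1 \<in> V" using mem[of 0 0] a b by simp
    fix v assume "v \<in> V"
    then obtain i j where v: "v = x ^ i * y ^ j" "i < a" "j < b" by (auto simp: V_def)
    show "x * v \<in> int_span V"
    proof (cases "Suc i < a")
      case True
      then show ?thesis using int_span_incl[OF fin mem[of "Suc i" j]] v by (simp add: mult.assoc)
    next
      case False
      then have "x * v = x ^ a * y ^ j" using v by (metis Suc_lessI power_Suc mult.assoc)
      also have "\<dots> = (\<Sum>k<a. of_int (c k) * (x ^ k * y ^ j))"
        by (simp add: a(2) sum_distrib_right mult.assoc)
      also have "\<dots> \<in> int_span V"
        using v by (intro int_span_sum int_span_smult int_span_incl fin mem) auto
      finally show ?thesis .
    qed
    show "y * v \<in> int_span V"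
    proof (cases "Suc j < b")
      case True
      then show ?thesis using int_span_incl[OF fin mem[of i "Suc j"]] v
        by (simp add: mult.left_commute)
    next
      case False
      then have "y * v = x ^ i * y ^ b" using v
        by (metis Suc_lessI power_Suc mult.left_commute)
      also have "\<dots> = (\<Sum>k<b. of_int (d k) * (x ^ i * y ^ k))"
        by (simp add: b(2) sum_distrib_left mult_ac)
      also have "\<dots> \<in> int_span V"
        using v by (intro int_span_sum int_span_smult int_span_incl fin mem) auto
      finally show ?thesis .
    qed
  qed (rule fin)
qed

lemma algebraic_int_add:
  assumes "algebraic_int (x :: complex)" "algebraic_int y"
  shows "algebraic_int (x + y)"
proof -
  obtain V where V: "finite V" "1 \<in> V" "\<And>v. v \<in> V \<Longrightarrow> x * v \<in> int_span V"
    "\<And>v. v \<in> V \<Longrightarrow> y * v \<in> int_span V" by (rule algebraic_int_common_module[OF assms]) blast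
  show ?thesis
    using V by (intro algebraic_int_if_module[of V]) (auto simp: distrib_right intro: int_span_add bexI[of _ 1])
qed

lemma algebraic_int_times:
  assumes "algebraic_int (x :: complex)" "algebraic_int y"
  shows "algebraic_int (x * y)"
proof -
  obtain V where V: "finite V" "1 \<in> V" "\<And>v. v \<in> V \<Longrightarrow> x * v \<in> int_span V"
    "\<And>v. v \<in> V \<Longrightarrow> y * v \<in> int_span V" by (rule algebraic_int_common_module[OF assms]) blast
  show ?thesis
    using V by (intro algebraic_int_if_module[of V])
      (auto simp: mult.assoc intro: int_span_mult bexI[of _ 1])
qed

section \<open>Determinants of systems of homomorphisms\<close>

lemma independence_of_characters:
  fixes c :: "('a \<Rightarrow> complex) \<Rightarrow> complex"
  assumes "finite F"
    and "\<And>\<tau> x y. \<tau> \<in> F \<Longrightarrow> x \<in> K \<Longrightarrow> y \<in> K \<Longrightarrow> \<tau> (mul x y) = \<tau> x * \<tau> y"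
    and "\<And>\<tau>. \<tau> \<in> F \<Longrightarrow> \<tau> e = 1" "e \<in> K" "\<And>x y. x \<in> K \<Longrightarrow> y \<in> K \<Longrightarrow> mul x y \<in> K"
    and "\<And>\<tau> \<tau>'. \<tau> \<in> F \<Longrightarrow> \<tau>' \<in> F \<Longrightarrow> \<tau> \<noteq> \<tau>' \<Longrightarrow> \<exists>x\<in>K. \<tau> x \<noteq> \<tau>' x"
    and "\<And>x. x \<in> K \<Longrightarrow> (\<Sum>\<tau>\<in>F. c \<tau> * \<tau> x) = 0"
  shows "\<forall>\<tau>\<in>F. c \<tau> = 0"
  using assms
proof (induction F arbitrary: c rule: finite_induct)
  case (insert \<tau>\<^sub>0 F)
  note mult = insert.prems(1) and e = insert.prems(2,3) and cl = insert.prems(4)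
    and dist = insert.prems(5) and zero = insert.prems(6)
  have F0: "c \<tau> = 0" if \<tau>: "\<tau> \<in> F" for \<tau>
  proof -
    have "\<tau> \<noteq> \<tau>\<^sub>0" using \<tau> insert.hyps(2) by blast
    then obtain y where y: "y \<in> K" "\<tau> y \<noteq> \<tau>\<^sub>0 y" using dist[of \<tau> \<tau>\<^sub>0] \<tau> by blast
    have "\<forall>\<tau>\<in>F. c \<tau> * (\<tau> y - \<tau>\<^sub>0 y) = 0"
    proof (rule insert.IH)
      fix x assume x: "x \<in> K"
      have "(\<Sum>\<tau>\<in>insert \<tau>\<^sub>0 F. c \<tau> * \<tau> (mul y x)) - \<tau>\<^sub>0 y * (\<Sum>\<tau>\<in>insert \<tau>\<^sub>0 F. c \<tau> * \<tau> x) = 0"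
        using zero x y(1) cl by simp
      moreover have "(\<Sum>\<tau>\<in>insert \<tau>\<^sub>0 F. c \<tau> * \<tau> (mul y x)) -
          \<tau>\<^sub>0 y * (\<Sum>\<tau>\<in>insert \<tau>\<^sub>0 F. c \<tau> * \<tau> x) =
          (\<Sum>\<tau>\<in>insert \<tau>\<^sub>0 F. c \<tau> * (\<tau> y - \<tau>\<^sub>0 y) * \<tau> x)"
        unfolding sum_distrib_left sum_subtractf[symmetric]
        by (intro sum.cong refl) (simp add: mult[OF _ y(1) x] algebra_simps)
      ultimately have "(\<Sum>\<tau>\<in>insert \<tau>\<^sub>0 F. c \<tau> * (\<tau> y - \<tau>\<^sub>0 y) * \<tau> x) = 0"
        by simp
      then show "(\<Sum>\<tau>\<in>F. c \<tau> * (\<tau> y - \<tau>\<^sub>0 y) * \<tau> x) = 0"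
        using insert.hyps by simp
    qed (use mult e cl dist in auto)
    then show ?thesis using \<tau> y(2) by auto
  qed
  moreover have "c \<tau>\<^sub>0 = 0" using zero[OF e(2)] insert.hyps F0 e(1)[of \<tau>\<^sub>0] by simp
  ultimately show ?case by simp
qed simp

text \<open>The points are found one column at a time. Expanded along the new column, the
  determinant is a combination of the homomorphisms whose last coefficient is the previous minor, so
  by independence it cannot vanish on all of \<open>K\<close>.\<close>

lemma exists_nonzero_minor:
  fixes \<tau>s :: "('a \<Rightarrow> complex) list"
  assumes "distinct \<tau>s"
    and "\<And>\<tau> x y. \<tau> \<in> set \<tau>s \<Longrightarrow> x \<in> K \<Longrightarrow> y \<in> K \<Longrightarrow> \<tau> (mul x y) = \<tau> x * \<tau> y"
    and "\<And>\<tau>. \<tau> \<in> set \<tau>s \<Longrightarrow> \<tau> e = 1" "e \<in> K" "\<And>x y. x \<in> K \<Longrightarrow> y \<in> K \<Longrightarrow> mul x y \<in> K"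
    and "\<And>\<tau> \<tau>'. \<tau> \<in> set \<tau>s \<Longrightarrow> \<tau>' \<in> set \<tau>s \<Longrightarrow> \<tau> \<noteq> \<tau>' \<Longrightarrow> \<exists>x\<in>K. \<tau> x \<noteq> \<tau>' x"
    and "r \<le> length \<tau>s"
  shows "\<exists>b. (\<forall>j<r. b j \<in> K) \<and> det (mat r r (\<lambda>(i, j). (\<tau>s ! i) (b j))) \<noteq> 0"
  using assms(7)
proof (induction r)
  case (Suc r)
  then obtain b where b: "\<forall>j<r. b j \<in> K" "det (mat r r (\<lambda>(i, j). (\<tau>s ! i) (b j))) \<noteq> 0" by auto
  define A where "A x = mat (Suc r) (Suc r) (\<lambda>(i, j). (\<tau>s ! i) (if j < r then b j else x))" for x
  \<comment> \<open>Cofactors along the last column do not depend on that column, so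
    \<open>e\<close> is an arbitrary filler.\<close>
  define d where "d i = cofactor (A e) i r" for i
  have cof: "cofactor (A x) i r = d i" if "i < Suc r" for x i
  proof -
    have "mat_delete (A x) i r = mat_delete (A e) i r"
      by (rule eq_matI) (auto simp: mat_delete_def A_def)
    then show ?thesis by (simp add: d_def cofactor_def)
  qed
  have det: "det (A x) = (\<Sum>i<Suc r. d i * (\<tau>s ! i) x)" for x
  proof -
    have "det (A x) = (\<Sum>i<Suc r. A x $$ (i, r) * cofactor (A x) i r)"
      by (rule laplace_expansion_column) (auto simp: A_def)
    also have "\<dots> = (\<Sum>i<Suc r. d i * (\<tau>s ! i) x)"
      by (intro sum.cong refl) (simp add: cof, simp add: A_def)
    finally show ?thesis .
  qed
  have "mat_delete (A e) r r = mat r r (\<lambda>(i, j). (\<tau>s ! i) (b j))"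
    by (rule eq_matI) (auto simp: mat_delete_def A_def)
  then have dr: "d r \<noteq> 0" using b(2) by (simp add: d_def cofactor_def)
  have "\<exists>x\<in>K. det (A x) \<noteq> 0"
  proof (rule ccontr)
    assume "\<not> ?thesis"
    then have z: "(\<Sum>i<Suc r. d i * (\<tau>s ! i) x) = 0" if "x \<in> K" for x using det that by simp
    define F where "F = (!) \<tau>s ` {..<Suc r}"
    have inj: "inj_on ((!) \<tau>s) {..<Suc r}"
      using inj_on_nth[OF assms(1), of "{..<Suc r}"] Suc.prems by auto
    \<comment> \<open>The coefficients are re-indexed by the homomorphisms themselves, the form in
      which independence is stated.\<close>
    define c where "c \<tau> = d (the_inv_into {..<Suc r} ((!) \<tau>s) \<tau>)" for \<tau>
    have c: "c (\<tau>s ! i) = d i" if "i < Suc r" for i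
      using the_inv_into_f_f[OF inj] that by (simp add: c_def)
    have F: "F \<subseteq> set \<tau>s" using Suc.prems by (auto simp: F_def)
    have "\<forall>\<tau>\<in>F. c \<tau> = 0"
    proof (rule independence_of_characters[where K = K and mul = mul and e = e])
      fix x assume x: "x \<in> K"
      have "(\<Sum>\<tau>\<in>F. c \<tau> * \<tau> x) = (\<Sum>i<Suc r. c (\<tau>s ! i) * (\<tau>s ! i) x)"
        unfolding F_def using sum.reindex[OF inj] by (simp add: o_def)
      also have "\<dots> = (\<Sum>i<Suc r. d i * (\<tau>s ! i) x)"
        by (intro sum.cong refl) (use c in simp)
      finally show "(\<Sum>\<tau>\<in>F. c \<tau> * \<tau> x) = 0" using z[OF x] by simp
    next
      fix \<tau> \<tau>' assume "\<tau> \<in> F" "\<tau>' \<in> F" "\<tau> \<noteq> \<tau>'"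
      then show "\<exists>x\<in>K. \<tau> x \<noteq> \<tau>' x" using F assms(6) by blast
    qed (use F assms in \<open>auto simp: F_def\<close>)
    then have "c (\<tau>s ! r) = 0" by (auto simp: F_def)
    then show False using c[of r] dr by simp
  qed
  then obtain x where x: "x \<in> K" "det (A x) \<noteq> 0" by blast
  show ?case
    using x b(1) by (intro exI[of _ "\<lambda>j. if j < r then b j else x"]) (auto simp: A_def)
qed (auto intro!: exI[of _ "\<lambda>_. e"] simp: assms(4))

section \<open>Subfields of the complex numbers and their embeddings\<close>

lemma num_ring_simps [simp]:
  "carrier (num_ring K) = K" "x \<otimes>\<^bsub>num_ring K\<^esub> y = x * y" "\<one>\<^bsub>num_ring K\<^esub> = 1"
  "\<zero>\<^bsub>num_ring K\<^esub> = 0" "x \<oplus>\<^bsub>num_ring K\<^esub> y = x + y"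
  by (simp_all add: num_ring_def)

lemma field_num_ring_UNIV: "field (num_ring UNIV)"
proof (rule cring.cring_fieldI2)
  show "cring (num_ring UNIV)"
  proof (rule cringI)
    show "abelian_group (num_ring UNIV)"
      by (rule abelian_groupI) (auto simp: algebra_simps intro: exI[of _ "- _"] add.left_inverse)
    show "Group.comm_monoid (num_ring UNIV)"
      by (rule comm_monoidI) auto
  qed (auto simp: algebra_simps)
  show "\<exists>b\<in>carrier (num_ring UNIV). a \<otimes>\<^bsub>num_ring UNIV\<^esub> b = \<one>\<^bsub>num_ring UNIV\<^esub>"
    if "a \<noteq> \<zero>\<^bsub>num_ring UNIV\<^esub>" for a
    using that by (auto intro: exI[of _ "inverse a"])
qed simp

lemma num_ring_UNIV_a_inv [simp]: "\<ominus>\<^bsub>num_ring UNIV\<^esub> x = - x"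
proof -
  interpret field "num_ring UNIV" by (rule field_num_ring_UNIV)
  show ?thesis by (rule minus_equality) auto
qed

lemma num_ring_UNIV_m_inv: "x \<noteq> 0 \<Longrightarrow> inv\<^bsub>num_ring UNIV\<^esub> x = inverse x"
proof -
  interpret field "num_ring UNIV" by (rule field_num_ring_UNIV)
  assume "x \<noteq> 0"
  then show ?thesis by (intro inv_unique'[symmetric]) auto
qed

text \<open>Finite dimension is kept out of this locale so that it also applies to
  \<open>adjoin K \<beta>\<close>.\<close>

locale complex_subfield =
  fixes K :: "complex set"
  assumes subfield: "subfield K (num_ring UNIV)"
begin

lemma add_closed [intro]: "x \<in> K \<Longrightarrow> y \<in> K \<Longrightarrow> x + y \<in> K"
  and mult_closed [intro]: "x \<in> K \<Longrightarrow> y \<in> K \<Longrightarrow> x * y \<in> K"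
  and uminus_closed [intro]: "x \<in> K \<Longrightarrow> - x \<in> K"
  and zero_closed [simp, intro]: "0 \<in> K"
  and one_closed [simp, intro]: "1 \<in> K"
  using subringE[OF subfieldE(1)[OF subfield]] by auto

lemma inverse_closed [intro]: "x \<in> K \<Longrightarrow> inverse x \<in> K"
proof -
  interpret field "num_ring UNIV" by (rule field_num_ring_UNIV)
  assume "x \<in> K"
  then show ?thesis
    using subfield_m_inv(1)[OF subfield, of x] by (cases "x = 0") (auto simp: num_ring_UNIV_m_inv)
qed

lemma diff_closed [intro]: "x \<in> K \<Longrightarrow> y \<in> K \<Longrightarrow> x - y \<in> K"
  using add_closed[of x "- y"] by auto

lemma divide_closed [intro]: "x \<in> K \<Longrightarrow> y \<in> K \<Longrightarrow> x / y \<in> K"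
  using mult_closed[of x "inverse y"] by (auto simp: divide_inverse)

lemma power_closed [intro]: "x \<in> K \<Longrightarrow> x ^ n \<in> K"
  by (induction n) auto

lemma sum_closed [intro]: "(\<And>i. i \<in> I \<Longrightarrow> f i \<in> K) \<Longrightarrow> sum f I \<in> K"
  by (induction I rule: infinite_finite_induct) auto

lemma prod_closed [intro]: "(\<And>i. i \<in> I \<Longrightarrow> f i \<in> K) \<Longrightarrow> prod f I \<in> K"
  by (induction I rule: infinite_finite_induct) auto

lemma of_nat_closed [simp, intro]: "of_nat n \<in> K"
  by (induction n) auto

lemma of_int_closed [simp, intro]: "of_int n \<in> K"
  by (cases n) auto

lemma Rats_closed [intro]: "x \<in> \<rat> \<Longrightarrow> x \<in> K"
  by (metis Rats_cases' divide_closed of_int_closed)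

section \<open>Embeddings as field homomorphisms fixing the rationals\<close>

lemma embedding_simps:
  assumes "\<tau> \<in> embeddings K"
  shows "x \<in> K \<Longrightarrow> y \<in> K \<Longrightarrow> \<tau> (x + y) = \<tau> x + \<tau> y"
    and "x \<in> K \<Longrightarrow> y \<in> K \<Longrightarrow> \<tau> (x * y) = \<tau> x * \<tau> y"
    and "\<tau> 1 = 1" and "\<tau> 0 = 0"
proof -
  have hom: "\<tau> \<in> Ring.ring_hom (num_ring K) (num_ring UNIV)" using assms by (simp add: embeddings_def)
  show add: "\<tau> (x + y) = \<tau> x + \<tau> y" if "x \<in> K" "y \<in> K" for x y
    using ring_hom_add[OF hom, of x y] that by simp
  show "x \<in> K \<Longrightarrow> y \<in> K \<Longrightarrow> \<tau> (x * y) = \<tau> x * \<tau> y"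
    using ring_hom_mult[OF hom, of x y] by simp
  show "\<tau> 1 = 1" using ring_hom_one[OF hom] by simp
  show "\<tau> 0 = 0" using add[of 0 0] by simp
qed

lemma embedding_uminus: "\<tau> \<in> embeddings K \<Longrightarrow> x \<in> K \<Longrightarrow> \<tau> (- x) = - \<tau> x"
  using embedding_simps(1)[of \<tau> x "- x"] embedding_simps(4)[of \<tau>]
  by (simp add: uminus_closed add_eq_0_iff)

lemma embedding_diff: "\<tau> \<in> embeddings K \<Longrightarrow> x \<in> K \<Longrightarrow> y \<in> K \<Longrightarrow> \<tau> (x - y) = \<tau> x - \<tau> y"
  using embedding_simps(1)[of \<tau> x "- y"] by (simp add: uminus_closed embedding_uminus)

lemma embedding_sum:
  "\<tau> \<in> embeddings K \<Longrightarrow> (\<And>i. i \<in> I \<Longrightarrow> f i \<in> K) \<Longrightarrow> \<tau> (sum f I) = (\<Sum>i\<in>I. \<tau> (f i))"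
  by (induction I rule: infinite_finite_induct) (auto simp: embedding_simps sum_closed)

lemma embedding_prod:
  "\<tau> \<in> embeddings K \<Longrightarrow> (\<And>i. i \<in> I \<Longrightarrow> f i \<in> K) \<Longrightarrow> \<tau> (prod f I) = (\<Prod>i\<in>I. \<tau> (f i))"
  by (induction I rule: infinite_finite_induct) (auto simp: embedding_simps prod_closed)

lemma embedding_power: "\<tau> \<in> embeddings K \<Longrightarrow> x \<in> K \<Longrightarrow> \<tau> (x ^ n) = \<tau> x ^ n"
  by (induction n) (auto simp: embedding_simps power_closed)

lemma embedding_eq_0_iff: "\<tau> \<in> embeddings K \<Longrightarrow> x \<in> K \<Longrightarrow> \<tau> x = 0 \<longleftrightarrow> x = 0"
  using embedding_simps(2)[of \<tau> x "inverse x"] embedding_simps(3,4)[of \<tau>]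
  by (cases "x = 0") (auto simp: inverse_closed)

lemma embedding_inverse: "\<tau> \<in> embeddings K \<Longrightarrow> x \<in> K \<Longrightarrow> \<tau> (inverse x) = inverse (\<tau> x)"
  using embedding_simps(2)[of \<tau> x "inverse x"] embedding_simps(3,4)[of \<tau>]
  by (cases "x = 0") (auto simp: inverse_closed inverse_unique)

lemma embedding_inj_on: "\<tau> \<in> embeddings K \<Longrightarrow> inj_on \<tau> K"
  using embedding_diff[of \<tau>] embedding_eq_0_iff[of \<tau>]
  by (intro inj_onI) (metis diff_closed eq_iff_diff_eq_0)

lemma embedding_of_nat: "\<tau> \<in> embeddings K \<Longrightarrow> \<tau> (of_nat n) = of_nat n"
  by (induction n) (auto simp: embedding_simps)

lemma embedding_of_int: "\<tau> \<in> embeddings K \<Longrightarrow> \<tau> (of_int n) = of_int n"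
proof (cases n)
  case (neg m)
  assume "\<tau> \<in> embeddings K"
  then have "\<tau> (- of_nat (Suc m)) = - of_nat (Suc m)"
    by (simp only: embedding_uminus of_nat_closed embedding_of_nat)
  then show ?thesis by (simp only: neg of_int_minus of_int_of_nat_eq)
qed (auto simp: embedding_of_nat)

lemma embedding_Rats: "\<tau> \<in> embeddings K \<Longrightarrow> x \<in> \<rat> \<Longrightarrow> \<tau> x = x"
proof -
  assume \<tau>: "\<tau> \<in> embeddings K" and "x \<in> \<rat>"
  then obtain a b where x: "x = of_int a * inverse (of_int b)"
    by (metis Rats_cases' divide_inverse)
  show ?thesis
    unfolding x embedding_simps(2)[OF \<tau> of_int_closed inverse_closed[OF of_int_closed]]
      embedding_inverse[OF \<tau> of_int_closed] embedding_of_int[OF \<tau>] by (rule refl)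
qed

lemma embedding_extensional: "\<tau> \<in> embeddings K \<Longrightarrow> \<tau> \<in> extensional K"
  by (simp add: embeddings_def)

lemma embedding_ext:
  "\<tau> \<in> embeddings K \<Longrightarrow> \<tau>' \<in> embeddings K \<Longrightarrow> (\<And>x. x \<in> K \<Longrightarrow> \<tau> x = \<tau>' x) \<Longrightarrow> \<tau> = \<tau>'"
  by (meson embedding_extensional extensionalityI)

lemma embeddingI:
  assumes "\<And>x y. x \<in> K \<Longrightarrow> y \<in> K \<Longrightarrow> \<tau> (x + y) = \<tau> x + \<tau> y"
    "\<And>x y. x \<in> K \<Longrightarrow> y \<in> K \<Longrightarrow> \<tau> (x * y) = \<tau> x * \<tau> y" "\<tau> 1 = 1"
  shows "restrict \<tau> K \<in> embeddings K"
  using assms unfolding embeddings_def by (auto intro!: ring_hom_memI)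

end

locale complex_number_field = complex_subfield +
  assumes finite_dimension: "ring.finite_dimension (num_ring UNIV) \<rat> K"
begin

text \<open>A nonzero minor of the matrix of values \<open>\<tau>\<^sub>i (b\<^sub>j)\<close> makes the \<open>b\<^sub>j\<close> linearly independent
  over the rationals.\<close>

lemma distinct_embeddings_le_degree:
  assumes "distinct \<tau>s" "set \<tau>s \<subseteq> embeddings K"
  shows "length \<tau>s \<le> field_degree K"
proof -
  interpret C: field "num_ring UNIV" by (rule field_num_ring_UNIV)
  have Q: "subfield \<rat> (num_ring UNIV)"
    by (rule C.subfieldI', rule C.subringI) (auto simp: num_ring_UNIV_m_inv)
  define r where "r = length \<tau>s"
  have "\<exists>b. (\<forall>j<r. b j \<in> K) \<and> det (mat r r (\<lambda>(i, j). (\<tau>s ! i) (b j))) \<noteq> 0"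
  proof (rule exists_nonzero_minor[OF assms(1), where mul = "(*)" and e = 1])
    fix \<tau> \<tau>' assume "\<tau> \<in> set \<tau>s" "\<tau>' \<in> set \<tau>s" "\<tau> \<noteq> \<tau>'"
    then show "\<exists>x\<in>K. \<tau> x \<noteq> \<tau>' x" using embedding_ext assms(2) by blast
  qed (use assms(2) embedding_simps in \<open>auto simp: r_def\<close>)
  then obtain b where b: "\<forall>j<r. b j \<in> K" "det (mat r r (\<lambda>(i, j). (\<tau>s ! i) (b j))) \<noteq> 0" by blast
  define A where "A = mat r r (\<lambda>(i, j). (\<tau>s ! i) (b j))"
  \<comment> \<open>The recursive linear combination as an indexed sum; the start \<open>k\<close>
    is general so that the induction can pass to tails.\<close>
  have combine: "C.combine Ks (map b [k..<r]) = (\<Sum>j\<in>{k..<r}. (Ks ! (j - k)) * b j)"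
    if "length Ks = r - k" "k \<le> r" for Ks k
    using that
  proof (induction Ks arbitrary: k)
    case (Cons x Ks)
    then have k: "k < r" by (cases "k < r") auto
    have "C.combine (x # Ks) (map b [k..<r]) = x * b k + C.combine Ks (map b [Suc k..<r])"
      using k by (simp add: upt_conv_Cons)
    also have "C.combine Ks (map b [Suc k..<r]) = (\<Sum>j\<in>{Suc k..<r}. Ks ! (j - Suc k) * b j)"
      using Cons.IH[of "Suc k"] Cons.prems k by simp
    also have "\<dots> = (\<Sum>j\<in>{Suc k..<r}. (x # Ks) ! (j - k) * b j)"
      by (intro sum.cong refl) (auto simp: Suc_diff_Suc nth_Cons')
    finally show ?case using k by (simp add: sum.atLeast_Suc_lessThan)
  qed auto
  have "C.independent \<rat> (map b [0..<r])"
  proof (rule ccontr)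
    assume "\<not> ?thesis"
    then obtain Ks where Ks: "length Ks = length (map b [0..<r])" "C.combine Ks (map b [0..<r]) = 0"
        "set Ks \<subseteq> \<rat>" "set Ks \<noteq> {0}"
      using C.dependent_imp_non_trivial_combine[OF Q, of "map b [0..<r]"] by auto
    then have len: "length Ks = r" by simp
    have eq: "(\<Sum>j<r. Ks ! j * b j) = 0"
      using Ks(2) combine[of Ks 0] len by (simp add: lessThan_atLeast0)
    define v where "v = vec r (\<lambda>j. Ks ! j)"
    have Kj: "Ks ! j \<in> \<rat>" if "j < r" for j using Ks(3) len that by auto
    have "A *\<^sub>v v = 0\<^sub>v r"
    proof (rule eq_vecI)
      fix i assume "i < dim_vec (0\<^sub>v r :: complex vec)"
      then have i: "i < r" by simp
      then have \<tau>: "\<tau>s ! i \<in> embeddings K" using assms(2) by (auto simp: r_def)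
      have "0 = (\<tau>s ! i) (\<Sum>j<r. Ks ! j * b j)" using eq embedding_simps(4)[OF \<tau>] by simp
      also have "\<dots> = (\<Sum>j<r. (\<tau>s ! i) (Ks ! j * b j))"
        using b(1) Kj by (intro embedding_sum[OF \<tau>]) (auto intro: Rats_closed)
      also have "\<dots> = (\<Sum>j<r. (\<tau>s ! i) (b j) * Ks ! j)"
        using b(1) Kj \<tau> by (intro sum.cong refl) (auto simp: embedding_simps embedding_Rats Rats_closed)
      finally show "vec_index (A *\<^sub>v v) i = vec_index (0\<^sub>v r) i"
        using i by (simp add: A_def v_def scalar_prod_def lessThan_atLeast0)
    qed (simp add: A_def)
    moreover have "v \<noteq> 0\<^sub>v r"
    proof
      assume *: "v = 0\<^sub>v r"
      have "Ks ! j = 0" if "j < r" for j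
        using arg_cong[OF *, of "\<lambda>x. vec_index x j"] that by (simp add: v_def)
      then have "set Ks \<subseteq> {0}" using len by (auto simp: in_set_conv_nth)
      then have "r = 0" using Ks(4) len by (cases Ks) auto
      then show False using Ks \<open>\<not> C.independent \<rat> (map b [0..<r])\<close> by simp
    qed
    moreover have "A \<in> carrier_mat r r" "v \<in> carrier_vec r" by (auto simp: A_def v_def)
    ultimately have "det A = 0" using det_0_iff_vec_prod_zero by blast
    then show False using b(2) by (simp add: A_def)
  qed
  moreover have "C.dimension (field_degree K) \<rat> K"
    using C.finite_dimensionE[OF Q finite_dimension] by (simp add: field_degree_def over_def)
  ultimately have "length (map b [0..<r]) \<le> field_degree K"
    using b(1) by (intro C.independent_length_le_dimension[OF Q]) auto
  then show ?thesis by (simp add: r_def)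
qed

lemma finite_embeddings: "finite (embeddings K)"
proof (rule ccontr)
  assume "infinite (embeddings K)"
  then obtain F where F: "F \<subseteq> embeddings K" "finite F" "card F = Suc (field_degree K)"
    using infinite_arbitrarily_large by blast
  obtain \<tau>s where "set \<tau>s = F" "distinct \<tau>s" using finite_distinct_list[OF F(2)] by blast
  then show False using distinct_embeddings_le_degree[of \<tau>s] F distinct_card[of \<tau>s] by auto
qed

lemma card_embeddings_le: "card (embeddings K) \<le> field_degree K"
proof -
  obtain \<tau>s where "set \<tau>s = embeddings K" "distinct \<tau>s"
    using finite_distinct_list[OF finite_embeddings] by blast
  then show ?thesis using distinct_embeddings_le_degree[of \<tau>s] distinct_card[of \<tau>s] by auto
qed

end

section \<open>Square linear systems\<close>

lemma index_mult_mat_vec_fun: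
  "i < m \<Longrightarrow> vec_index (mat m n (\<lambda>(i, j). A i j) *\<^sub>v vec n q) i = (\<Sum>j<n. A i j * q j)"
  by (simp add: scalar_prod_def lessThan_atLeast0)

lemma system_solvable:
  fixes A :: "nat \<Rightarrow> nat \<Rightarrow> 'a :: field"
  assumes "det (mat m m (\<lambda>(i, j). A i j)) \<noteq> 0"
  shows "\<exists>q. \<forall>i<m. (\<Sum>j<m. A i j * q j) = t i"
proof -
  define M where "M = mat m m (\<lambda>(i, j). A i j)"
  have M: "M \<in> carrier_mat m m" by (simp add: M_def)
  define w where "w = (1 / det M) \<cdot>\<^sub>v (adj_mat M *\<^sub>v vec m t)"
  have w: "w = vec m (vec_index w)" using adj_mat(1)[OF M] by (intro eq_vecI) (auto simp: w_def)
  have "M *\<^sub>v w = (1 / det M) \<cdot>\<^sub>v ((M * adj_mat M) *\<^sub>v vec m t)"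
    using M adj_mat(1)[OF M] by (simp add: w_def mult_mat_vec assoc_mult_mat_vec[of M m m "adj_mat M" m])
  also have "\<dots> = vec m t"
    using assms M by (intro eq_vecI) (auto simp: adj_mat(2)[OF M] M_def[symmetric])
  finally have *: "M *\<^sub>v w = vec m t" .
  have "(\<Sum>j<m. A i j * vec_index w j) = t i" if "i < m" for i
    using arg_cong[OF *, of "\<lambda>v. vec_index v i"] that
    by (subst (asm) w) (simp add: M_def index_mult_mat_vec_fun del: index_mult_mat_vec)
  then show ?thesis by blast
qed

lemma system_zero:
  fixes A :: "nat \<Rightarrow> nat \<Rightarrow> 'a :: idom"
  assumes "det (mat m m (\<lambda>(i, j). A i j)) \<noteq> 0" "\<And>i. i < m \<Longrightarrow> (\<Sum>j<m. A i j * q j) = 0" "j < m"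
  shows "q j = 0"
proof (rule ccontr)
  assume "q j \<noteq> 0"
  define M where "M = mat m m (\<lambda>(i, j). A i j)"
  have "M *\<^sub>v vec m q = 0\<^sub>v m"
    using assms(2) by (intro eq_vecI)
      (simp_all add: M_def index_mult_mat_vec_fun del: index_mult_mat_vec)
  moreover have "vec m q \<noteq> 0\<^sub>v m"
    using \<open>q j \<noteq> 0\<close> assms(3) by (metis index_vec index_zero_vec(1))
  moreover have "M \<in> carrier_mat m m" "vec m q \<in> carrier_vec m" by (auto simp: M_def)
  ultimately have "det M = 0" using det_0_iff_vec_prod_zero by blast
  then show False using assms(1) by (simp add: M_def)
qed

text \<open>Padding with zero rows gives a square matrix of determinant zero, and a kernel vector is
  the relation.\<close>

lemma nontrivial_relation:
  fixes A :: "nat \<Rightarrow> nat \<Rightarrow> 'a :: idom"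
  assumes "m < n"
  shows "\<exists>c. (\<exists>j<n. c j \<noteq> 0) \<and> (\<forall>i<m. (\<Sum>j<n. A i j * c j) = 0)"
proof -
  define B where "B i j = (if i < m then A i j else 0)" for i j
  define M where "M = mat n n (\<lambda>(i, j). B i j)"
  have M: "M \<in> carrier_mat n n" by (simp add: M_def)
  have "det M = 0"
    using assms by (subst laplace_expansion_row[OF M, of m]) (auto simp: M_def B_def)
  then obtain v where v: "v \<in> carrier_vec n" "v \<noteq> 0\<^sub>v n" "M *\<^sub>v v = 0\<^sub>v n"
    using det_0_iff_vec_prod_zero[OF M] by blast
  have v_eq: "v = vec n (vec_index v)" using v(1) by (intro eq_vecI) auto
  have "\<exists>j<n. vec_index v j \<noteq> 0"
  proof (rule ccontr)
    assume "\<not> ?thesis"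
    then have "v = 0\<^sub>v n" using v(1) by (intro eq_vecI) auto
    then show False using v(2) by simp
  qed
  moreover have "(\<Sum>j<n. A i j * vec_index v j) = 0" if "i < m" for i
  proof -
    have "vec_index (M *\<^sub>v vec n (vec_index v)) i = (\<Sum>j<n. B i j * vec_index v j)"
      unfolding M_def using that assms by (intro index_mult_mat_vec_fun) auto
    then show ?thesis using v(3) v_eq that assms by (simp add: B_def del: index_mult_mat_vec)
  qed
  ultimately show ?thesis by blast
qed

lemma det_mult_fun:
  "det (mat m m (\<lambda>(i, j). \<Sum>l<m. A i l * B l j)) =
   det (mat m m (\<lambda>(i, j). A i j)) * det (mat m m (\<lambda>(i, j). (B i j :: 'a :: comm_ring_1)))"
proof -
  have "mat m m (\<lambda>(i, j). \<Sum>l<m. A i l * B l j) = mat m m (\<lambda>(i, j). A i j) * mat m m (\<lambda>(i, j). B i j)"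
    by (rule eq_matI) (auto simp: scalar_prod_def lessThan_atLeast0)
  then show ?thesis by (simp add: det_mult[of _ m])
qed

text \<open>With \<open>A l i\<close> the l-th conjugate of the i-th basis element, the left entries
  are traces of products: the discriminant of a tuple is the square of its determinant of
  conjugates.\<close>

lemma det_gram:
  "det (mat m m (\<lambda>(i, j). \<Sum>l<m. A l i * A l j)) =
   (det (mat m m (\<lambda>(i, j). (A i j :: 'a :: comm_ring_1))))\<^sup>2"
proof -
  have "det (mat m m (\<lambda>(i, j). A j i)) = det (mat m m (\<lambda>(i, j). A i j))"
  proof -
    have "mat m m (\<lambda>(i, j). A j i) = transpose_mat (mat m m (\<lambda>(i, j). A i j))"
      by (rule eq_matI) auto
    then show ?thesis by (simp add: det_transpose[of _ m])
  qed
  then show ?thesis using det_mult_fun[of m "\<lambda>i l. A l i" A] by (simp add: power2_eq_square)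
qed

text \<open>Cramer's rule, in the form that measures how exchanging one basis element changes the
  determinant of conjugates.\<close>

lemma det_replace_column:
  fixes A :: "nat \<Rightarrow> nat \<Rightarrow> 'a :: comm_ring_1"
  assumes "k < m"
  shows "det (mat m m (\<lambda>(i, j). if j = k then \<Sum>l<m. A i l * x l else A i j)) =
    x k * det (mat m m (\<lambda>(i, j). A i j))"
proof -
  define M where "M = mat m m (\<lambda>(i, j). A i j)"
  have "mat m m (\<lambda>(i, j). if j = k then \<Sum>l<m. A i l * x l else A i j) =
      replace_col M (M *\<^sub>v vec m x) k"
    unfolding replace_col_def
    by (rule eq_matI) (auto simp: M_def index_mult_mat_vec_fun simp del: index_mult_mat_vec)
  then show ?thesis
    using cramer_lemma_mat[of M m "vec m x" k] assms by (simp add: M_def)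
qed

section \<open>Galois extensions\<close>

locale galois_number_field =
  fixes K :: "complex set"
  assumes galois: "galois_over_Q K"

sublocale galois_number_field \<subseteq> complex_number_field K
  using galois by (intro complex_number_field.intro complex_subfield.intro
    complex_number_field_axioms.intro) (auto simp: galois_over_Q_def number_field_def)

context galois_number_field
begin

lemma Gal_subset: "Gal K \<subseteq> embeddings K"
  by (auto simp: Gal_def embeddings_def ring_iso_def Ring.ring_hom_def)

lemma Gal_bij: "\<sigma> \<in> Gal K \<Longrightarrow> bij_betw \<sigma> K K"
  by (auto simp: Gal_def ring_iso_def)

lemma Gal_closed [intro]: "\<sigma> \<in> Gal K \<Longrightarrow> x \<in> K \<Longrightarrow> \<sigma> x \<in> K"
  using Gal_bij by (auto simp: bij_betw_def)

lemma GalI: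
  assumes "\<sigma> \<in> embeddings K" "bij_betw \<sigma> K K"
  shows "\<sigma> \<in> Gal K"
  using assms embedding_Rats[OF assms(1)] unfolding Gal_def embeddings_def ring_iso_def
  by (auto simp: Ring.ring_hom_def bij_betw_def)

lemma finite_Gal: "finite (Gal K)"
  using Gal_subset finite_embeddings by (rule finite_subset)

lemma id_in_Gal: "(\<lambda>x\<in>K. x) \<in> Gal K"
  using embeddingI[of "\<lambda>x. x"] by (intro GalI) (auto simp: bij_betw_def inj_on_def)

lemma compose_in_embeddings:
  assumes "\<tau> \<in> embeddings K" "\<sigma> \<in> Gal K"
  shows "compose K \<tau> \<sigma> \<in> embeddings K"
  unfolding compose_def using assms Gal_subset
  by (intro embeddingI) (auto simp: embedding_simps Gal_closed)

lemma compose_in_Gal: "\<sigma> \<in> Gal K \<Longrightarrow> \<tau> \<in> Gal K \<Longrightarrow> compose K \<sigma> \<tau> \<in> Gal K"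
  using Gal_bij Gal_subset
  by (intro GalI compose_in_embeddings) (auto intro: bij_betw_compose)

lemma fixed_imp_Rats: "x \<in> K \<Longrightarrow> (\<And>\<sigma>. \<sigma> \<in> Gal K \<Longrightarrow> \<sigma> x = x) \<Longrightarrow> x \<in> \<rat>"
  using galois unfolding galois_over_Q_def by blast

text \<open>Left multiplication is injective on a finite set, hence onto. Both the invariance of
  sums and products over the group and the existence of inverses are drawn from this.\<close>

lemma bij_compose_left:
  assumes "\<sigma> \<in> Gal K"
  shows "bij_betw (compose K \<sigma>) (Gal K) (Gal K)"
proof -
  have "inj_on (compose K \<sigma>) (Gal K)"
  proof (rule inj_onI)
    fix \<tau> \<tau>' assume *: "\<tau> \<in> Gal K" "\<tau>' \<in> Gal K" "compose K \<sigma> \<tau> = compose K \<sigma> \<tau>'"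
    have "\<tau> x = \<tau>' x" if "x \<in> K" for x
      using fun_cong[OF *(3), of x] that * embedding_inj_on[of \<sigma>] assms Gal_subset
      by (auto simp: compose_def dest: inj_onD)
    then show "\<tau> = \<tau>'" using * Gal_subset by (intro embedding_ext) auto
  qed
  moreover have "compose K \<sigma> ` Gal K \<subseteq> Gal K" using assms compose_in_Gal by auto
  ultimately show ?thesis using endo_inj_surj[OF finite_Gal] by (auto simp: bij_betw_def)
qed

lemma Gal_inverse:
  assumes "\<sigma> \<in> Gal K"
  obtains \<tau> where "\<tau> \<in> Gal K" "\<And>x. x \<in> K \<Longrightarrow> \<sigma> (\<tau> x) = x" "\<And>x. x \<in> K \<Longrightarrow> \<tau> (\<sigma> x) = x"
proof -
  have "(\<lambda>x\<in>K. x) \<in> compose K \<sigma> ` Gal K"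
    using bij_compose_left[OF assms] id_in_Gal by (auto simp: bij_betw_def)
  then obtain \<tau> where \<tau>: "\<tau> \<in> Gal K" "(\<lambda>x\<in>K. x) = compose K \<sigma> \<tau>" by blast
  have 1: "\<sigma> (\<tau> x) = x" if "x \<in> K" for x
    using fun_cong[OF \<tau>(2), of x] that by (simp add: compose_def)
  moreover have "\<tau> (\<sigma> x) = x" if "x \<in> K" for x
    using 1[of "\<sigma> x"] that assms \<tau>(1) embedding_inj_on[of \<sigma>] Gal_subset
    by (auto dest!: inj_onD intro!: Gal_closed)
  ultimately show ?thesis using that \<tau>(1) by blast
qed

lemma Gal_sum_Rats:
  assumes "x \<in> K"
  shows "(\<Sum>\<sigma>\<in>Gal K. \<sigma> x) \<in> \<rat>"
proof (rule fixed_imp_Rats)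
  show "(\<Sum>\<sigma>\<in>Gal K. \<sigma> x) \<in> K" using assms by auto
  fix \<tau> assume \<tau>: "\<tau> \<in> Gal K"
  have "\<tau> (\<Sum>\<sigma>\<in>Gal K. \<sigma> x) = (\<Sum>\<sigma>\<in>Gal K. compose K \<tau> \<sigma> x)"
    using \<tau> Gal_subset assms by (subst embedding_sum) (auto simp: compose_def)
  also have "\<dots> = (\<Sum>\<sigma>\<in>Gal K. \<sigma> x)"
    by (rule sum.reindex_bij_betw[OF bij_compose_left[OF \<tau>]])
  finally show "\<tau> (\<Sum>\<sigma>\<in>Gal K. \<sigma> x) = (\<Sum>\<sigma>\<in>Gal K. \<sigma> x)" .
qed

lemma Gal_prod_Rats:
  assumes "x \<in> K"
  shows "(\<Prod>\<sigma>\<in>Gal K. \<sigma> x) \<in> \<rat>"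
proof (rule fixed_imp_Rats)
  show "(\<Prod>\<sigma>\<in>Gal K. \<sigma> x) \<in> K" using assms by auto
  fix \<tau> assume \<tau>: "\<tau> \<in> Gal K"
  have "\<tau> (\<Prod>\<sigma>\<in>Gal K. \<sigma> x) = (\<Prod>\<sigma>\<in>Gal K. compose K \<tau> \<sigma> x)"
    using \<tau> Gal_subset assms by (subst embedding_prod) (auto simp: compose_def)
  also have "\<dots> = (\<Prod>\<sigma>\<in>Gal K. \<sigma> x)"
    by (rule prod.reindex_bij_betw[OF bij_compose_left[OF \<tau>]])
  finally show "\<tau> (\<Prod>\<sigma>\<in>Gal K. \<sigma> x) = (\<Prod>\<sigma>\<in>Gal K. \<sigma> x)" .
qed

section \<open>Enumeration of the Galois group and rational coordinates\<close>

lemma exists_Gal_list: "\<exists>gs. set gs = Gal K \<and> distinct gs"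
  using finite_distinct_list[OF finite_Gal] by blast

text \<open>An arbitrary but fixed enumeration, so that automorphisms can index matrix rows; its
  first entry need not be the identity.\<close>

definition Gal_list :: "(complex \<Rightarrow> complex) list" where
  "Gal_list = (SOME gs. set gs = Gal K \<and> distinct gs)"

definition ngal :: nat where "ngal = card (Gal K)"

lemma Gal_list: "set Gal_list = Gal K" "distinct Gal_list" "length Gal_list = ngal"
proof -
  show "set Gal_list = Gal K" "distinct Gal_list"
    using someI_ex[OF exists_Gal_list] by (auto simp: Gal_list_def)
  then show "length Gal_list = ngal" by (metis distinct_card ngal_def)
qed

definition gal :: "nat \<Rightarrow> complex \<Rightarrow> complex" where "gal i = Gal_list ! i"

lemma gal_in_Gal [simp, intro]: "i < ngal \<Longrightarrow> gal i \<in> Gal K"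
  using Gal_list nth_mem unfolding gal_def by metis

lemma gal_in_embeddings [simp, intro]: "i < ngal \<Longrightarrow> gal i \<in> embeddings K"
  using Gal_subset by auto

lemma bij_gal: "bij_betw gal {..<ngal} (Gal K)"
  using bij_betw_nth[OF Gal_list(2) refl Gal_list(1)[symmetric]] by (simp add: Gal_list(3) gal_def[abs_def])

lemma sum_Gal: "(\<Sum>\<sigma>\<in>Gal K. f \<sigma>) = (\<Sum>i<ngal. f (gal i))"
  using sum.reindex_bij_betw[OF bij_gal, of f] by simp

lemma ngal_pos: "ngal > 0"
  using id_in_Gal finite_Gal by (auto simp: ngal_def card_gt_0_iff)

text \<open>A square root of the discriminant of the tuple; another enumeration of the group could
  change only its sign.\<close>

definition conj_det :: "(nat \<Rightarrow> complex) \<Rightarrow> complex" where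
  "conj_det b = det (mat ngal ngal (\<lambda>(i, j). gal i (b j)))"

text \<open>The Gram matrix of the trace form is rational with determinant the square of
  \<open>conj_det b\<close>. Solving it against the traces of \<open>b i * x\<close> gives rational
  coordinates of some \<open>y\<close> for which \<open>y - x\<close> is trace-orthogonal to every
  \<open>b i\<close>.\<close>

lemma rational_coordinates:
  assumes b: "\<And>j. j < ngal \<Longrightarrow> b j \<in> K" and conj_det: "conj_det b \<noteq> 0" and x: "x \<in> K"
  shows "\<exists>q :: nat \<Rightarrow> rat. x = (\<Sum>j<ngal. of_rat (q j) * b j)"
proof -
  define Tr where "Tr y = (\<Sum>\<sigma>\<in>Gal K. \<sigma> y)" for y
  have "\<exists>r :: rat. Tr y = of_rat r" if "y \<in> K" for y
    using Gal_sum_Rats[OF that] by (auto simp: Tr_def elim: Rats_cases)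
  then obtain r :: "complex \<Rightarrow> rat" where r: "\<And>y. y \<in> K \<Longrightarrow> Tr y = of_rat (r y)" by metis
  have tr2: "Tr (b i * y) = (\<Sum>l<ngal. gal l (b i) * gal l y)" if "i < ngal" "y \<in> K" for i y
    using that b by (simp add: Tr_def sum_Gal embedding_simps)
  define T where "T i j = r (b i * b j)" for i j
  have "of_rat (det (mat ngal ngal (\<lambda>(i, j). T i j))) = (conj_det b)\<^sup>2"
  proof -
    have "of_rat (det (mat ngal ngal (\<lambda>(i, j). T i j))) =
        det (of_rat_hom.mat_hom (mat ngal ngal (\<lambda>(i, j). T i j)) :: complex mat)"
      by (simp only: of_rat_hom.hom_det)
    also have "of_rat_hom.mat_hom (mat ngal ngal (\<lambda>(i, j). T i j)) =
        mat ngal ngal (\<lambda>(i, j). \<Sum>l<ngal. gal l (b i) * gal l (b j))"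
      by (rule eq_matI) (use b in \<open>auto simp: T_def r[symmetric] tr2 mult_closed\<close>)
    finally show ?thesis by (simp add: det_gram conj_det_def)
  qed
  then have "det (mat ngal ngal (\<lambda>(i, j). T i j)) \<noteq> 0" using conj_det by auto
  then obtain q where q: "\<And>i. i < ngal \<Longrightarrow> (\<Sum>j<ngal. T i j * q j) = r (b i * x)"
    using system_solvable[of ngal T "\<lambda>i. r (b i * x)"] by blast
  define y where "y = (\<Sum>j<ngal. of_rat (q j) * b j)"
  have y: "y \<in> K" unfolding y_def using b by (auto intro!: sum_closed mult_closed Rats_closed[OF Rats_of_rat])
  \<comment> \<open>The conjugates of \<open>y - x\<close> solve a homogeneous system with nonzero
    determinant. One vanishing conjugate is enough, because embeddings are injective.\<close>
  have "gal 0 (y - x) = 0" if "0 < ngal"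
  proof (rule system_zero[OF _ _ that, where q = "\<lambda>l. gal l (y - x)"])
    show "det (mat ngal ngal (\<lambda>(i, l). gal l (b i))) \<noteq> 0"
    proof -
      have "mat ngal ngal (\<lambda>(i, l). gal l (b i)) = transpose_mat (mat ngal ngal (\<lambda>(i, j). gal i (b j)))"
        by (rule eq_matI) auto
      then show ?thesis using conj_det by (simp add: det_transpose[of _ ngal] conj_det_def)
    qed
    fix i assume i: "i < ngal"
    have "(\<Sum>l<ngal. gal l (b i) * gal l y) = (\<Sum>l<ngal. \<Sum>j<ngal. of_rat (q j) * (gal l (b i) * gal l (b j)))"
    proof (rule sum.cong[OF refl])
      fix l assume "l \<in> {..<ngal}"
      then have l: "gal l \<in> embeddings K" by simp
      have "gal l y = (\<Sum>j<ngal. gal l (of_rat (q j) * b j))"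
        unfolding y_def using b by (intro embedding_sum[OF l]) (auto intro: Rats_closed[OF Rats_of_rat])
      also have "\<dots> = (\<Sum>j<ngal. of_rat (q j) * gal l (b j))"
        using b by (intro sum.cong refl) (auto simp: embedding_simps[OF l] Rats_closed embedding_Rats[OF l])
      finally show "gal l (b i) * gal l y = (\<Sum>j<ngal. of_rat (q j) * (gal l (b i) * gal l (b j)))"
        by (simp add: sum_distrib_left mult_ac)
    qed
    also have "\<dots> = (\<Sum>j<ngal. of_rat (q j) * (\<Sum>l<ngal. gal l (b i) * gal l (b j)))"
      by (subst sum.swap) (simp add: sum_distrib_left)
    also have "\<dots> = (\<Sum>j<ngal. of_rat (q j) * of_rat (T i j))"
      using b i by (intro sum.cong refl) (simp add: T_def r[symmetric] tr2 mult_closed)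
    also have "\<dots> = of_rat (\<Sum>j<ngal. T i j * q j)" by (simp add: of_rat_sum of_rat_mult mult_ac)
    also have "\<dots> = (\<Sum>l<ngal. gal l (b i) * gal l x)"
      using b i x by (simp add: q r[symmetric] tr2 mult_closed)
    finally show "(\<Sum>l<ngal. gal l (b i) * gal l (y - x)) = 0"
      using x y by (simp add: embedding_diff right_diff_distrib sum_subtractf)
  qed
  then have "y = x" using ngal_pos x y by (simp add: embedding_eq_0_iff diff_closed)
  then show ?thesis using y_def by blast
qed

lemma exists_field_basis: "\<exists>b. (\<forall>j<ngal. b j \<in> K) \<and> conj_det b \<noteq> 0"
proof -
  have "\<exists>b. (\<forall>j<ngal. b j \<in> K) \<and> det (mat ngal ngal (\<lambda>(i, j). (Gal_list ! i) (b j))) \<noteq> 0"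
  proof (rule exists_nonzero_minor[OF Gal_list(2), where mul = "(*)" and e = 1])
    fix \<tau> \<tau>' assume "\<tau> \<in> set Gal_list" "\<tau>' \<in> set Gal_list" "\<tau> \<noteq> \<tau>'"
    then show "\<exists>x\<in>K. \<tau> x \<noteq> \<tau>' x" using embedding_ext Gal_subset Gal_list(1) by blast
  qed (use Gal_subset Gal_list embedding_simps in auto)
  then show ?thesis by (simp add: conj_det_def gal_def)
qed

text \<open>With more embeddings than automorphisms, some nontrivial combination of embeddings would
  vanish on the \<open>ngal\<close> elements of a basis, hence by rational coordinates on all of
  \<open>K\<close>, against independence.\<close>

lemma embeddings_eq_Gal: "embeddings K = Gal K"
proof (rule ccontr)
  assume "embeddings K \<noteq> Gal K"
  then have "card (Gal K) < card (embeddings K)"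
    using Gal_subset finite_embeddings by (intro psubset_card_mono) auto
  define n where "n = card (embeddings K)"
  obtain \<tau>s where \<tau>s: "set \<tau>s = embeddings K" "distinct \<tau>s"
    using finite_distinct_list[OF finite_embeddings] by blast
  have len: "length \<tau>s = n" using \<tau>s by (metis distinct_card n_def)
  obtain b where b: "\<forall>j<ngal. b j \<in> K" "conj_det b \<noteq> 0" using exists_field_basis by blast
  obtain c where c: "\<exists>j<n. c j \<noteq> 0" "\<forall>i<ngal. (\<Sum>j<n. (\<tau>s ! j) (b i) * c j) = 0"
    using nontrivial_relation[of ngal n "\<lambda>i j. (\<tau>s ! j) (b i)"] \<open>card (Gal K) < _\<close>
    by (auto simp: ngal_def n_def)
  have bij: "bij_betw ((!) \<tau>s) {..<n} (embeddings K)"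
    using bij_betw_nth[OF \<tau>s(2) refl \<tau>s(1)[symmetric]] by (simp add: len)
  define c' where "c' \<tau> = c (the_inv_into {..<n} ((!) \<tau>s) \<tau>)" for \<tau>
  have c': "c' (\<tau>s ! j) = c j" if "j < n" for j
    using the_inv_into_f_f[of "(!) \<tau>s" "{..<n}"] bij that by (simp add: c'_def bij_betw_def)
  have zero: "(\<Sum>\<tau>\<in>embeddings K. c' \<tau> * \<tau> (b i)) = 0" if "i < ngal" for i
  proof -
    have "(\<Sum>\<tau>\<in>embeddings K. c' \<tau> * \<tau> (b i)) = (\<Sum>j<n. c' (\<tau>s ! j) * (\<tau>s ! j) (b i))"
      using sum.reindex_bij_betw[OF bij, of "\<lambda>\<tau>. c' \<tau> * \<tau> (b i)"] by simp
    also have "\<dots> = 0" using c(2) that by (simp add: c' mult.commute)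
    finally show ?thesis .
  qed
  have "\<forall>\<tau>\<in>embeddings K. c' \<tau> = 0"
  proof (rule independence_of_characters[where K = K and mul = "(*)" and e = 1, OF finite_embeddings])
    fix x assume "x \<in> K"
    then obtain q :: "nat \<Rightarrow> rat" where q: "x = (\<Sum>j<ngal. of_rat (q j) * b j)"
      using rational_coordinates b by blast
    have "(\<Sum>\<tau>\<in>embeddings K. c' \<tau> * \<tau> x) =
        (\<Sum>\<tau>\<in>embeddings K. \<Sum>j<ngal. of_rat (q j) * (c' \<tau> * \<tau> (b j)))"
    proof (rule sum.cong[OF refl])
      fix \<tau> assume \<tau>: "\<tau> \<in> embeddings K"
      have "\<tau> x = (\<Sum>j<ngal. \<tau> (of_rat (q j) * b j))"
        unfolding q using b by (intro embedding_sum[OF \<tau>]) (auto intro: Rats_closed[OF Rats_of_rat])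
      also have "\<dots> = (\<Sum>j<ngal. of_rat (q j) * \<tau> (b j))"
        using b by (intro sum.cong refl) (auto simp: embedding_simps[OF \<tau>] Rats_closed embedding_Rats[OF \<tau>])
      finally show "c' \<tau> * \<tau> x = (\<Sum>j<ngal. of_rat (q j) * (c' \<tau> * \<tau> (b j)))"
        by (simp add: sum_distrib_left mult_ac)
    qed
    also have "\<dots> = (\<Sum>j<ngal. of_rat (q j) * (\<Sum>\<tau>\<in>embeddings K. c' \<tau> * \<tau> (b j)))"
      by (subst sum.swap) (simp add: sum_distrib_left)
    also have "\<dots> = 0" using zero by simp
    finally show "(\<Sum>\<tau>\<in>embeddings K. c' \<tau> * \<tau> x) = 0" .
  next
    fix \<tau> \<tau>' assume "\<tau> \<in> embeddings K" "\<tau>' \<in> embeddings K" "\<tau> \<noteq> \<tau>'"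
    then show "\<exists>x\<in>K. \<tau> x \<noteq> \<tau>' x" using embedding_ext by blast
  qed (use embedding_simps in auto)
  then have "c j = 0" if "j < n" for j
    using c'[OF that] bij that by (metis bij_betwE lessThan_iff)
  then show False using c(1) by blast
qed

lemma ngal_le_degree: "ngal \<le> field_degree K"
  using card_embeddings_le by (simp add: ngal_def embeddings_eq_Gal)

end

section \<open>The ring of integers\<close>

lemma common_denominator:
  assumes "finite Q"
  shows "\<exists>N>0. \<forall>r\<in>Q. \<exists>k. of_nat N * (r :: rat) = of_int k"
  using assms
proof (induction Q)
  case (insert r Q)
  then obtain N where N: "N > 0" "\<forall>r\<in>Q. \<exists>k. of_nat N * r = of_int k" by blast
  obtain a b where r: "r = of_int a / of_int b" "b > 0"
    by (metis quotient_of_div quotient_of_denom_pos surj_pair)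
  show ?case
  proof (intro exI[of _ "N * nat b"] conjI ballI)
    fix s assume "s \<in> insert r Q"
    then consider "s = r" | "s \<in> Q" by blast
    then show "\<exists>k. of_nat (N * nat b) * s = of_int k"
    proof cases
      case 1
      then show ?thesis using r by (intro exI[of _ "int N * a"]) simp
    next
      case 2
      then obtain k where "of_nat N * s = of_int k" using N by blast
      then have "of_nat (N * nat b) * s = of_int (k * b)" using r(2) by (simp add: mult_ac)
      then show ?thesis by blast
    qed
  qed (use N r in auto)
qed (auto intro: exI[of _ 1])

context complex_subfield
begin

lemma embedding_algebraic_int:
  assumes "\<tau> \<in> embeddings K" "x \<in> K" "algebraic_int x"
  shows "algebraic_int (\<tau> x)"
proof -
  obtain p :: "int poly" where p: "poly (of_int_poly p) x = 0" "monic p"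
    using assms(3) unfolding algebraic_int_altdef_ipoly by blast
  have "\<tau> (poly (of_int_poly p) x) = poly (of_int_poly p) (\<tau> x)"
    using assms(2) by (simp add: poly_altdef embedding_sum[OF assms(1)] embedding_simps[OF assms(1)]
      embedding_power[OF assms(1)] embedding_of_int[OF assms(1)] mult_closed power_closed)
  then show ?thesis
    using p embedding_simps(4)[OF assms(1)] unfolding algebraic_int_altdef_ipoly by auto
qed

abbreviation "\<O> \<equiv> integers K"

lemma integers_in_K [intro]: "x \<in> \<O> \<Longrightarrow> x \<in> K"
  by (simp add: integers_def)

lemma integers_add [intro]: "x \<in> \<O> \<Longrightarrow> y \<in> \<O> \<Longrightarrow> x + y \<in> \<O>"
  and integers_mult [intro]: "x \<in> \<O> \<Longrightarrow> y \<in> \<O> \<Longrightarrow> x * y \<in> \<O>"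
  and integers_uminus [intro]: "x \<in> \<O> \<Longrightarrow> - x \<in> \<O>"
  and integers_of_int [simp, intro]: "of_int k \<in> \<O>"
  by (auto simp: integers_def intro: algebraic_int_add algebraic_int_times int_imp_algebraic_int)

lemma integers_of_nat [simp, intro]: "of_nat n \<in> \<O>"
  and integers_0 [simp, intro]: "0 \<in> \<O>"
  and integers_1 [simp, intro]: "1 \<in> \<O>"
  using integers_of_int[of "int n"] integers_of_int[of 0] integers_of_int[of 1] by simp_all

lemma integers_diff [intro]: "x \<in> \<O> \<Longrightarrow> y \<in> \<O> \<Longrightarrow> x - y \<in> \<O>"
  using integers_add[of x "- y"] by auto

lemma integers_power [intro]: "x \<in> \<O> \<Longrightarrow> x ^ n \<in> \<O>"
  by (induction n) auto

lemma integers_sum [intro]: "(\<And>i. i \<in> I \<Longrightarrow> f i \<in> \<O>) \<Longrightarrow> sum f I \<in> \<O>"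
  by (induction I rule: infinite_finite_induct) auto

lemma integers_prod [intro]: "(\<And>i. i \<in> I \<Longrightarrow> f i \<in> \<O>) \<Longrightarrow> prod f I \<in> \<O>"
  by (induction I rule: infinite_finite_induct) auto

lemma integers_Rats: "x \<in> \<O> \<Longrightarrow> x \<in> \<rat> \<Longrightarrow> x \<in> \<int>"
  by (simp add: integers_def rational_algebraic_int_is_int)

end

context galois_number_field
begin

lemma Gal_integers [intro]: "\<sigma> \<in> Gal K \<Longrightarrow> x \<in> \<O> \<Longrightarrow> \<sigma> x \<in> \<O>"
  using embedding_algebraic_int[of \<sigma> x] Gal_subset Gal_closed[of \<sigma> x] by (auto simp: integers_def)

lemma basis_nontrivial:
  assumes "\<forall>j<ngal. b j \<in> K" "conj_det b \<noteq> 0"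
  shows "\<exists>j<ngal. b j \<noteq> 0"
proof (rule ccontr)
  assume "\<not> ?thesis"
  moreover obtain q :: "nat \<Rightarrow> rat" where "1 = (\<Sum>j<ngal. of_rat (q j) * b j)"
    using rational_coordinates[of b 1] assms by auto
  ultimately show False by simp
qed

text \<open>Clearing the denominators of the matrix of multiplication by \<open>x\<close> makes the
  integral span of a basis stable, and the determinant criterion applies.\<close>

lemma integer_multiple:
  assumes "x \<in> K"
  shows "\<exists>n>0. of_nat n * x \<in> \<O>"
proof -
  obtain b where b: "\<forall>j<ngal. b j \<in> K" "conj_det b \<noteq> 0" using exists_field_basis by blast
  have "\<forall>j\<in>{..<ngal}. \<exists>q :: nat \<Rightarrow> rat. x * b j = (\<Sum>l<ngal. of_rat (q l) * b l)"
    using rational_coordinates[of b] b assms mult_closed by blast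
  then obtain q :: "nat \<Rightarrow> nat \<Rightarrow> rat"
    where q: "\<And>j. j < ngal \<Longrightarrow> x * b j = (\<Sum>l<ngal. of_rat (q j l) * b l)"
    unfolding bchoice_iff by auto
  have "finite ((\<lambda>(j, l). q j l) ` ({..<ngal} \<times> {..<ngal}))" by simp
  from common_denominator[OF this] obtain N where N: "N > 0"
    "\<And>j l. j < ngal \<Longrightarrow> l < ngal \<Longrightarrow> \<exists>k. of_nat N * q j l = of_int k" by auto
  have "algebraic_int (of_nat N * x)"
  proof (rule algebraic_int_if_module[of "b ` {..<ngal}"])
    show "\<exists>v\<in>b ` {..<ngal}. v \<noteq> 0" using basis_nontrivial[OF b] by blast
    fix v assume "v \<in> b ` {..<ngal}"
    then obtain j where j: "j < ngal" "v = b j" by blast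
    have "of_nat N * x * v = (\<Sum>l<ngal. of_rat (of_nat N * q j l) * b l)"
      using q[OF j(1)] by (simp add: j(2) mult.assoc sum_distrib_left of_rat_mult)
    also have "\<dots> \<in> int_span (b ` {..<ngal})"
    proof (rule int_span_sum)
      fix l assume l: "l \<in> {..<ngal}"
      obtain k where "of_nat N * q j l = of_int k" using N(2)[of j l] l j by auto
      then show "of_rat (of_nat N * q j l) * b l \<in> int_span (b ` {..<ngal})"
        using l by (simp only: of_rat_of_int_eq) (intro int_span_smult int_span_incl, auto)
    qed
    finally show "of_nat N * x * v \<in> int_span (b ` {..<ngal})" .
  qed simp
  then show ?thesis using N(1) assms by (auto simp: integers_def)
qed

section \<open>Norm and trace of integral elements\<close>

definition Nm :: "complex \<Rightarrow> complex" where "Nm x = (\<Prod>\<sigma>\<in>Gal K. \<sigma> x)"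

lemma field_norm_eq: "field_norm K x = Nm x"
  by (simp add: field_norm_def Nm_def embeddings_eq_Gal)

lemma Nm_Ints: "x \<in> \<O> \<Longrightarrow> Nm x \<in> \<int>"
  unfolding Nm_def by (rule integers_Rats) (auto intro: Gal_prod_Rats)

lemma Nm_mult: "x \<in> K \<Longrightarrow> y \<in> K \<Longrightarrow> Nm (x * y) = Nm x * Nm y"
  unfolding Nm_def prod.distrib[symmetric]
  using Gal_subset by (intro prod.cong refl) (auto simp: embedding_simps)

lemma Nm_eq_0_iff: "x \<in> K \<Longrightarrow> Nm x = 0 \<longleftrightarrow> x = 0"
  using Gal_subset id_in_Gal finite_Gal embedding_eq_0_iff unfolding Nm_def prod_zero_iff[OF finite_Gal]
  by blast

lemma Nm_multiple:
  assumes "x \<in> \<O>"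
  shows "\<exists>y\<in>\<O>. Nm x = x * y"
proof
  show "Nm x = x * (\<Prod>\<sigma>\<in>Gal K - {\<lambda>x\<in>K. x}. \<sigma> x)"
    unfolding Nm_def using prod.remove[OF finite_Gal id_in_Gal, of "\<lambda>\<sigma>. \<sigma> x"] assms by auto
qed (use assms in auto)

lemma positive_integer_multiple:
  assumes "x \<in> \<O>" "x \<noteq> 0"
  shows "\<exists>N>0. \<exists>y\<in>\<O>. of_nat N = x * y"
proof -
  obtain y where y: "y \<in> \<O>" "Nm x = x * y" using Nm_multiple[OF assms(1)] by blast
  obtain k where k: "Nm x = of_int k" using Nm_Ints[OF assms(1)] by (auto elim: Ints_cases)
  have "k \<noteq> 0" using k Nm_eq_0_iff[OF integers_in_K[OF assms(1)]] assms(2) by auto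
  have "of_nat (nat \<bar>k\<bar>) = x * (if k \<ge> 0 then y else - y)"
    using y k by (simp add: of_nat_nat)
  then show ?thesis using y(1) \<open>k \<noteq> 0\<close>
    by (intro exI[of _ "nat \<bar>k\<bar>"] conjI bexI[of _ "if k \<ge> 0 then y else - y"]) auto
qed

definition Tr :: "complex \<Rightarrow> complex" where "Tr x = (\<Sum>\<sigma>\<in>Gal K. \<sigma> x)"

lemma field_trace_eq: "field_trace K x = Tr x"
  by (simp add: field_trace_def Tr_def embeddings_eq_Gal)

lemma Tr_Ints: "x \<in> \<O> \<Longrightarrow> Tr x \<in> \<int>"
  unfolding Tr_def by (rule integers_Rats) (auto intro: Gal_sum_Rats)

lemma det_trace:
  assumes b: "\<And>j. j < ngal \<Longrightarrow> b j \<in> K"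
  shows "det (mat ngal ngal (\<lambda>(i, j). Tr (b i * b j))) = (conj_det b)\<^sup>2"
proof -
  have "mat ngal ngal (\<lambda>(i, j). Tr (b i * b j)) = mat ngal ngal (\<lambda>(i, j). \<Sum>l<ngal. gal l (b i) * gal l (b j))"
    by (rule eq_matI) (use b in \<open>auto simp: Tr_def sum_Gal embedding_simps\<close>)
  then show ?thesis by (simp add: det_gram conj_det_def)
qed

lemma trace_matrix:
  assumes b: "\<And>j. j < ngal \<Longrightarrow> b j \<in> \<O>"
  shows "\<exists>T :: nat \<Rightarrow> nat \<Rightarrow> int. (\<forall>i<ngal. \<forall>j<ngal. Tr (b i * b j) = of_int (T i j)) \<and>
    of_int (det (mat ngal ngal (\<lambda>(i, j). T i j))) = (conj_det b)\<^sup>2"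
proof -
  \<comment> \<open>The traces are rational integers, so the floor of the real part recovers them as
    values of type \<open>int\<close>.\<close>
  define T where "T i j = \<lfloor>Re (Tr (b i * b j))\<rfloor>" for i j
  have T: "Tr (b i * b j) = of_int (T i j)" if "i < ngal" "j < ngal" for i j
    using Tr_Ints[OF integers_mult[OF b[OF that(1)] b[OF that(2)]]]
    by (auto simp: T_def elim!: Ints_cases)
  have "of_int (det (mat ngal ngal (\<lambda>(i, j). T i j))) =
      det (of_int_hom.mat_hom (mat ngal ngal (\<lambda>(i, j). T i j)) :: complex mat)"
    by (simp only: of_int_hom.hom_det)
  also have "of_int_hom.mat_hom (mat ngal ngal (\<lambda>(i, j). T i j)) = mat ngal ngal (\<lambda>(i, j). Tr (b i * b j))"
    by (rule eq_matI) (auto simp: T)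
  also have "det \<dots> = (conj_det b)\<^sup>2" using b by (intro det_trace) auto
  finally show ?thesis using T by (intro exI[of _ T]) simp
qed

section \<open>Integral bases\<close>

lemma conj_det_square_Ints:
  assumes b: "\<And>j. j < ngal \<Longrightarrow> b j \<in> \<O>"
  shows "\<exists>D :: int. (conj_det b)\<^sup>2 = of_int D"
proof -
  obtain T :: "nat \<Rightarrow> nat \<Rightarrow> int"
    where T: "(\<forall>i<ngal. \<forall>j<ngal. Tr (b i * b j) = of_int (T i j)) \<and>
      of_int (det (mat ngal ngal (\<lambda>(i, j). T i j))) = (conj_det b)\<^sup>2"
    using trace_matrix[of b, OF b] by (rule exE)
  then show ?thesis by (intro exI[of _ "det (mat ngal ngal (\<lambda>(i, j). T i j))"]) simp
qed

text \<open>The length is left free: the basis chosen inside \<open>discriminant\<close> comes with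
  an unknown length, identified with \<open>ngal\<close> only by
  \<open>zbasis_length\<close>.\<close>

definition zbasis :: "(nat \<Rightarrow> complex) \<Rightarrow> nat \<Rightarrow> bool" where
  "zbasis b r \<longleftrightarrow> (\<forall>j<r. b j \<in> \<O>) \<and> (\<forall>x\<in>\<O>. \<exists>c :: nat \<Rightarrow> int. x = (\<Sum>j<r. of_int (c j) * b j)) \<and>
     (\<forall>c :: nat \<Rightarrow> int. (\<Sum>j<r. of_int (c j) * b j) = 0 \<longrightarrow> (\<forall>j<r. c j = 0))"

lemma zbasis_unique:
  assumes "zbasis b r" "(\<Sum>j<r. of_int (c j) * b j) = (\<Sum>j<r. of_int (d j) * b j)" "j < r"
  shows "c j = (d j :: int)"
proof -
  have "(\<Sum>j<r. of_int (c j - d j) * b j) = 0"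
    using assms(2) by (simp add: left_diff_distrib sum_subtractf)
  then have "c j - d j = 0"
    using assms(1,3) unfolding zbasis_def by (elim conjE allE[of _ "\<lambda>j. c j - d j"]) simp
  then show ?thesis by simp
qed

lemma gal_combination:
  assumes "i < ngal" "\<And>j. j \<in> J \<Longrightarrow> b j \<in> K"
  shows "gal i (\<Sum>j\<in>J. of_int (c j) * b j) = (\<Sum>j\<in>J. of_int (c j) * gal i (b j))"
  using assms
  by (subst embedding_sum, simp, blast) (simp add: embedding_simps embedding_of_int cong: sum.cong)

lemma gal_rat_combination:
  assumes "i < ngal" "\<And>j. j \<in> J \<Longrightarrow> b j \<in> K"
  shows "gal i (\<Sum>j\<in>J. of_rat (c j) * b j) = (\<Sum>j\<in>J. of_rat (c j) * gal i (b j))"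
  using assms Rats_closed[OF Rats_of_rat]
  by (subst embedding_sum, simp, blast) (simp add: embedding_simps embedding_Rats cong: sum.cong)

text \<open>An integral basis is a tuple of integers whose discriminant has minimal nonzero absolute value:
  a non-integral coordinate could be reduced to its fractional part, which shrinks the
  discriminant.\<close>

lemma exists_zbasis: "\<exists>b. zbasis b ngal \<and> conj_det b \<noteq> 0"
proof -
  \<comment> \<open>Absolute values of discriminants are recorded as natural numbers, which makes a
    least one available.\<close>
  define P where "P n \<longleftrightarrow> (\<exists>b D. (\<forall>j<ngal. b j \<in> \<O>) \<and> conj_det b \<noteq> 0 \<and> (conj_det b)\<^sup>2 = of_int D \<and> n = nat \<bar>D\<bar>)"
    for n
  have "\<exists>n. P n"
  proof -
    obtain b where b: "\<forall>j<ngal. b j \<in> K" "conj_det b \<noteq> 0" using exists_field_basis by blast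
    have "\<forall>j\<in>{..<ngal}. \<exists>n>0. of_nat n * b j \<in> \<O>" using integer_multiple b by blast
    then obtain n where n: "\<And>j. j < ngal \<Longrightarrow> n j > 0" "\<And>j. j < ngal \<Longrightarrow> of_nat (n j) * b j \<in> \<O>"
      unfolding bchoice_iff by auto
    define b' where "b' j = of_nat (n j) * b j" for j
    have "conj_det b' \<noteq> 0"
    proof
      assume "conj_det b' = 0"
      \<comment> \<open>Scaling the columns is multiplication by a diagonal matrix, so the
        determinant changes by the product of the \<open>n j\<close>.\<close>
      have "conj_det b' = det (mat ngal ngal (\<lambda>(i, j). \<Sum>l<ngal. gal i (b l) * (if l = j then of_nat (n j) else 0)))"
        unfolding conj_det_def
        by (intro arg_cong[where f = det] eq_matI)
           (use b in \<open>auto simp: b'_def embedding_simps embedding_of_nat if_distrib cong: if_cong\<close>)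
      also have "\<dots> = conj_det b * det (mat ngal ngal (\<lambda>(i, j). if i = j then of_nat (n j) else 0))"
        by (simp add: det_mult_fun conj_det_def)
      also have "det (mat ngal ngal (\<lambda>(i, j). if i = j then of_nat (n j) else 0)) =
          (\<Prod>j<ngal. of_nat (n j) :: complex)"
        by (subst det_upper_triangular[of _ ngal])
          (auto simp: diag_mat_def prod.list_conv_set_nth lessThan_atLeast0 intro!: prod.cong)
      finally have "(\<Prod>j<ngal. of_nat (n j) :: complex) = 0" using b(2) \<open>conj_det b' = 0\<close> by simp
      then show False by (auto dest!: n(1))
    qed
    moreover have b': "\<And>j. j < ngal \<Longrightarrow> b' j \<in> \<O>" using n by (simp add: b'_def)
    moreover obtain D where "(conj_det b')\<^sup>2 = of_int D"
      using conj_det_square_Ints[of b', OF b'] by blast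
    ultimately have "P (nat \<bar>D\<bar>)"
      unfolding P_def by (intro exI[of _ b'] exI[of _ D] conjI allI impI refl) simp_all
    then show ?thesis by blast
  qed
  define n where "n = (LEAST n. P n)"
  have "P n" using \<open>\<exists>n. P n\<close> unfolding n_def by (rule LeastI_ex)
  then obtain b D where b: "\<And>j. j < ngal \<Longrightarrow> b j \<in> \<O>" "conj_det b \<noteq> 0" "(conj_det b)\<^sup>2 = of_int D" "n = nat \<bar>D\<bar>"
    unfolding P_def by blast
  have least: "nat \<bar>D\<bar> \<le> nat \<bar>E\<bar>" if "\<And>j. j < ngal \<Longrightarrow> c j \<in> \<O>" "conj_det c \<noteq> 0" "(conj_det c)\<^sup>2 = of_int E" for c E
  proof -
    have "P (nat \<bar>E\<bar>)"
      unfolding P_def using that by (intro exI[of _ c] exI[of _ E] conjI allI impI refl) simp_all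
    then show ?thesis unfolding b(4)[symmetric] n_def by (rule Least_le)
  qed
  have span: "\<exists>c :: nat \<Rightarrow> int. x = (\<Sum>j<ngal. of_int (c j) * b j)" if x: "x \<in> \<O>" for x
  proof -
    obtain q :: "nat \<Rightarrow> rat" where q: "x = (\<Sum>j<ngal. of_rat (q j) * b j)"
      using rational_coordinates[of b x] b x by auto
    have "q k \<in> \<int>" if k: "k < ngal" for k
    proof (rule ccontr)
      assume "q k \<notin> \<int>"
      define y where "y = (\<Sum>j<ngal. of_rat (frac (q j)) * b j)"
      have "y = x - (\<Sum>j<ngal. of_int \<lfloor>q j\<rfloor> * b j)"
        by (simp add: y_def q frac_def of_rat_diff left_diff_distrib sum_subtractf)
      then have y: "y \<in> \<O>" using x b(1) by (auto intro!: integers_diff integers_sum integers_mult)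
      define c where "c j = (if j = k then y else b j)" for j
      have c: "\<And>j. j < ngal \<Longrightarrow> c j \<in> \<O>" using y b(1) by (simp add: c_def)
      have "conj_det c = of_rat (frac (q k)) * conj_det b"
      proof -
        have gy: "gal i y = (\<Sum>l<ngal. gal i (b l) * of_rat (frac (q l)))" if "i < ngal" for i
          unfolding y_def
          by (subst gal_rat_combination[OF that]) (simp add: b(1) integers_in_K, simp add: mult.commute)
        have "conj_det c = det (mat ngal ngal (\<lambda>(i, j). if j = k then \<Sum>l<ngal. gal i (b l) * of_rat (frac (q l))
            else gal i (b j)))"
          unfolding conj_det_def
          by (intro arg_cong[where f = det] eq_matI)
             (auto simp: c_def gy)
        also have "\<dots> = of_rat (frac (q k)) * conj_det b"
          using det_replace_column[OF k, of "\<lambda>i j. gal i (b j)"] by (simp add: conj_det_def)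
        finally show ?thesis .
      qed
      moreover obtain E where E: "(conj_det c)\<^sup>2 = of_int E"
        using conj_det_square_Ints[of c, OF c] by blast
      \<comment> \<open>The discriminant is multiplied by the square of the fractional part. The
        identity is moved from the complex to the rational numbers, where sizes can be
        compared.\<close>
      ultimately have "of_rat (of_int E) = (of_rat ((frac (q k))\<^sup>2 * of_int D) :: complex)"
        using b(3) by (simp add: power_mult_distrib of_rat_mult of_rat_power)
      then have ED: "of_int E = (frac (q k))\<^sup>2 * (of_int D :: rat)" by (simp only: of_rat_eq_iff) 
      have f: "0 < frac (q k)" "frac (q k) < 1"
        using \<open>q k \<notin> \<int>\<close> by (simp_all add: frac_gt_0_iff frac_lt_1)
      have "conj_det c \<noteq> 0" using \<open>conj_det c = _\<close> f b(2) by simp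
      then have "nat \<bar>D\<bar> \<le> nat \<bar>E\<bar>" using least[of c, OF c _ E] by simp
      then have "\<bar>of_int D :: rat\<bar> \<le> \<bar>of_int E\<bar>" by linarith
      also have "\<dots> = (frac (q k))\<^sup>2 * \<bar>of_int D\<bar>" by (simp add: ED abs_mult)
      also have "\<dots> < 1 * \<bar>of_int D\<bar>"
        using f b(2,3) by (intro mult_strict_right_mono) (auto simp: power_less_one_iff)
      finally show False by simp
    qed
    then have "of_rat (q j) = (of_int \<lfloor>q j\<rfloor> :: complex)" if "j < ngal" for j
      using that by (metis Ints_cases floor_of_int of_rat_of_int_eq)
    then show ?thesis using q by (intro exI[of _ "\<lambda>j. \<lfloor>q j\<rfloor>"]) simp
  qed
  have "c j = 0" if "(\<Sum>j<ngal. of_int (c j) * b j) = 0" "j < ngal" for c :: "nat \<Rightarrow> int" and j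
  proof -
    have "of_int (c j) = (0 :: complex)"
    proof (rule system_zero[OF _ _ that(2), where q = "\<lambda>j. of_int (c j)"])
      show "det (mat ngal ngal (\<lambda>(i, j). gal i (b j))) \<noteq> 0" using b(2) by (simp add: conj_det_def)
      fix i assume i: "i < ngal"
      have "(\<Sum>j<ngal. gal i (b j) * of_int (c j)) = gal i (\<Sum>j<ngal. of_int (c j) * b j)"
        using b(1) i by (subst gal_combination) (auto simp: mult.commute)
      also have "\<dots> = 0" using that(1) i by (simp add: embedding_simps)
      finally show "(\<Sum>j<ngal. gal i (b j) * of_int (c j)) = 0" .
    qed
    then show ?thesis by simp
  qed
  then have "zbasis b ngal" using b(1) span unfolding zbasis_def by simp
  then show ?thesis using b(2) by blast
qed


section \<open>Residue systems\<close>

definition coords :: "(nat \<Rightarrow> complex) \<Rightarrow> nat \<Rightarrow> complex \<Rightarrow> nat \<Rightarrow> int" where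
  "coords b r x = (SOME c. x = (\<Sum>j<r. of_int (c j) * b j))"

lemma coords: "zbasis b r \<Longrightarrow> x \<in> \<O> \<Longrightarrow> x = (\<Sum>j<r. of_int (coords b r x j) * b j)"
proof -
  assume "zbasis b r" "x \<in> \<O>"
  then have ex: "\<exists>c :: nat \<Rightarrow> int. x = (\<Sum>j<r. of_int (c j) * b j)" by (simp add: zbasis_def)
  show ?thesis using someI_ex[OF ex] by (simp only: coords_def)
qed

text \<open>An upper bound for the index of \<open>I\<close> in \<O>, stated through
  representatives. In this one-sided form it passes to larger ideals and to conjugates and
  multiplies along chains, by elementary manipulations of finite sets.\<close>

definition covered :: "complex set \<Rightarrow> nat \<Rightarrow> bool" where
  "covered I N \<longleftrightarrow> (\<exists>R\<subseteq>\<O>. finite R \<and> card R \<le> N \<and> (\<forall>x\<in>\<O>. \<exists>r\<in>R. x - r \<in> I))"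

lemma principal_idealI: "x \<in> \<O> \<Longrightarrow> x * a \<in> principal_ideal K a"
  by (auto simp: principal_ideal_def)

lemma covered_of_nat:
  assumes b: "zbasis b r" and t: "t > 0"
  shows "covered (principal_ideal K (of_nat t)) (t ^ r)"
proof -
  define F where "F = {..<r} \<rightarrow>\<^sub>E {0..<int t}"
  define \<phi> where "\<phi> c = (\<Sum>j<r. of_int (c j) * b j)" for c :: "nat \<Rightarrow> int"
  have F: "finite F" "card F = t ^ r" by (auto simp: F_def card_PiE intro!: finite_PiE)
  have b_int: "b j \<in> \<O>" if "j < r" for j using b that by (simp add: zbasis_def)
  have \<phi>: "\<phi> c \<in> \<O>" for c unfolding \<phi>_def using b_int by (intro integers_sum integers_mult) auto
  show ?thesis
    unfolding covered_def
  proof (intro exI[of _ "\<phi> ` F"] conjI ballI)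
    show "card (\<phi> ` F) \<le> t ^ r" using card_image_le[OF F(1), of \<phi>] F(2) by simp
    fix x assume "x \<in> \<O>"
    define c where "c = coords b r x"
    have c: "x = (\<Sum>j<r. of_int (c j) * b j)"
      unfolding c_def using b \<open>x \<in> \<O>\<close> by (rule coords)
    define d where "d = (\<lambda>j\<in>{..<r}. c j mod int t)"
    have "x - \<phi> d = (\<Sum>j<r. (of_int (c j) - of_int (c j mod int t)) * b j)"
      by (simp add: c \<phi>_def d_def left_diff_distrib sum_subtractf)
    also have "\<dots> = (\<Sum>j<r. of_int (c j div int t) * b j) * of_nat t"
      unfolding sum_distrib_right
    proof (rule sum.cong[OF refl])
      fix j
      have "of_int (c j) - of_int (c j mod int t) = (of_int (c j - c j mod int t) :: complex)" by simp
      also have "c j - c j mod int t = c j div int t * int t" by (simp add: minus_mod_eq_div_mult)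
      finally show "(of_int (c j) - of_int (c j mod int t)) * b j =
          of_int (c j div int t) * b j * of_nat t" by simp
    qed
    also have "\<dots> \<in> principal_ideal K (of_nat t)"
      using \<phi>[of "\<lambda>j. c j div int t"] by (intro principal_idealI) (simp add: \<phi>_def)
    finally have "x - \<phi> d \<in> principal_ideal K (of_nat t)" .
    moreover have "d \<in> F" using t by (auto simp: d_def F_def)
    ultimately show "\<exists>s\<in>\<phi> ` F. x - s \<in> principal_ideal K (of_nat t)" by blast
  qed (use F(1) \<phi> in auto)
qed

text \<open>Coordinate vectors with entries from 0 to t - 1 are pairwise incongruent modulo
  \<open>t\<close>, by uniqueness of coordinates, so they need distinct representatives.\<close>

lemma covered_of_nat_lower:
  assumes b: "zbasis b r" and t: "t > 0" and cov: "covered (principal_ideal K (of_nat t)) N"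
  shows "t ^ r \<le> N"
proof -
  obtain R where R: "finite R" "card R \<le> N" "\<forall>x\<in>\<O>. \<exists>r\<in>R. x - r \<in> principal_ideal K (of_nat t)"
    using cov by (auto simp: covered_def)
  define F where "F = {..<r} \<rightarrow>\<^sub>E {0..<int t}"
  define \<phi> where "\<phi> c = (\<Sum>j<r. of_int (c j) * b j)" for c :: "nat \<Rightarrow> int"
  have F: "finite F" "card F = t ^ r" by (auto simp: F_def card_PiE intro!: finite_PiE)
  have b_int: "b j \<in> \<O>" if "j < r" for j using b that by (simp add: zbasis_def)
  have \<phi>: "\<phi> c \<in> \<O>" for c unfolding \<phi>_def using b_int by (intro integers_sum integers_mult) auto
  have "\<forall>c. \<exists>s\<in>R. \<phi> c - s \<in> principal_ideal K (of_nat t)" using R(3) \<phi> by blast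
  then obtain s where s: "\<And>c. s c \<in> R" "\<And>c. \<phi> c - s c \<in> principal_ideal K (of_nat t)" by metis
  have "inj_on s F"
  proof (rule inj_onI)
    fix c d assume c: "c \<in> F" and d: "d \<in> F" and eq: "s c = s d"
    obtain y where y: "y \<in> \<O>" "\<phi> c - s c = y * of_nat t" using s(2)[of c] by (auto simp: principal_ideal_def)
    obtain z where z: "z \<in> \<O>" "\<phi> d - s d = z * of_nat t" using s(2)[of d] by (auto simp: principal_ideal_def)
    define e where "e = coords b r (y - z)"
    have e: "y - z = (\<Sum>j<r. of_int (e j) * b j)"
      unfolding e_def using b integers_diff[OF y(1) z(1)] by (rule coords)
    have "\<phi> c - \<phi> d = (y - z) * of_nat t" using y(2) z(2) eq by (simp add: algebra_simps)
    also have "\<dots> = (\<Sum>j<r. of_int (e j * int t) * b j)"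
      by (simp add: e sum_distrib_left mult_ac)
    finally have "\<phi> c = (\<Sum>j<r. of_int (d j + e j * int t) * b j)"
      by (simp add: \<phi>_def distrib_right sum.distrib algebra_simps)
    then have cd: "c j = d j + e j * int t" if "j < r" for j
      using zbasis_unique[OF b _ that, of c "\<lambda>j. d j + e j * int t"] by (simp add: \<phi>_def)
    show "c = d"
    proof (rule extensionalityI)
      fix j assume "j \<in> {..<r}"
      then have j: "c j \<in> {0..<int t}" "d j \<in> {0..<int t}" "c j = d j + e j * int t"
        using PiE_mem[OF c[unfolded F_def]] PiE_mem[OF d[unfolded F_def]] cd by simp_all
      have "c j = c j mod int t" using j(1) by simp
      also have "\<dots> = d j mod int t" unfolding j(3) by simp
      also have "\<dots> = d j" using j(2) by simp
      finally show "c j = d j" .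
    qed (use c d in \<open>auto simp: F_def PiE_def\<close>)
  qed
  then have "card F \<le> card R" using s(1) R(1) by (intro card_inj_on_le[of s]) auto
  then show ?thesis using F(2) R(2) by simp
qed

text \<open>Both lengths are read off from the number of residues modulo 2.\<close>

lemma zbasis_length:
  assumes "zbasis b r"
  shows "r = ngal"
proof -
  obtain b' where b': "zbasis b' ngal" using exists_zbasis by blast
  have "2 ^ r \<le> (2 :: nat) ^ ngal"
    by (rule covered_of_nat_lower[OF assms _ covered_of_nat[OF b']]) simp_all
  moreover have "2 ^ ngal \<le> (2 :: nat) ^ r"
    by (rule covered_of_nat_lower[OF b' _ covered_of_nat[OF assms]]) simp_all
  ultimately show ?thesis by simp
qed

text \<open>Some integral basis has nonzero determinant, and its determinant is that of
  \<open>b\<close> times the determinant of the change of basis.\<close>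

lemma zbasis_conj_det_nonzero:
  assumes b: "zbasis b ngal"
  shows "conj_det b \<noteq> 0"
proof
  assume "conj_det b = 0"
  obtain b' where b': "zbasis b' ngal" "conj_det b' \<noteq> 0" using exists_zbasis by blast
  define u where "u j = coords b ngal (b' j)" for j
  have u: "b' j = (\<Sum>l<ngal. of_int (u j l) * b l)" if "j < ngal" for j
    unfolding u_def using b by (rule coords) (use b'(1) that in \<open>simp add: zbasis_def\<close>)
  have bK: "b j \<in> K" if "j < ngal" for j using b that integers_in_K by (simp add: zbasis_def)
  have "gal i (b' j) = (\<Sum>l<ngal. gal i (b l) * of_int (u j l))" if "i < ngal" "j < ngal" for i j
    unfolding u[OF that(2)] by (subst gal_combination[OF that(1)]) (simp_all add: bK mult.commute)
  then have "conj_det b' = det (mat ngal ngal (\<lambda>(i, j). \<Sum>l<ngal. gal i (b l) * of_int (u j l)))"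
    unfolding conj_det_def by (intro arg_cong[where f = det] eq_matI) auto
  also have "\<dots> = conj_det b * det (mat ngal ngal (\<lambda>(l, j). of_int (u j l)))"
    by (simp add: det_mult_fun conj_det_def)
  finally show False using b'(2) \<open>conj_det b = 0\<close> by simp
qed

section \<open>The discriminant\<close>

text \<open>Linear independence is the uniqueness of the coefficient list of 0, compared with the
  list of zeros.\<close>

lemma integral_basis_zbasis:
  assumes "integral_basis K bs"
  shows "zbasis (nth bs) (length bs)"
  unfolding zbasis_def
proof (intro conjI allI impI ballI)
  fix x assume "x \<in> \<O>"
  from bspec[OF conjunct2[OF assms[unfolded integral_basis_def]] this]
  obtain cs :: "int list" where
    "length cs = length bs \<and> x = (\<Sum>i<length bs. of_int (cs ! i) * bs ! i)" by (rule ex1E)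
  then show "\<exists>c :: nat \<Rightarrow> int. x = (\<Sum>j<length bs. of_int (c j) * bs ! j)"
    by (intro exI[of _ "nth cs"]) simp
next
  fix c :: "nat \<Rightarrow> int" and j
  assume c: "(\<Sum>j<length bs. of_int (c j) * bs ! j) = 0" and j: "j < length bs"
  define P where "P cs \<longleftrightarrow> length cs = length bs \<and> 0 = (\<Sum>i<length bs. of_int (cs ! i) * bs ! i)"
    for cs :: "int list"
  have "\<exists>!cs. P cs" unfolding P_def
    by (rule bspec[OF conjunct2[OF assms[unfolded integral_basis_def]] integers_0])
  moreover have "P (map c [0..<length bs])" using c by (simp add: P_def)
  moreover have "P (replicate (length bs) 0)" by (simp add: P_def)
  ultimately have "map c [0..<length bs] = replicate (length bs) 0" by blast
  from arg_cong[OF this, of "\<lambda>cs. cs ! j"] show "c j = 0" using j by simp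
next
  fix j assume "j < length bs"
  then have "bs ! j \<in> set bs" by simp
  moreover have "set bs \<subseteq> \<O>" using assms unfolding integral_basis_def by (rule conjunct1)
  ultimately show "bs ! j \<in> \<O>" by blast
qed

lemma exists_integral_basis: "\<exists>bs. integral_basis K bs"
proof -
  obtain b where b: "zbasis b ngal" using exists_zbasis by blast
  define bs where "bs = map b [0..<ngal]"
  have sum: "(\<Sum>i<length bs. of_int (cs ! i) * bs ! i) = (\<Sum>j<ngal. of_int (cs ! j) * b j)"
    for cs :: "int list" by (simp add: bs_def)
  have bs_int: "set bs \<subseteq> \<O>" using b by (auto simp: bs_def zbasis_def)
  have ex1: "\<exists>!cs :: int list. length cs = length bs \<and>
      x = (\<Sum>i<length bs. of_int (cs ! i) * bs ! i)" if x: "x \<in> \<O>" for x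
    unfolding sum
  proof (rule ex1I[of _ "map (coords b ngal x) [0..<ngal]"])
    show "length (map (coords b ngal x) [0..<ngal]) = length bs \<and>
        x = (\<Sum>j<ngal. of_int (map (coords b ngal x) [0..<ngal] ! j) * b j)"
      using coords[OF b x] by (simp add: bs_def)
    fix cs :: "int list"
    assume cs: "length cs = length bs \<and> x = (\<Sum>j<ngal. of_int (cs ! j) * b j)"
    have "cs ! j = coords b ngal x j" if "j < ngal" for j
      using zbasis_unique[OF b _ that, of "nth cs" "coords b ngal x"] coords[OF b x] cs by simp
    then show "cs = map (coords b ngal x) [0..<ngal]"
      using cs by (intro nth_equalityI) (simp_all add: bs_def)
  qed
  show ?thesis
    unfolding integral_basis_def by (intro exI[of _ bs] conjI ballI bs_int ex1)
qed

text \<open>\<open>discriminant\<close> picks its basis by \<open>SOME\<close>; this bundles such a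
  choice with an integer matrix of its trace form, so that later arguments can take place in the
  integers.\<close>

definition trace_basis :: "(nat \<Rightarrow> complex) \<Rightarrow> (nat \<Rightarrow> nat \<Rightarrow> int) \<Rightarrow> bool" where
  "trace_basis b T \<longleftrightarrow> zbasis b ngal \<and> (\<forall>i<ngal. \<forall>j<ngal. Tr (b i * b j) = of_int (T i j)) \<and>
     discriminant K = of_int (det (mat ngal ngal (\<lambda>(i, j). T i j))) \<and>
     det (mat ngal ngal (\<lambda>(i, j). T i j)) \<noteq> 0"

lemma exists_trace_basis: "\<exists>b T. trace_basis b T"
proof -
  define bs where "bs = (SOME bs. integral_basis K bs)"
  have "integral_basis K bs" unfolding bs_def by (rule someI_ex[OF exists_integral_basis])
  then have zb: "zbasis (nth bs) (length bs)" by (rule integral_basis_zbasis)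
  then have len: "length bs = ngal" by (rule zbasis_length)
  have b: "zbasis (nth bs) ngal" using zb len by simp
  then have b_int: "bs ! j \<in> \<O>" if "j < ngal" for j using that by (simp add: zbasis_def)
  obtain T :: "nat \<Rightarrow> nat \<Rightarrow> int"
    where T: "(\<forall>i<ngal. \<forall>j<ngal. Tr (bs ! i * bs ! j) = of_int (T i j)) \<and>
      of_int (det (mat ngal ngal (\<lambda>(i, j). T i j))) = (conj_det (nth bs))\<^sup>2"
    using trace_matrix[of "nth bs", OF b_int] by (rule exE)
  have bK: "bs ! j \<in> K" if "j < ngal" for j using b_int[OF that] by (rule integers_in_K)
  define D where "D = det (mat ngal ngal (\<lambda>(i, j). T i j))"
  have "discriminant K = det (mat ngal ngal (\<lambda>(i, j). Tr (bs ! i * bs ! j)))"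
    by (simp only: discriminant_def Let_def bs_def[symmetric] len field_trace_eq)
  also have "\<dots> = (conj_det (nth bs))\<^sup>2" by (rule det_trace[of "nth bs", OF bK])
  also have TD: "\<dots> = of_int D" using T unfolding D_def by (elim conjE) (rule sym)
  finally have disc: "discriminant K = of_int D" .
  have nz: "D \<noteq> 0" using TD zbasis_conj_det_nonzero[OF b] by (intro notI) simp
  have "trace_basis (nth bs) T"
    unfolding trace_basis_def D_def[symmetric] using b disc nz T by simp
  then show ?thesis by blast
qed

lemma discriminant_ge_1: "cmod (discriminant K) \<ge> 1"
proof -
  obtain b T where bT: "trace_basis b T" using exists_trace_basis by blast
  define D where "D = det (mat ngal ngal (\<lambda>(i, j). T i j))"
  have "discriminant K = of_int D" "D \<noteq> 0" 
    using bT[unfolded trace_basis_def, folded D_def] by - (elim conjE, assumption)+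
  moreover from this have "1 \<le> \<bar>real_of_int D\<bar>" by linarith
  ultimately show ?thesis by (simp only: norm_of_int)
qed

text \<open>The coordinate vector of \<open>x\<close> lies in the kernel of the trace matrix modulo \<open>p\<close>.\<close>

lemma le_discriminant_if_trace_divisible:
  assumes x: "x \<in> \<O>" "x \<notin> principal_ideal K (of_nat p)" and p: "Factorial_Ring.prime p"
    and Tr: "\<And>y. y \<in> \<O> \<Longrightarrow> \<exists>k :: int. Tr (x * y) = of_int (int p * k)"
  shows "real p \<le> cmod (discriminant K)"
proof -
  obtain b T where bT: "trace_basis b T" using exists_trace_basis by blast
  define M where "M = mat ngal ngal (\<lambda>(i, j). T i j)"
  have b: "zbasis b ngal" and T: "\<forall>i<ngal. \<forall>j<ngal. Tr (b i * b j) = of_int (T i j)"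
    and disc: "discriminant K = of_int (det M)" and nz: "det M \<noteq> 0"
    using bT[unfolded trace_basis_def, folded M_def] by - (elim conjE, assumption)+
  have M: "M \<in> carrier_mat ngal ngal" by (simp add: M_def)
  have b_int: "b j \<in> \<O>" if "j < ngal" for j using b that by (simp add: zbasis_def)
  define c where "c = coords b ngal x"
  have c: "x = (\<Sum>j<ngal. of_int (c j) * b j)"
    unfolding c_def using b x(1) by (rule coords)
  have tr_x: "Tr (x * b i) = of_int (\<Sum>j<ngal. T i j * c j)" if i: "i < ngal" for i
  proof -
    have "Tr (x * b i) = (\<Sum>l<ngal. gal l (x * b i))" by (simp add: Tr_def sum_Gal)
    also have "\<dots> = (\<Sum>l<ngal. \<Sum>j<ngal. of_int (c j) * gal l (b i * b j))"
    proof (rule sum.cong[OF refl])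
      fix l assume "l \<in> {..<ngal}"
      then have l: "l < ngal" by simp
      have "x * b i = (\<Sum>j<ngal. of_int (c j) * (b i * b j))"
        by (simp add: c sum_distrib_left mult_ac)
      then show "gal l (x * b i) = (\<Sum>j<ngal. of_int (c j) * gal l (b i * b j))"
        using gal_combination[OF l, of "{..<ngal}" "\<lambda>j. b i * b j" c] b_int i
        by (auto intro: mult_closed integers_in_K)
    qed
    also have "\<dots> = (\<Sum>j<ngal. of_int (c j) * Tr (b i * b j))"
      by (subst sum.swap) (simp add: Tr_def sum_Gal sum_distrib_left)
    also have "\<dots> = of_int (\<Sum>j<ngal. T i j * c j)" using T i by (simp add: mult.commute[of "of_int (T i _)"])
    finally show ?thesis .
  qed
  have dvd1: "int p dvd (\<Sum>j<ngal. T i j * c j)" if i: "i < ngal" for i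
  proof -
    obtain k where "Tr (x * b i) = of_int (int p * k)" using Tr[OF b_int[OF i]] by blast
    then have "(\<Sum>j<ngal. T i j * c j) = int p * k"
      unfolding tr_x[OF i] of_int_eq_iff .
    then show ?thesis by simp
  qed
  \<comment> \<open>If all coordinates were divisible by \<open>p\<close>, then \<open>x\<close>
    would be a multiple of \<open>p\<close> in \<O>.\<close>
  have "\<exists>j<ngal. \<not> int p dvd c j"
  proof (rule ccontr)
    assume "\<not> ?thesis"
    then have *: "int p * (c j div int p) = c j" if "j < ngal" for j using that by simp
    have "x = (\<Sum>j<ngal. of_int (int p * (c j div int p)) * b j)"
      unfolding c by (intro sum.cong refl) (simp only: * lessThan_iff)
    also have "\<dots> = (\<Sum>j<ngal. of_int (c j div int p) * b j) * of_nat p"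
      by (simp add: sum_distrib_left mult_ac)
    finally have "x = (\<Sum>j<ngal. of_int (c j div int p) * b j) * of_nat p" .
    moreover have "(\<Sum>j<ngal. of_int (c j div int p) * b j) \<in> \<O>"
      using b_int by (intro integers_sum integers_mult) simp_all
    ultimately show False using x(2) principal_idealI by blast
  qed
  then obtain j where j: "j < ngal" "\<not> int p dvd c j" by blast
  \<comment> \<open>The adjugate turns divisibility of every entry of \<open>M\<close> times
    \<open>c\<close> into divisibility of \<open>det M * c j\<close>; the prime \<open>p\<close>
    does not divide \<open>c j\<close>, so it divides the determinant.\<close>
  have "det M \<cdot>\<^sub>v vec ngal c = adj_mat M *\<^sub>v (M *\<^sub>v vec ngal c)"
    using M adj_mat[OF M] by (subst assoc_mult_mat_vec[symmetric, of _ ngal ngal _ ngal]) auto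
  then have "det M * c j = vec_index (adj_mat M *\<^sub>v (M *\<^sub>v vec ngal c)) j"
    using j(1) by (metis index_smult_vec(1) index_vec dim_vec)
  also have "M *\<^sub>v vec ngal c = vec ngal (\<lambda>i. \<Sum>l<ngal. T i l * c l)"
    by (rule eq_vecI) (auto simp: M_def index_mult_mat_vec_fun simp del: index_mult_mat_vec)
  also have "vec_index (adj_mat M *\<^sub>v vec ngal (\<lambda>i. \<Sum>l<ngal. T i l * c l)) j =
      (\<Sum>i<ngal. adj_mat M $$ (j, i) * (\<Sum>l<ngal. T i l * c l))"
    using adj_mat(1)[OF M] j(1) by (auto simp: scalar_prod_def lessThan_atLeast0)
  finally have "det M * c j = (\<Sum>i<ngal. adj_mat M $$ (j, i) * (\<Sum>l<ngal. T i l * c l))" .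
  moreover have "int p dvd (\<Sum>i<ngal. adj_mat M $$ (j, i) * (\<Sum>l<ngal. T i l * c l))"
    by (rule dvd_sum, rule dvd_mult, rule dvd1) simp
  ultimately have "int p dvd det M * c j" by (simp only:)
  then have "int p dvd det M"
    using j(2) prime_dvd_multD[of "int p" "det M" "c j"] p by simp
  then have "\<bar>int p\<bar> \<le> \<bar>det M\<bar>" using nz by (rule dvd_imp_le_int[rotated])
  then have "real_of_int (int p) \<le> real_of_int \<bar>det M\<bar>" by (simp only: of_int_le_iff abs_of_nat)
  then have "real p \<le> \<bar>real_of_int (det M)\<bar>" by simp
  then show ?thesis unfolding disc by (simp only: norm_of_int)
qed

section \<open>Prime ideals\<close>


text \<open>Ideals as closure conditions on complex numbers; the library notion is unpacked once, in
  \<open>primes_of_int_prime\<close>.\<close>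

definition int_ideal :: "complex set \<Rightarrow> bool" where
  "int_ideal I \<longleftrightarrow> I \<subseteq> \<O> \<and> 0 \<in> I \<and> (\<forall>x\<in>I. \<forall>y\<in>I. x + y \<in> I) \<and> (\<forall>x\<in>\<O>. \<forall>y\<in>I. x * y \<in> I)"

lemma int_idealD:
  assumes "int_ideal I"
  shows "x \<in> I \<Longrightarrow> x \<in> \<O>" "0 \<in> I" "x \<in> I \<Longrightarrow> y \<in> I \<Longrightarrow> x + y \<in> I"
    "x \<in> \<O> \<Longrightarrow> y \<in> I \<Longrightarrow> x * y \<in> I" "y \<in> I \<Longrightarrow> x \<in> \<O> \<Longrightarrow> y * x \<in> I"
  using assms by (auto simp: int_ideal_def mult.commute)

lemma int_ideal_uminus: "int_ideal I \<Longrightarrow> x \<in> I \<Longrightarrow> - x \<in> I"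
  using int_idealD(4)[of I "- 1" x] integers_uminus[OF integers_1] by simp

lemma int_ideal_diff: "int_ideal I \<Longrightarrow> x \<in> I \<Longrightarrow> y \<in> I \<Longrightarrow> x - y \<in> I"
  using int_idealD(3)[of I x "- y"] int_ideal_uminus[of I y] by simp

lemma int_ideal_diff_iff: "int_ideal I \<Longrightarrow> x - y \<in> I \<Longrightarrow> x \<in> I \<longleftrightarrow> y \<in> I"
  using int_idealD(3)[of I "x - y" y] int_ideal_diff[of I x "x - y"] by auto

lemma principal_int_ideal:
  assumes "a \<in> \<O>"
  shows "int_ideal (principal_ideal K a)"
  unfolding int_ideal_def
proof (intro conjI ballI subsetI)
  show "x \<in> \<O>" if "x \<in> principal_ideal K a" for x
    using that assms by (auto simp: principal_ideal_def)
  show "0 \<in> principal_ideal K a" using principal_idealI[OF integers_0, of a] by simp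
  show "x + y \<in> principal_ideal K a" if xy: "x \<in> principal_ideal K a" "y \<in> principal_ideal K a" for x y
  proof -
    obtain u v where "x = u * a" "u \<in> \<O>" "y = v * a" "v \<in> \<O>"
      using xy unfolding principal_ideal_def by blast
    then show ?thesis using principal_idealI[of "u + v" a] by (simp add: integers_add distrib_right)
  qed
  show "x * y \<in> principal_ideal K a" if xy: "x \<in> \<O>" "y \<in> principal_ideal K a" for x y
  proof -
    obtain v where "y = v * a" "v \<in> \<O>" using xy unfolding principal_ideal_def by blast
    then show ?thesis using principal_idealI[of "x * v" a] xy(1) by (simp add: integers_mult mult.assoc)
  qed
qed

lemma principal_subset: "int_ideal I \<Longrightarrow> a \<in> I \<Longrightarrow> principal_ideal K a \<subseteq> I"
  by (auto simp: principal_ideal_def intro: int_idealD)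

lemma principal_of_nat_iff:
  "N > 0 \<Longrightarrow> x \<in> principal_ideal K (of_nat N) \<longleftrightarrow> x / of_nat N \<in> \<O>"
  by (auto simp: principal_ideal_def intro!: exI[of _ "x / of_nat N"])

definition int_prime :: "complex set \<Rightarrow> bool" where
  "int_prime \<qq> \<longleftrightarrow> int_ideal \<qq> \<and> 1 \<notin> \<qq> \<and> \<qq> \<noteq> {0} \<and>
     (\<forall>x\<in>\<O>. \<forall>y\<in>\<O>. x * y \<in> \<qq> \<longrightarrow> x \<in> \<qq> \<or> y \<in> \<qq>)"

lemma primes_of_int_prime:
  assumes "\<qq> \<in> primes_of K"
  shows "int_prime \<qq>"
proof -
  interpret primeideal \<qq> "int_ring K" using assms by (simp add: primes_of_def)
  have sub: "\<qq> \<subseteq> \<O>" using a_subset by simp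
  have "int_ideal \<qq>"
    unfolding int_ideal_def using sub I_l_closed additive_subgroup.a_closed[OF is_additive_subgroup]
      additive_subgroup.zero_closed[OF is_additive_subgroup] by simp
  moreover have "1 \<notin> \<qq>"
  proof
    assume "1 \<in> \<qq>"
    then have "\<O> \<subseteq> \<qq>" using I_l_closed[of 1] by auto
    then show False using I_notcarr sub by auto
  qed
  moreover have "x \<in> \<qq> \<or> y \<in> \<qq>" if "x \<in> \<O>" "y \<in> \<O>" "x * y \<in> \<qq>" for x y
    using I_prime[of x y] that by simp
  ultimately show ?thesis using assms by (simp add: int_prime_def primes_of_def)
qed

lemma int_prime_ideal: "int_prime \<qq> \<Longrightarrow> int_ideal \<qq>"
  by (simp add: int_prime_def)

lemma int_prime_mult: "int_prime \<qq> \<Longrightarrow> x \<in> \<O> \<Longrightarrow> y \<in> \<O> \<Longrightarrow> x * y \<in> \<qq> \<Longrightarrow> x \<notin> \<qq> \<Longrightarrow> y \<in> \<qq>"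
  unfolding int_prime_def by blast

lemma int_prime_power: "int_prime \<qq> \<Longrightarrow> x \<in> \<O> \<Longrightarrow> x \<notin> \<qq> \<Longrightarrow> x ^ n \<notin> \<qq>"
  by (induction n) (auto dest: int_prime_mult[of \<qq> x] simp: integers_power int_prime_def[of \<qq>])

lemma int_prime_contains_nat:
  assumes "int_prime \<qq>"
  obtains N where "N > 0" "of_nat N \<in> \<qq>"
proof -
  have I: "int_ideal \<qq>" using assms by (rule int_prime_ideal)
  obtain x where x: "x \<in> \<qq>" "x \<noteq> 0"
    using assms int_idealD(2)[OF I] unfolding int_prime_def by auto
  obtain N y where "N > 0" "y \<in> \<O>" "of_nat N = x * y"
    using positive_integer_multiple[OF int_idealD(1)[OF I x(1)] x(2)] by blast
  then show ?thesis using that int_idealD(5)[OF I x(1)] by metis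
qed

lemma covered_nat:
  assumes "N > 0"
  obtains R where "R \<subseteq> \<O>" "finite R" "\<forall>x\<in>\<O>. \<exists>r\<in>R. x - r \<in> principal_ideal K (of_nat N)"
proof -
  obtain b where b: "zbasis b ngal" using exists_zbasis by blast
  show ?thesis using covered_of_nat[OF b assms] that unfolding covered_def by blast
qed

text \<open>Pigeonhole: the powers of \<open>y\<close> meet finitely many residues modulo
  \<open>N\<close>, so two of them agree. This is the form in which the finiteness of the quotient
  enters the arguments about prime ideals.\<close>

lemma power_congruence:
  assumes "N > 0" "y \<in> \<O>"
  obtains i d where "d > 0" "y ^ i * (1 - y ^ d) \<in> principal_ideal K (of_nat N)"
proof -
  obtain R where R: "R \<subseteq> \<O>" "finite R"
    "\<forall>x\<in>\<O>. \<exists>r\<in>R. x - r \<in> principal_ideal K (of_nat N)"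
    using covered_nat[OF assms(1)] .
  have "\<forall>i. \<exists>r\<in>R. y ^ i - r \<in> principal_ideal K (of_nat N)"
    using R(3) integers_power[OF assms(2)] by simp
  then obtain f where f: "\<And>i :: nat. f i \<in> R" "\<And>i. y ^ i - f i \<in> principal_ideal K (of_nat N)"
    by metis
  have "\<not> inj f" using f(1) R(2) by (meson finite_subset image_subset_iff infinite_UNIV_nat finite_imageD)
  then obtain i j where ij: "i < j" "f i = f j" unfolding inj_def by (metis linorder_neqE_nat)
  have "y ^ i - f i - (y ^ j - f j) \<in> principal_ideal K (of_nat N)"
    by (intro int_ideal_diff principal_int_ideal f(2) integers_of_nat)
  also have "y ^ i - f i - (y ^ j - f j) = y ^ i * (1 - y ^ (j - i))"
    using ij by (simp add: right_diff_distrib flip: power_add)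
  finally show ?thesis using that[of "j - i" i] ij(1) by simp
qed

text \<open>A finite domain is a field: cancelling x^i from the power congruence puts 1 - x^d into
  \<qq>, and x^(d-1) is the inverse.\<close>

lemma int_prime_maximal:
  assumes q: "int_prime \<qq>" and x: "x \<in> \<O>" "x \<notin> \<qq>"
  obtains s t where "s \<in> \<qq>" "t \<in> \<O>" "1 = s + x * t"
proof -
  have I: "int_ideal \<qq>" using q by (rule int_prime_ideal)
  obtain N where N: "N > 0" "of_nat N \<in> \<qq>" using q by (rule int_prime_contains_nat)
  obtain i d where d: "d > 0" "x ^ i * (1 - x ^ d) \<in> principal_ideal K (of_nat N)"
    using N(1) x(1) by (rule power_congruence)
  then have "x ^ i * (1 - x ^ d) \<in> \<qq>" using principal_subset[OF I N(2)] by blast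
  then have "1 - x ^ d \<in> \<qq>"
    using int_prime_mult[OF q, of "x ^ i" "1 - x ^ d"] int_prime_power[OF q x] x(1)
    by (simp add: integers_power integers_diff)
  moreover have "1 = (1 - x ^ d) + x * x ^ (d - 1)" using d(1) by (cases d) auto
  ultimately show ?thesis using that x(1) integers_power by blast
qed

text \<open>Among the \<open>b\<close> whose annihilator modulo \<open>N\<close> lies in \<open>\<qq>\<close>, one with a maximal annihilator is
  annihilated by all of \<open>\<qq>\<close>. Then \<open>b / N\<close> lies in the inverse of \<open>\<qq>\<close>.\<close>

lemma exists_inverse_element:
  assumes q: "int_prime \<qq>"
  obtains z where "z \<in> K" "z \<notin> \<O>" "\<forall>y\<in>\<qq>. z * y \<in> \<O>"
proof -
  have I: "int_ideal \<qq>" using q by (rule int_prime_ideal)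
  obtain N where N: "N > 0" "of_nat N \<in> \<qq>" using q by (rule int_prime_contains_nat)
  define P where "P = principal_ideal K (of_nat N)"
  have P: "int_ideal P" unfolding P_def by (rule principal_int_ideal) simp
  have Pq: "P \<subseteq> \<qq>" unfolding P_def by (rule principal_subset[OF I N(2)])
  obtain R where R: "R \<subseteq> \<O>" "finite R" "\<forall>x\<in>\<O>. \<exists>r\<in>R. x - r \<in> P"
    using covered_nat[OF N(1)] unfolding P_def .
  define ann where "ann b = {y \<in> \<O>. b * y \<in> P}" for b
  \<comment> \<open>A larger annihilator leaves fewer such representatives, so minimizing this
    number selects a maximal annihilator.\<close>
  define f where "f b = card {r \<in> R. r \<in> \<qq> \<and> r \<notin> ann b}" for b
  define B where "B = {b \<in> \<O>. ann b \<subseteq> \<qq>}"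
  have "1 \<in> B" using Pq by (auto simp: B_def ann_def)
  then obtain b where b: "b \<in> B" "\<And>b'. b' \<in> B \<Longrightarrow> f b \<le> f b'"
    using ex_has_least_nat[of "\<lambda>b. b \<in> B" 1 f] by blast
  then have bO: "b \<in> \<O>" and bq: "ann b \<subseteq> \<qq>" by (auto simp: B_def)
  have annb: "b * y \<in> P" if y: "y \<in> \<qq>" for y
  proof (rule ccontr)
    assume nby: "b * y \<notin> P"
    have yO: "y \<in> \<O>" using int_idealD(1)[OF I y] .
    obtain i d where d: "d > 0" "y ^ i * (1 - y ^ d) \<in> P"
      using power_congruence[OF N(1) yO] unfolding P_def .
    have "1 - y ^ d \<notin> \<qq>"
    proof
      assume "1 - y ^ d \<in> \<qq>"
      moreover have "y ^ d \<in> \<qq>"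
        using d(1) int_idealD(5)[OF I y integers_power[OF yO, of "d - 1"]] by (cases d) auto
      ultimately have "1 \<in> \<qq>" using int_idealD(3)[OF I, of "1 - y ^ d" "y ^ d"] by simp
      then show False using q by (simp add: int_prime_def)
    qed
    moreover have "1 - y ^ d \<in> ann (b * y ^ i)"
      using int_idealD(4)[OF P bO d(2)] yO
      by (simp add: ann_def mult.assoc integers_diff integers_power)
    ultimately have ex: "\<exists>i. \<not> ann (b * y ^ i) \<subseteq> \<qq>" by blast
    \<comment> \<open>This exponent is positive because \<open>ann b\<close> lies in \<qq>; at its
      predecessor \<open>k\<close> the annihilator is still inside \<qq>.\<close>
    define i0 where "i0 = (LEAST i. \<not> ann (b * y ^ i) \<subseteq> \<qq>)"
    have i0: "\<not> ann (b * y ^ i0) \<subseteq> \<qq>" unfolding i0_def by (rule LeastI_ex[OF ex])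
    have "i0 \<noteq> 0" using i0 bq by (intro notI) simp
    then obtain k where k: "i0 = Suc k" using not0_implies_Suc by blast
    have annk: "ann (b * y ^ k) \<subseteq> \<qq>"
      using not_less_Least[of k "\<lambda>i. \<not> ann (b * y ^ i) \<subseteq> \<qq>"] k unfolding i0_def[symmetric] by simp
    obtain s where s: "s \<in> \<O>" "s \<notin> \<qq>" "b * y ^ Suc k * s \<in> P"
      using i0 unfolding k by (auto simp: ann_def)
    \<comment> \<open>The competitor to \<open>b\<close>: it is annihilated by \<open>y\<close>
      through the choice of \<open>s\<close>, while \<open>s\<close> lying outside the prime \<qq>
      keeps its annihilator inside \<qq>.\<close>
    define b' where "b' = b * s * y ^ k"
    have b'O: "b' \<in> \<O>" unfolding b'_def by (intro integers_mult integers_power bO s(1) yO)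
    have "ann b' \<subseteq> \<qq>"
    proof
      fix t assume "t \<in> ann b'"
      then have t: "t \<in> \<O>" "b' * t \<in> P" by (auto simp: ann_def)
      then have "s * t \<in> ann (b * y ^ k)"
        using s(1) integers_mult[OF s(1) t(1)] by (simp add: ann_def b'_def mult_ac)
      then have "s * t \<in> \<qq>" using annk by blast
      then show "t \<in> \<qq>" using int_prime_mult[OF q s(1) t(1)] s(2) by blast
    qed
    then have "b' \<in> B" using b'O by (simp add: B_def)
    have sub: "x \<in> ann b'" if "x \<in> ann b" for x
    proof -
      have "s * y ^ k * (b * x) \<in> P"
        using that int_idealD(4)[OF P integers_mult[OF s(1) integers_power[OF yO]]] by (simp add: ann_def)
      then show ?thesis using that by (simp add: ann_def b'_def mult_ac)
    qed
    \<comment> \<open>\<open>f\<close> counts representatives only, so \<open>y\<close> is replaced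
      by \<open>r\<close>, which lies in \<open>ann b'\<close> but not in
      \<open>ann b\<close>.\<close>
    obtain r where r: "r \<in> R" "y - r \<in> P" using R(3)[rule_format, OF yO] by blast
    have rO: "r \<in> \<O>" using R(1) r(1) by blast
    have "r \<in> \<qq>" using int_ideal_diff_iff[OF I] r(2) Pq y by blast
    have br: "c * y \<in> P \<longleftrightarrow> c * r \<in> P" if "c \<in> \<O>" for c
      using int_ideal_diff_iff[OF P, of "c * y" "c * r"] int_idealD(4)[OF P that r(2)]
      by (simp add: right_diff_distrib)
    have "b' * y \<in> P" using s(3) by (simp add: b'_def mult_ac)
    then have "r \<in> ann b'" using br[OF b'O] rO by (simp add: ann_def)
    moreover have "r \<notin> ann b" using br[OF bO] nby by (simp add: ann_def)
    ultimately have "{r \<in> R. r \<in> \<qq> \<and> r \<notin> ann b'} \<subset> {r \<in> R. r \<in> \<qq> \<and> r \<notin> ann b}"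
      using sub r(1) \<open>r \<in> \<qq>\<close> by blast
    then have "f b' < f b" unfolding f_def using R(2) by (intro psubset_card_mono) auto
    then show False using b(2)[OF \<open>b' \<in> B\<close>] by simp
  qed
  show ?thesis
  proof (rule that[of "b / of_nat N"])
    show "b / of_nat N \<in> K" using bO by (intro divide_closed integers_in_K) simp_all
    show "b / of_nat N \<notin> \<O>"
    proof
      assume "b / of_nat N \<in> \<O>"
      then have "1 \<in> ann b" using N(1) by (simp add: ann_def P_def principal_of_nat_iff)
      then show False using bq q by (auto simp: int_prime_def)
    qed
    show "\<forall>y\<in>\<qq>. b / of_nat N * y \<in> \<O>"
      using annb N(1) by (simp add: P_def principal_of_nat_iff)
  qed
qed

text \<open>The elements \<open>c\<close> with \<open>c * z ^ n\<close> integral for all \<open>n\<close> form a finitely generated module that is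
  stable under \<open>z\<close>.\<close>

lemma almost_integral:
  assumes z: "z \<in> K" and c: "c \<in> \<O>" "c \<noteq> 0" "\<And>n. c * z ^ n \<in> \<O>"
  shows "z \<in> \<O>"
proof -
  define I where "I = {c \<in> \<O>. \<forall>n. c * z ^ n \<in> \<O>}"
  have I: "int_ideal I"
    unfolding int_ideal_def I_def by (auto simp: distrib_right mult.assoc)
  have zI: "z * x \<in> I" if "x \<in> I" for x
  proof -
    have *: "x * z ^ n \<in> \<O>" for n using that by (simp add: I_def)
    have "z * x \<in> \<O>" using *[of 1] by (simp add: mult.commute)
    moreover have "z * x * z ^ n \<in> \<O>" for n using *[of "Suc n"] by (simp add: mult_ac)
    ultimately show ?thesis by (simp add: I_def)
  qed
  have "c \<in> I" using c by (simp add: I_def)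
  obtain N y where N: "N > 0" "y \<in> \<O>" "of_nat N = c * y"
    using positive_integer_multiple[OF c(1,2)] by blast
  have NI: "of_nat N \<in> I" unfolding N(3) by (rule int_idealD(5)[OF I \<open>c \<in> I\<close> N(2)])
  obtain R where R: "R \<subseteq> \<O>" "finite R"
    "\<forall>x\<in>\<O>. \<exists>r\<in>R. x - r \<in> principal_ideal K (of_nat N)"
    using covered_nat[OF N(1)] .
  obtain b where b: "zbasis b ngal" using exists_zbasis by blast
  \<comment> \<open>Generators of \<open>I\<close>: the representatives that lie in
    \<open>I\<close>, and \<open>of_nat N\<close> times an integral basis for what remains modulo
    them. The entry \<open>of_nat N\<close> supplies the nonzero generator for the determinant
    criterion.\<close>
  define V where "V = insert (of_nat N) (R \<inter> I \<union> (\<lambda>j. of_nat N * b j) ` {..<ngal})"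
  have fin: "finite V" using R(2) by (simp add: V_def)
  have VI: "V \<subseteq> I"
    using NI b int_idealD(5)[OF I NI] by (auto simp: V_def zbasis_def)
  have span: "x \<in> int_span V" if x: "x \<in> I" for x
  proof -
    have xO: "x \<in> \<O>" using int_idealD(1)[OF I x] .
    obtain r where r: "r \<in> R" "x - r \<in> principal_ideal K (of_nat N)" using R(3)[rule_format, OF xO] by blast
    have "x - r \<in> I" using principal_subset[OF I NI] r(2) by blast
    then have "r \<in> I" using int_ideal_diff_iff[OF I] x by blast
    obtain y where y: "y \<in> \<O>" "x - r = y * of_nat N" using r(2) by (auto simp: principal_ideal_def)
    have "x = r + (\<Sum>j<ngal. of_int (coords b ngal y j) * b j) * of_nat N"
      using y(2) coords[OF b y(1)] by (simp add: algebra_simps)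
    also have "\<dots> = r + (\<Sum>j<ngal. of_int (coords b ngal y j) * (of_nat N * b j))"
      by (simp add: sum_distrib_left mult_ac)
    also have "\<dots> \<in> int_span V"
      using r(1) \<open>r \<in> I\<close> fin
      by (intro int_span_add int_span_sum int_span_smult int_span_incl) (auto simp: V_def)
    finally show ?thesis .
  qed
  have "algebraic_int z"
  proof (rule algebraic_int_if_module[OF fin])
    show "\<exists>v\<in>V. v \<noteq> 0" using N(1) by (intro bexI[of _ "of_nat N"]) (auto simp: V_def)
    show "z * v \<in> int_span V" if "v \<in> V" for v using span zI VI that by blast
  qed
  then show ?thesis using z by (simp add: integers_def)
qed

text \<open>If \<open>z\<close> mapped \<qq> into itself, a rational integer N in \<qq> would keep
  all N z^n integral, and \<open>z\<close> would be integral. The element \<open>v\<close> acts as a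
  uniformizer: \<open>z * v\<close> is a unit modulo \<qq>.\<close>

lemma exists_local_parameter:
  assumes q: "int_prime \<qq>" and z: "z \<in> K" "z \<notin> \<O>" "\<And>y. y \<in> \<qq> \<Longrightarrow> z * y \<in> \<O>"
  obtains v where "v \<in> \<qq>" "z * v \<notin> \<qq>"
proof -
  have I: "int_ideal \<qq>" using q by (rule int_prime_ideal)
  have "\<exists>v\<in>\<qq>. z * v \<notin> \<qq>"
  proof (rule ccontr)
    assume "\<not> ?thesis"
    then have stable: "z * v \<in> \<qq>" if "v \<in> \<qq>" for v using that by blast
    obtain N where N: "N > 0" "of_nat N \<in> \<qq>" using q by (rule int_prime_contains_nat)
    have "of_nat N * z ^ n \<in> \<qq>" for n
    proof (induction n)
      case (Suc n)
      then show ?case using stable[OF Suc] by (simp add: mult_ac)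
    qed (simp add: N(2))
    then have "z \<in> \<O>"
      using N(1) int_idealD(1)[OF I] by (intro almost_integral[OF z(1), of "of_nat N"]) auto
    then show False using z(2) by blast
  qed
  then show ?thesis using that by blast
qed

section \<open>Powers of a prime and the order of an element\<close>

lemma ideal_group_pow_0: "\<qq> [^]\<^bsub>ideal_group K\<^esub> (0 :: nat) = \<O>"
  by (simp add: ideal_group_def)

lemma ideal_group_pow_Suc:
  "\<qq> [^]\<^bsub>ideal_group K\<^esub> Suc n = ideal_prod (num_ring K) (\<qq> [^]\<^bsub>ideal_group K\<^esub> n) \<qq>"
  by (simp add: ideal_group_def)

abbreviation ideal_pow :: "complex set \<Rightarrow> nat \<Rightarrow> complex set" where
  "ideal_pow \<qq> n \<equiv> \<qq> [^]\<^bsub>ideal_group K\<^esub> n"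

lemma int_ideal_prod:
  assumes I: "int_ideal I" and J: "int_ideal J"
  shows "int_ideal (ideal_prod (num_ring K) I J)" (is "int_ideal ?P")
proof -
  have "x \<in> \<O>" if "x \<in> ?P" for x
    using that
  proof (induction rule: ideal_prod.induct)
    case (prod i j)
    then show ?case using int_idealD(1)[OF I] int_idealD(1)[OF J] by (simp add: integers_mult)
  qed (simp add: integers_add)
  moreover have "0 \<in> ?P"
    using ideal_prod.prod[OF int_idealD(2)[OF I] int_idealD(2)[OF J], of "num_ring K"] by simp
  moreover have "x + y \<in> ?P" if "x \<in> ?P" "y \<in> ?P" for x y
    using ideal_prod.sum[OF that] by simp
  moreover have "x * y \<in> ?P" if "x \<in> \<O>" "y \<in> ?P" for x y
    using that(2)
  proof (induction rule: ideal_prod.induct)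
    case (prod i j)
    then show ?case
      using ideal_prod.prod[OF int_idealD(4)[OF I that(1) prod(1)] prod(2), of "num_ring K"]
      by (simp add: mult.assoc)
  next
    case (sum s t)
    then show ?case using ideal_prod.sum[OF sum(3,4)] by (simp add: distrib_left)
  qed
  ultimately show ?thesis by (auto simp: int_ideal_def)
qed

lemma ideal_prod_subset:
  assumes "\<And>i j. i \<in> I \<Longrightarrow> j \<in> J \<Longrightarrow> i * j \<in> A" "\<And>x y. x \<in> A \<Longrightarrow> y \<in> A \<Longrightarrow> x + y \<in> A"
    "x \<in> ideal_prod (num_ring K) I J"
  shows "x \<in> A"
  using assms(3) by (induction rule: ideal_prod.induct) (use assms(1,2) in auto)

lemma ideal_pow_int_ideal: "int_ideal \<qq> \<Longrightarrow> int_ideal (ideal_pow \<qq> n)"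
proof (induction n)
  case 0
  have "int_ideal \<O>" by (auto simp: int_ideal_def)
  then show ?case by (simp only: ideal_group_pow_0)
qed (simp only: ideal_group_pow_Suc int_ideal_prod)

lemma ideal_pow_mult: "x \<in> ideal_pow \<qq> n \<Longrightarrow> y \<in> \<qq> \<Longrightarrow> x * y \<in> ideal_pow \<qq> (Suc n)"
  using ideal_prod.prod[of x "ideal_pow \<qq> n" y \<qq> "num_ring K"] by (simp only: ideal_group_pow_Suc num_ring_simps)

lemma ideal_pow_power: "int_ideal \<qq> \<Longrightarrow> x \<in> \<qq> \<Longrightarrow> x ^ n \<in> ideal_pow \<qq> n"
proof (induction n)
  case 0
  then show ?case by (simp only: ideal_group_pow_0 power_0 integers_1)
next
  case (Suc n)
  then show ?case using ideal_pow_mult[of "x ^ n" \<qq> n x] by (simp only: power_Suc2)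
qed

lemma ideal_pow_Suc_subset: "int_ideal \<qq> \<Longrightarrow> ideal_pow \<qq> (Suc n) \<subseteq> ideal_pow \<qq> n"
  unfolding ideal_group_pow_Suc
  using int_idealD[OF ideal_pow_int_ideal[of \<qq> n]] int_idealD(1)[of \<qq>]
  by (intro subsetI) (erule ideal_prod_subset[rotated 2], auto)

lemma ideal_pow_Suc_subset_prime: "int_ideal \<qq> \<Longrightarrow> ideal_pow \<qq> (Suc n) \<subseteq> \<qq>"
  unfolding ideal_group_pow_Suc
  using int_idealD[of \<qq>] int_idealD(1)[OF ideal_pow_int_ideal[of \<qq> n]]
  by (intro subsetI) (erule ideal_prod_subset[rotated 2], auto)

text \<open>Multiplication by \<open>z\<close> removes one factor \<qq>, as multiplication by the
  inverse ideal would.\<close>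

lemma ideal_pow_inverse_element:
  assumes I: "int_ideal \<qq>" and z: "\<And>y. y \<in> \<qq> \<Longrightarrow> z * y \<in> \<O>" and x: "x \<in> ideal_pow \<qq> (Suc n)"
  shows "z * x \<in> ideal_pow \<qq> n"
proof -
  have P: "int_ideal (ideal_pow \<qq> n)" using I by (rule ideal_pow_int_ideal)
  have "x \<in> {x. z * x \<in> ideal_pow \<qq> n}"
  proof (rule ideal_prod_subset[OF _ _ x[unfolded ideal_group_pow_Suc]])
    show "i * j \<in> {x. z * x \<in> ideal_pow \<qq> n}" if "i \<in> ideal_pow \<qq> n" "j \<in> \<qq>" for i j
      using int_idealD(5)[OF P that(1) z[OF that(2)]] by (simp add: mult_ac)
  qed (use int_idealD(3)[OF P] in \<open>simp add: distrib_left\<close>)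
  then show ?thesis by simp
qed

lemma ideal_pow_inverse_power:
  assumes I: "int_ideal \<qq>" and z: "\<And>y. y \<in> \<qq> \<Longrightarrow> z * y \<in> \<O>" and x: "x \<in> ideal_pow \<qq> n"
  shows "z ^ n * x \<in> \<O>"
  using x
proof (induction n arbitrary: x)
  case 0
  then show ?case by (simp only: ideal_group_pow_0 power_0 mult_1)
next
  case (Suc n)
  have "z ^ n * (z * x) \<in> \<O>" using Suc.IH ideal_pow_inverse_element[OF I z Suc.prems] by blast
  then show ?case by (simp add: mult_ac)
qed

lemma ideal_pow_antimono: "int_ideal \<qq> \<Longrightarrow> i \<le> j \<Longrightarrow> ideal_pow \<qq> j \<subseteq> ideal_pow \<qq> i"
  using lift_Suc_antimono_le[of "ideal_pow \<qq>"] ideal_pow_Suc_subset by blast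

text \<open>An \<open>x\<close> in all powers would make every x z^n integral, and
  \<open>almost_integral\<close> would put \<open>z\<close> into \<O>.\<close>

lemma ideal_pow_bounded:
  assumes q: "int_prime \<qq>" and x: "x \<in> \<O>" "x \<noteq> 0"
  obtains n where "x \<notin> ideal_pow \<qq> n"
proof -
  have I: "int_ideal \<qq>" using q by (rule int_prime_ideal)
  obtain z where z: "z \<in> K" "z \<notin> \<O>" "\<forall>y\<in>\<qq>. z * y \<in> \<O>"
    using q by (rule exists_inverse_element)
  have "\<exists>n. x \<notin> ideal_pow \<qq> n"
  proof (rule ccontr)
    assume "\<not> ?thesis"
    then have "x * z ^ n \<in> \<O>" for n
      using ideal_pow_inverse_power[OF I z(3)[rule_format], of x n] by (simp add: mult.commute)
    then have "z \<in> \<O>" using almost_integral[OF z(1) x] by blast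
    then show False using z(2) by blast
  qed
  then show ?thesis using that by blast
qed

text \<open>\<open>GREATEST\<close> is meaningful only once the exponents are bounded and the
  maximum is attained; exponent 0 is always admissible since \<open>x\<close> is integral.\<close>

lemma ord_at_props:
  assumes q: "int_prime \<qq>" and x: "x \<in> \<O>" "x \<noteq> 0"
  shows "ord_at K \<qq> x \<ge> 0" and "x \<in> ideal_pow \<qq> (nat (ord_at K \<qq> x))"
proof -
  have I: "int_ideal \<qq>" using q by (rule int_prime_ideal)
  obtain n where n: "x \<notin> ideal_pow \<qq> n" using q x by (rule ideal_pow_bounded)
  define N where "N = {i. x \<in> ideal_pow \<qq> i}"
  have lt: "i < n" if "i \<in> N" for i
  proof (rule ccontr)
    assume "\<not> i < n"
    then have "ideal_pow \<qq> i \<subseteq> ideal_pow \<qq> n" by (intro ideal_pow_antimono[OF I]) simp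
    then show False using n that unfolding N_def by blast
  qed
  then have fin: "finite N" by (intro finite_subset[of N "{..<n}"]) auto
  have "0 \<in> N" using x(1) by (simp only: N_def mem_Collect_eq ideal_group_pow_0)
  then have M: "Max N \<in> N" using fin by (intro Max_in) auto
  have "ord_at K \<qq> x = int (Max N)"
    unfolding ord_at_def
  proof (rule Greatest_equality)
    show "x \<in> \<qq> [^]\<^bsub>ideal_group K\<^esub> int (Max N)"
      using M by (simp add: N_def int_pow_int)
    fix y :: int assume y: "x \<in> \<qq> [^]\<^bsub>ideal_group K\<^esub> y"
    show "y \<le> int (Max N)"
    \<comment> \<open>A negative exponent is below the maximum, whatever its ideal power is.\<close>
    proof (cases "y \<ge> 0")
      case True
      then have "nat y \<in> N" using y int_pow_int[of "ideal_group K" \<qq> "nat y"] by (simp add: N_def)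
      then show ?thesis using Max_ge[OF fin, of "nat y"] True by simp
    qed simp
  qed
  then show "ord_at K \<qq> x \<ge> 0" "x \<in> ideal_pow \<qq> (nat (ord_at K \<qq> x))"
    using M by (simp_all add: N_def)
qed


section \<open>Norms of generators of prime powers\<close>

text \<open>A positive cardinality certifies that the quotient is finite, and one representative per
  coset is chosen.\<close>

lemma covered_prime:
  assumes q: "int_prime \<qq>" and card: "ideal_norm K \<qq> > 0"
  shows "covered \<qq> (ideal_norm K \<qq>)"
proof -
  have I: "int_ideal \<qq>" using q by (rule int_prime_ideal)
  define F where "F x = {h + x | h. h \<in> \<qq>}" for x :: complex
  have carrier: "carrier (int_ring K Quot \<qq>) = F ` \<O>"
    unfolding FactRing_def A_RCOSETS_def' a_r_coset_def' F_def by auto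
  have fin: "finite (F ` \<O>)"
    using card unfolding ideal_norm_def carrier by (rule card_ge_0_finite)
  define rep where "rep = inv_into \<O> F"
  have rep: "rep (F x) \<in> \<O>" "x - rep (F x) \<in> \<qq>" if "x \<in> \<O>" for x
  proof -
    show "rep (F x) \<in> \<O>" unfolding rep_def using that by (intro inv_into_into imageI)
    have "F (rep (F x)) = F x" unfolding rep_def using that by (intro f_inv_into_f imageI)
    moreover have "0 + x \<in> F x" using int_idealD(2)[OF I] unfolding F_def by blast
    ultimately have "0 + x \<in> F (rep (F x))" by simp
    then obtain h where "h \<in> \<qq>" "0 + x = h + rep (F x)" unfolding F_def by blast
    moreover from this(2) have "x - rep (F x) = h" by (metis add_0 add_diff_cancel_right')
    ultimately show "x - rep (F x) \<in> \<qq>" by (simp only:)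
  qed
  show ?thesis
    unfolding covered_def
  proof (intro exI[of _ "rep ` F ` \<O>"] conjI ballI)
    show "rep ` F ` \<O> \<subseteq> \<O>" using rep(1) by auto
    show "finite (rep ` F ` \<O>)" using fin by simp
    show "card (rep ` F ` \<O>) \<le> ideal_norm K \<qq>"
      unfolding ideal_norm_def carrier by (rule card_image_le[OF fin])
    show "\<exists>r\<in>rep ` F ` \<O>. x - r \<in> \<qq>" if "x \<in> \<O>" for x using rep(2)[OF that] that by blast
  qed
qed

lemma covered_mono:
  assumes "I \<subseteq> J" "covered I A"
  shows "covered J A"
proof -
  obtain R where "R \<subseteq> \<O>" "finite R" "card R \<le> A" "\<forall>x\<in>\<O>. \<exists>r\<in>R. x - r \<in> I"
    using assms(2) unfolding covered_def by blast
  moreover from this(4) have "\<forall>x\<in>\<O>. \<exists>r\<in>R. x - r \<in> J" using assms(1) by blast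
  ultimately show ?thesis unfolding covered_def by blast
qed

text \<open>Index along a chain: a remainder in \<open>I\<close> is reduced modulo \<open>L\<close>
  by multiples \<open>a * s\<close>, with \<open>s\<close> running through residues modulo
  \<open>J\<close>. The representatives are the sums \<open>r + a * s\<close>.\<close>

lemma covered_combine:
  assumes "covered I A" "covered J B" "a \<in> \<O>"
    and "\<And>x. x \<in> \<O> \<Longrightarrow> x \<in> I \<Longrightarrow> \<exists>y\<in>\<O>. \<forall>s\<in>\<O>. y - s \<in> J \<longrightarrow> x - a * s \<in> L"
    and I: "I \<subseteq> \<O>"
  shows "covered L (A * B)"
proof -
  obtain R where R: "R \<subseteq> \<O>" "finite R" "card R \<le> A" "\<forall>x\<in>\<O>. \<exists>r\<in>R. x - r \<in> I"
    using assms(1) unfolding covered_def by blast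
  obtain S where S: "S \<subseteq> \<O>" "finite S" "card S \<le> B" "\<forall>x\<in>\<O>. \<exists>s\<in>S. x - s \<in> J"
    using assms(2) unfolding covered_def by blast
  define f where "f = (\<lambda>(r, s). r + a * s)"
  show ?thesis
    unfolding covered_def
  proof (intro exI[of _ "f ` (R \<times> S)"] conjI ballI)
    show "f ` (R \<times> S) \<subseteq> \<O>" using R(1) S(1) assms(3) by (auto simp: f_def)
    have "card (f ` (R \<times> S)) \<le> card (R \<times> S)" using R(2) S(2) by (intro card_image_le) simp
    also have "\<dots> \<le> A * B" using R(3) S(3) by (simp add: card_cartesian_product mult_le_mono)
    finally show "card (f ` (R \<times> S)) \<le> A * B" .
    fix x assume x: "x \<in> \<O>"
    obtain r where r: "r \<in> R" "x - r \<in> I" using R(4) x by blast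
    obtain y where y: "y \<in> \<O>" "\<forall>s\<in>\<O>. y - s \<in> J \<longrightarrow> x - r - a * s \<in> L"
      using assms(4)[of "x - r"] r(2) I by blast
    obtain s where s: "s \<in> S" "y - s \<in> J" using S(4) y(1) by blast
    have "x - f (r, s) \<in> L" using y(2) s S(1) by (auto simp: f_def algebra_simps)
    then show "\<exists>t\<in>f ` (R \<times> S). x - t \<in> L" using r(1) s(1) by blast
  qed (use R(2) S(2) in simp)
qed

text \<open>Residues of \<qq>^n modulo \<qq>^(n+1) are v^n times residues modulo \<qq>. Indeed (z
  v)^n is a unit modulo \<qq>, so 1 = s + (z v)^n t with \<open>s\<close> in \<qq>; multiplied by
  \<open>x\<close> in \<qq>^n, this leaves a term s x in \<qq>^(n+1) and v^n times the integer t z^n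
  x.\<close>

lemma covered_pw:
  assumes q: "int_prime \<qq>" and cov: "covered \<qq> N"
  shows "covered (ideal_pow \<qq> n) (N ^ n)"
proof (induction n)
  case 0
  have "covered \<O> 1" unfolding covered_def by (intro exI[of _ "{0}"]) auto
  then show ?case by (simp only: ideal_group_pow_0 power_0)
next
  case (Suc n)
  have I: "int_ideal \<qq>" using q by (rule int_prime_ideal)
  have P: "int_ideal (ideal_pow \<qq> n)" using I by (rule ideal_pow_int_ideal)
  have P': "int_ideal (ideal_pow \<qq> (Suc n))" using I by (rule ideal_pow_int_ideal)
  obtain z where z: "z \<in> K" "z \<notin> \<O>" "\<forall>y\<in>\<qq>. z * y \<in> \<O>" using q by (rule exists_inverse_element)
  obtain v where v: "v \<in> \<qq>" "z * v \<notin> \<qq>"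
    using exists_local_parameter[OF q z(1,2) z(3)[rule_format]] by blast
  have vO: "v \<in> \<O>" using int_idealD(1)[OF I v(1)] .
  have w: "(z * v) ^ n \<in> \<O>" "(z * v) ^ n \<notin> \<qq>"
    using z(3) v int_prime_power[OF q _ v(2)] by auto
  obtain s t where st: "s \<in> \<qq>" "t \<in> \<O>" "1 = s + (z * v) ^ n * t"
    using q w by (rule int_prime_maximal)
  have "covered (ideal_pow \<qq> (Suc n)) (N ^ n * N)"
  proof (rule covered_combine[OF Suc.IH cov integers_power[OF vO, of n]])
    show "ideal_pow \<qq> n \<subseteq> \<O>" using int_idealD(1)[OF P] by blast
    fix x assume x: "x \<in> \<O>" "x \<in> ideal_pow \<qq> n"
    define e where "e = t * (z ^ n * x)"
    have eO: "e \<in> \<O>"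
      unfolding e_def using st(2) ideal_pow_inverse_power[OF I z(3)[rule_format] x(2)] by (rule integers_mult)
    have eq: "x = s * x + v ^ n * e"
    proof -
      have "1 * x = (s + (z * v) ^ n * t) * x" by (rule arg_cong[OF st(3)])
      also have "\<dots> = s * x + v ^ n * e"
        by (simp add: e_def power_mult_distrib algebra_simps)
      finally show ?thesis by (simp only: mult_1)
    qed
    show "\<exists>y\<in>\<O>. \<forall>u\<in>\<O>. y - u \<in> \<qq> \<longrightarrow> x - v ^ n * u \<in> ideal_pow \<qq> (Suc n)"
    proof (intro bexI[of _ e] ballI impI eO)
      fix u assume u: "u \<in> \<O>" "e - u \<in> \<qq>"
      have "x * s + v ^ n * (e - u) \<in> ideal_pow \<qq> (Suc n)"
        by (intro int_idealD(3)[OF P'] ideal_pow_mult ideal_pow_power x(2) st(1) u(2) I v(1))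
      moreover have "x - v ^ n * u = x * s + v ^ n * (e - u)"
        by (subst eq) (simp add: algebra_simps)
      ultimately show "x - v ^ n * u \<in> ideal_pow \<qq> (Suc n)" by (simp only:)
    qed
  qed
  then show ?case by (simp only: power_Suc2)
qed

lemma covered_principal_mult:
  assumes "covered (principal_ideal K a) A" "covered (principal_ideal K b) B" "a \<in> \<O>"
  shows "covered (principal_ideal K (a * b)) (A * B)"
proof (rule covered_combine[OF assms])
  show "principal_ideal K a \<subseteq> \<O>" using assms(3) by (auto simp: principal_ideal_def)
  fix x assume "x \<in> principal_ideal K a"
  then obtain y where y: "y \<in> \<O>" "x = y * a" by (auto simp: principal_ideal_def)
  show "\<exists>y\<in>\<O>. \<forall>s\<in>\<O>. y - s \<in> principal_ideal K b \<longrightarrow> x - a * s \<in> principal_ideal K (a * b)"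
  proof (intro bexI[of _ y] ballI impI y(1))
    fix s assume "y - s \<in> principal_ideal K b"
    then obtain u where u: "u \<in> \<O>" "y - s = u * b" by (auto simp: principal_ideal_def)
    have "x - a * s = a * (y - s)" by (simp add: y(2) algebra_simps)
    also have "\<dots> = u * (a * b)" by (simp add: u(2) mult_ac)
    finally show "x - a * s \<in> principal_ideal K (a * b)" using principal_idealI[OF u(1)] by simp
  qed
qed

text \<open>Representatives are transported by the automorphism; its inverse brings a given element
  back to where it can be reduced.\<close>

lemma covered_principal_Gal:
  assumes \<sigma>: "\<sigma> \<in> Gal K" and a: "a \<in> \<O>" and cov: "covered (principal_ideal K a) A"
  shows "covered (principal_ideal K (\<sigma> a)) A"
proof -
  have hom: "\<sigma> \<in> embeddings K" using \<sigma> Gal_subset by blast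
  obtain R where R: "R \<subseteq> \<O>" "finite R" "card R \<le> A" "\<forall>x\<in>\<O>. \<exists>r\<in>R. x - r \<in> principal_ideal K a"
    using cov unfolding covered_def by blast
  obtain \<tau> where \<tau>: "\<tau> \<in> Gal K" "\<forall>x\<in>K. \<sigma> (\<tau> x) = x"
    by (rule Gal_inverse[OF \<sigma>]) blast
  show ?thesis
    unfolding covered_def
  proof (intro exI[of _ "\<sigma> ` R"] conjI ballI)
    show "\<sigma> ` R \<subseteq> \<O>" using R(1) \<sigma> by auto
    show "card (\<sigma> ` R) \<le> A" using card_image_le[OF R(2), of \<sigma>] R(3) by simp
    fix x assume x: "x \<in> \<O>"
    have "\<tau> x \<in> \<O>" using Gal_integers[OF \<tau>(1) x] .
    then obtain r where r: "r \<in> R" "\<tau> x - r \<in> principal_ideal K a" using R(4) by blast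
    then obtain y where y: "y \<in> \<O>" "\<tau> x - r = y * a" by (auto simp: principal_ideal_def)
    have K: "r \<in> K" "y \<in> K" "a \<in> K" "\<tau> x \<in> K" "x \<in> K"
      using r(1) R(1) y(1) a x \<open>\<tau> x \<in> \<O>\<close> by auto
    have "x - \<sigma> r = \<sigma> (\<tau> x - r)" using K by (simp add: embedding_diff[OF hom] \<tau>(2))
    also have "\<dots> = \<sigma> y * \<sigma> a" using K by (simp add: y(2) embedding_simps[OF hom])
    also have "\<dots> \<in> principal_ideal K (\<sigma> a)" using Gal_integers[OF \<sigma> y(1)] by (rule principal_idealI)
    finally show "\<exists>r\<in>\<sigma> ` R. x - r \<in> principal_ideal K (\<sigma> a)" using r(1) by blast
  qed (use R(2) in simp)
qed

text \<open>Multiplying over all conjugates replaces \<open>a\<close> by its norm, and for a rational integer the size of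
  a residue system is known.\<close>

lemma Nm_le_residues:
  assumes a: "a \<in> \<O>" "a \<noteq> 0" and cov: "covered (principal_ideal K a) A"
  shows "cmod (Nm a) \<le> real A"
proof -
  have prod: "covered (principal_ideal K (\<Prod>\<sigma>\<in>F. \<sigma> a)) (A ^ card F)" if "finite F" "F \<subseteq> Gal K" for F
    using that
  proof (induction F)
    case empty
    have "covered (principal_ideal K 1) 1"
      unfolding covered_def by (intro exI[of _ "{0}"]) (auto simp: principal_ideal_def)
    then show ?case by simp
  next
    case (insert \<sigma> F)
    have "covered (principal_ideal K (\<sigma> a * (\<Prod>\<sigma>\<in>F. \<sigma> a))) (A * A ^ card F)"
    proof (rule covered_principal_mult)
      have \<sigma>: "\<sigma> \<in> Gal K" using insert.prems by simp
      show "covered (principal_ideal K (\<sigma> a)) A" by (rule covered_principal_Gal[OF \<sigma> a(1) cov])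
      show "\<sigma> a \<in> \<O>" by (rule Gal_integers[OF \<sigma> a(1)])
      show "covered (principal_ideal K (\<Prod>\<sigma>\<in>F. \<sigma> a)) (A ^ card F)" using insert by simp
    qed
    then show ?case using insert.hyps by simp
  qed
  obtain k where k: "Nm a = of_int k" using Nm_Ints[OF a(1)] by (auto elim: Ints_cases)
  have "k \<noteq> 0" using Nm_eq_0_iff[OF integers_in_K[OF a(1)]] a(2) k by auto
  define t where "t = nat \<bar>k\<bar>"
  have t: "t > 0" using \<open>k \<noteq> 0\<close> by (simp add: t_def)
  have "principal_ideal K (of_int k) \<subseteq> principal_ideal K (of_nat t)"
  proof
    fix x assume "x \<in> principal_ideal K (of_int k)"
    then obtain y where y: "y \<in> \<O>" "x = y * of_int k" by (auto simp: principal_ideal_def)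
    have t_abs: "of_nat t = (of_int \<bar>k\<bar> :: complex)" by (simp add: t_def)
    have "x = y * of_int (sgn k * \<bar>k\<bar>)" by (simp only: y(2) sgn_mult_abs)
    also have "\<dots> = (of_int (sgn k) * y) * of_nat t"
      unfolding t_abs of_int_mult by (simp only: mult_ac)
    finally have "x = (of_int (sgn k) * y) * of_nat t" .
    then show "x \<in> principal_ideal K (of_nat t)"
      using principal_idealI[OF integers_mult[OF integers_of_int y(1)]] by blast
  qed
  moreover have "covered (principal_ideal K (of_int k)) (A ^ ngal)"
    using prod[OF finite_Gal subset_refl] unfolding k[symmetric] Nm_def ngal_def .
  ultimately have "covered (principal_ideal K (of_nat t)) (A ^ ngal)" by (rule covered_mono)
  moreover obtain b where "zbasis b ngal" using exists_zbasis by blast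
  \<comment> \<open>Both exponents are \<open>ngal\<close>: the norm has that many factors, and \<O>
    has that rank.\<close>
  ultimately have "t ^ ngal \<le> A ^ ngal" using covered_of_nat_lower t by blast
  then have "t \<le> A" using ngal_pos by (simp add: power_mono_iff)
  moreover have "cmod (Nm a) = real t" by (simp add: k t_def)
  ultimately show ?thesis by simp
qed

lemma Nm_prime_power_generator:
  assumes q: "int_prime \<qq>" and "ideal_norm K \<qq> > 0" and a: "a \<in> \<O>" "a \<noteq> 0"
    and gen: "ideal_pow \<qq> h = principal_ideal K a"
  shows "cmod (Nm a) \<le> real (ideal_norm K \<qq>) ^ h"
  using Nm_le_residues[OF a, of "ideal_norm K \<qq> ^ h"]
    covered_pw[OF q covered_prime[OF assms(1,2)], of h]
  unfolding gen by simp

section \<open>Ramified primes divide the discriminant\<close>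

lemma ramified_le_discriminant:
  assumes p: "p \<in> Ram K"
  shows "real p \<le> cmod (discriminant K)"
proof -
  obtain \<qq> where \<qq>: "\<qq> \<in> primes_of K" "lies_over \<qq> p" "ram_index K \<qq> p > 1"
    and pp: "Factorial_Ring.prime p" using p unfolding Ram_def by blast
  have q: "int_prime \<qq>" using \<qq>(1) by (rule primes_of_int_prime)
  have I: "int_ideal \<qq>" using q by (rule int_prime_ideal)
  have p0: "p > 0" using pp prime_gt_0_nat by blast
  define e where "e = nat (ord_at K \<qq> (of_nat p))"
  have "(of_nat p :: complex) \<in> ideal_pow \<qq> e"
    unfolding e_def using p0 by (intro ord_at_props(2)[OF q]) simp_all
  moreover have "Suc (Suc 0) \<le> e" using \<qq>(3) unfolding e_def ram_index_def by linarith
  ultimately have p2: "(of_nat p :: complex) \<in> ideal_pow \<qq> (Suc (Suc 0))"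
    using ideal_pow_antimono[OF I] by blast
  have pq: "(of_nat p :: complex) \<in> \<qq>" using p2 ideal_pow_Suc_subset_prime[OF I] by blast
  obtain z where z: "z \<in> K" "z \<notin> \<O>" "\<forall>y\<in>\<qq>. z * y \<in> \<O>" using q by (rule exists_inverse_element)
  define x where "x = z * of_nat p"
  have "x \<in> ideal_pow \<qq> (Suc 0)"
    unfolding x_def by (rule ideal_pow_inverse_element[OF I z(3)[rule_format] p2])
  then have xq: "x \<in> \<qq>" using ideal_pow_Suc_subset_prime[OF I] by blast
  have xO: "x \<in> \<O>" using int_idealD(1)[OF I xq] .
  \<comment> \<open>If \<sigma> moves some \<open>u\<close> of \<qq> out of \<qq>, then the product
    of \<sigma> u and \<sigma> x is \<open>p\<close> times the integer \<sigma> (z u), hence in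
    \<qq>, and primality gives the second factor. Otherwise \<sigma> maps \<qq>, and with it
    \<open>x\<close>, into \<qq>.\<close>
  have x_conj: "\<sigma> x \<in> \<qq>" if \<sigma>: "\<sigma> \<in> Gal K" for \<sigma>
  proof (cases "\<sigma> ` \<qq> \<subseteq> \<qq>")
    case False
    then obtain u where u: "u \<in> \<qq>" "\<sigma> u \<notin> \<qq>" by blast
    have uO: "u \<in> \<O>" using int_idealD(1)[OF I u(1)] .
    have hom: "\<sigma> \<in> embeddings K" using \<sigma> Gal_subset by blast
    have zu: "z * u \<in> \<O>" using z(3) u(1) by blast
    have "\<sigma> u * \<sigma> x = \<sigma> (of_nat p * (z * u))"
      using uO xO by (simp add: embedding_simps(2)[OF hom, symmetric] integers_in_K x_def mult_ac)
    also have "\<dots> = of_nat p * \<sigma> (z * u)"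
      using zu by (simp add: embedding_simps(2)[OF hom] integers_in_K embedding_of_nat[OF hom])
    also have "\<dots> \<in> \<qq>" using int_idealD(5)[OF I pq Gal_integers[OF \<sigma> zu]] .
    finally show ?thesis
      using int_prime_mult[OF q Gal_integers[OF \<sigma> uO] Gal_integers[OF \<sigma> xO]] u(2) by blast
  qed (use xq in blast)
  show ?thesis
  proof (rule le_discriminant_if_trace_divisible[OF xO _ pp])
    show "x \<notin> principal_ideal K (of_nat p)"
      using p0 z(2) by (simp add: principal_of_nat_iff x_def)
    fix y assume y: "y \<in> \<O>"
    have conj: "\<sigma> (x * y) \<in> \<qq>" if \<sigma>: "\<sigma> \<in> Gal K" for \<sigma>
    proof -
      have hom: "\<sigma> \<in> embeddings K" using \<sigma> Gal_subset by blast
      have "\<sigma> (x * y) = \<sigma> x * \<sigma> y"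
        using xO y by (simp add: embedding_simps(2)[OF hom] integers_in_K)
      also have "\<dots> \<in> \<qq>" using int_idealD(5)[OF I x_conj[OF \<sigma>] Gal_integers[OF \<sigma> y]] .
      finally show ?thesis .
    qed
    have sum_q: "(\<Sum>\<sigma>\<in>F. \<sigma> (x * y)) \<in> \<qq>" if "finite F" "F \<subseteq> Gal K" for F
      using that
    proof (induction F rule: finite_induct)
      case (insert \<sigma> F)
      then show ?case using int_idealD(3)[OF I conj[of \<sigma>]] by simp
    qed (simp add: int_idealD(2)[OF I])
    have "Tr (x * y) \<in> \<qq>" unfolding Tr_def by (rule sum_q[OF finite_Gal subset_refl])
    moreover have "Tr (x * y) \<in> \<int>" using Tr_Ints[OF integers_mult[OF xO y]] .
    ultimately obtain k where "k \<in> \<int>" "Tr (x * y) = of_nat p * k"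
      using \<qq>(2) unfolding lies_over_def by blast
    then show "\<exists>k :: int. Tr (x * y) = of_int (int p * k)" by (auto elim!: Ints_cases)
  qed
qed

end

section \<open>Finiteness of the class group\<close>

lemma complex_of_rat: "(of_rat x :: complex) = of_real (of_rat x)"
  by (induct x) (simp add: of_rat_rat)

context galois_number_field
begin

text \<open>Small rational coordinates make every conjugate small; for \<open>e\<close> below the
  reciprocal of the sum over the basis, the norm drops below 1.\<close>

lemma norm_bound_rational_combination:
  assumes b: "\<And>j. j < ngal \<Longrightarrow> b j \<in> K" and r: "\<And>j. j < ngal \<Longrightarrow> \<bar>real_of_rat (r j)\<bar> \<le> e"
  shows "cmod (Nm (\<Sum>j<ngal. of_rat (r j) * b j)) \<le> (e * (\<Sum>j<ngal. \<Sum>i<ngal. cmod (gal i (b j)))) ^ ngal"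
proof -
  define B where "B = (\<Sum>j<ngal. \<Sum>i<ngal. cmod (gal i (b j)))"
  have bound: "cmod (gal i (\<Sum>j<ngal. of_rat (r j) * b j)) \<le> e * B" if i: "i < ngal" for i
  proof -
    have e: "e \<ge> 0" using r[OF ngal_pos] by linarith
    have "gal i (\<Sum>j<ngal. of_rat (r j) * b j) = (\<Sum>j<ngal. of_rat (r j) * gal i (b j))"
      using b by (intro gal_rat_combination[OF i]) simp
    also have "cmod \<dots> \<le> (\<Sum>j<ngal. cmod (of_rat (r j) * gal i (b j)))" by (rule norm_sum)
    also have "\<dots> \<le> (\<Sum>j<ngal. e * (\<Sum>i<ngal. cmod (gal i (b j))))"
    proof (rule sum_mono)
      fix j assume "j \<in> {..<ngal}"
      then have j: "j < ngal" by simp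
      have "cmod (of_rat (r j)) = \<bar>real_of_rat (r j)\<bar>"
        by (simp only: complex_of_rat norm_of_real)
      then have "cmod (of_rat (r j) * gal i (b j)) = \<bar>real_of_rat (r j)\<bar> * cmod (gal i (b j))"
        by (simp add: norm_mult)
      also have "\<dots> \<le> e * (\<Sum>i<ngal. cmod (gal i (b j)))"
        using r[OF j] e i by (intro mult_mono member_le_sum) auto
      finally show "cmod (of_rat (r j) * gal i (b j)) \<le> e * (\<Sum>i<ngal. cmod (gal i (b j)))" .
    qed
    finally show ?thesis by (simp add: B_def sum_distrib_left)
  qed
  have "cmod (Nm (\<Sum>j<ngal. of_rat (r j) * b j)) = (\<Prod>i<ngal. cmod (gal i (\<Sum>j<ngal. of_rat (r j) * b j)))"
    unfolding Nm_def prod_norm[symmetric]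
    using prod.reindex_bij_betw[OF bij_gal, of "\<lambda>\<sigma>. cmod (\<sigma> (\<Sum>j<ngal. of_rat (r j) * b j))"] by simp
  also have "\<dots> \<le> (\<Prod>i<ngal. e * B)" by (intro prod_mono) (use bound in auto)
  finally show ?thesis by (simp add: B_def)
qed

text \<open>Dirichlet's simultaneous approximation: the n^r + 1 multipliers from 0 to n^r fall into
  n^r boxes of side 1/n, and the difference of two multipliers sharing a box is the required
  one.\<close>

lemma pigeonhole_fractional_parts:
  fixes q :: "nat \<Rightarrow> rat"
  assumes n: "n > 0"
  obtains t :: nat and c :: "nat \<Rightarrow> int" where "t > 0" "t \<le> n ^ r"
    "\<forall>j<r. \<bar>of_nat t * q j - of_int (c j)\<bar> \<le> 1 / of_nat n"
proof -
  define F where "F = {..<r} \<rightarrow>\<^sub>E {..<n}"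
  have F: "finite F" "card F = n ^ r" by (auto simp: F_def card_PiE intro!: finite_PiE)
  define box where "box t = (\<lambda>j\<in>{..<r}. nat \<lfloor>of_nat n * frac (of_nat t * q j)\<rfloor>)" for t :: nat
  have "box t \<in> F" for t
    unfolding F_def box_def
  proof (intro restrict_PiE_iff[THEN iffD2] ballI)
    fix j assume "j \<in> {..<r}"
    have "of_nat n * frac (of_nat t * q j) < of_nat n * 1"
      using n by (intro mult_strict_left_mono frac_lt_1) simp
    then have "\<lfloor>of_nat n * frac (of_nat t * q j)\<rfloor> < int n" by (simp add: floor_less_iff)
    then show "nat \<lfloor>of_nat n * frac (of_nat t * q j)\<rfloor> \<in> {..<n}" using n by (simp add: nat_less_iff)
  qed
  then have "\<not> inj_on box {..n ^ r}"
    using card_inj_on_le[of box "{..n ^ r}" F] F by auto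
  then obtain s t where st: "s < t" "t \<le> n ^ r" "box s = box t"
    unfolding inj_on_def by (metis atMost_iff linorder_neqE_nat)
  have "\<bar>of_nat (t - s) * q j - of_int (\<lfloor>of_nat t * q j\<rfloor> - \<lfloor>of_nat s * q j\<rfloor>)\<bar> \<le> 1 / of_nat n"
    if j: "j < r" for j
  proof -
    define x y where "x = frac (of_nat t * q j)" and "y = frac (of_nat s * q j)"
    have xy: "x \<ge> 0" "y \<ge> 0" by (simp_all add: x_def y_def)
    have "nat \<lfloor>of_nat n * x\<rfloor> = nat \<lfloor>of_nat n * y\<rfloor>"
      using fun_cong[OF st(3), of j] j by (simp add: box_def x_def y_def)
    then have "\<lfloor>of_nat n * x\<rfloor> = \<lfloor>of_nat n * y\<rfloor>"
      using xy by (simp add: nat_eq_iff)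
    then have "\<bar>of_nat n * x - of_nat n * y\<bar> \<le> 1" by linarith
    then have "of_nat n * \<bar>x - y\<bar> \<le> 1" by (simp add: abs_mult flip: right_diff_distrib)
    then have "\<bar>x - y\<bar> \<le> 1 / of_nat n" using n by (simp add: field_simps)
    moreover have "of_nat (t - s) * q j - of_int (\<lfloor>of_nat t * q j\<rfloor> - \<lfloor>of_nat s * q j\<rfloor>) = x - y"
      using st(1) by (simp add: x_def y_def frac_def of_nat_diff algebra_simps)
    ultimately show ?thesis by (simp only:)
  qed
  then show ?thesis
    using that[of "t - s" "\<lambda>j. \<lfloor>of_nat t * q j\<rfloor> - \<lfloor>of_nat s * q j\<rfloor>"] st by simp
qed

text \<open>A substitute for Euclidean division: after a bounded multiplier \<open>t\<close>, the
  coordinates of \<open>x\<close> are within 1/n of integers. Taking \<open>n\<close> beyond the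
  basis constant \<open>B\<close> forces the remainder to have norm below 1.\<close>

lemma approximate_division:
  obtains M :: nat where "\<forall>x\<in>K. \<exists>t w. 0 < t \<and> t \<le> M \<and> w \<in> \<O> \<and> cmod (Nm (of_nat t * x - w)) < 1"
proof -
  obtain b where b: "zbasis b ngal" "conj_det b \<noteq> 0" using exists_zbasis by blast
  have b_int: "b j \<in> \<O>" if "j < ngal" for j using b(1) that by (simp add: zbasis_def)
  have bK: "b j \<in> K" if "j < ngal" for j using b_int[OF that] by (rule integers_in_K)
  define B where "B = (\<Sum>j<ngal. \<Sum>i<ngal. cmod (gal i (b j)))"
  have B: "B \<ge> 0" unfolding B_def by (intro sum_nonneg) simp
  obtain n :: nat where n: "real n > B" using reals_Archimedean2 by blast
  then have n0: "n > 0" using B by (cases n) auto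
  show ?thesis
  proof (rule that[of "n ^ ngal"], intro ballI)
    fix x assume x: "x \<in> K"
    have ex: "\<exists>q :: nat \<Rightarrow> rat. x = (\<Sum>j<ngal. of_rat (q j) * b j)"
      using rational_coordinates[of b x, OF bK b(2) x] .
    define q where "q = (SOME q :: nat \<Rightarrow> rat. x = (\<Sum>j<ngal. of_rat (q j) * b j))"
    have q: "x = (\<Sum>j<ngal. of_rat (q j) * b j)" unfolding q_def using someI_ex[OF ex] .
    obtain t :: nat and c :: "nat \<Rightarrow> int" where t: "t > 0" "t \<le> n ^ ngal"
      and c: "\<forall>j<ngal. \<bar>of_nat t * q j - of_int (c j)\<bar> \<le> 1 / of_nat n"
      using pigeonhole_fractional_parts[OF n0] .
    define w where "w = (\<Sum>j<ngal. of_int (c j) * b j)"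
    have wO: "w \<in> \<O>" unfolding w_def by (intro integers_sum integers_mult integers_of_int b_int) simp
    define r where "r j = of_nat t * q j - of_int (c j)" for j
    have eq: "of_nat t * x - w = (\<Sum>j<ngal. of_rat (r j) * b j)"
    proof -
      have "of_nat t * x = (\<Sum>j<ngal. of_nat t * of_rat (q j) * b j)"
        by (subst q) (simp add: sum_distrib_left mult.assoc)
      then show ?thesis
        by (simp add: w_def r_def of_rat_diff of_rat_mult left_diff_distrib sum_subtractf)
    qed
    have "\<bar>real_of_rat (r j)\<bar> \<le> 1 / real n" if "j < ngal" for j
    proof -
      have "real_of_rat \<bar>r j\<bar> \<le> real_of_rat (1 / of_nat n)"
        using c that unfolding r_def of_rat_less_eq by blast
      then show ?thesis by (simp add: of_rat_divide)
    qed
    then have "cmod (Nm (of_nat t * x - w)) \<le> (1 / real n * B) ^ ngal"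
      unfolding eq B_def by (intro norm_bound_rational_combination bK)
    also have "\<dots> < 1"
    proof -
      have "1 / real n * B < 1" using n n0 by (simp add: field_simps)
      then show ?thesis using B ngal_pos power_strict_mono[of "1 / real n * B" 1 ngal] by simp
    qed
    finally show "\<exists>t w. 0 < t \<and> t \<le> n ^ ngal \<and> w \<in> \<O> \<and> cmod (Nm (of_nat t * x - w)) < 1"
      using t wO by blast
  qed
qed

section \<open>Scaled ideals and their classes\<close>

definition scale :: "complex \<Rightarrow> complex set \<Rightarrow> complex set" where
  "scale c I = (\<lambda>x. c * x) ` I"

lemma scale_scale: "scale c (scale d I) = scale (c * d) I"
  by (auto simp: scale_def image_image mult.assoc)

lemma scale_0: "0 \<in> I \<Longrightarrow> 0 \<in> scale c I"
  unfolding scale_def by (rule image_eqI[of _ _ 0]) simp_all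

lemma scale_add:
  assumes "\<And>x y. x \<in> I \<Longrightarrow> y \<in> I \<Longrightarrow> x + y \<in> I" "u \<in> scale c I" "v \<in> scale c I"
  shows "u + v \<in> scale c I"
proof -
  obtain x y where xy: "x \<in> I" "u = c * x" "y \<in> I" "v = c * y"
    using assms(2,3) unfolding scale_def by blast
  have "u + v = c * (x + y)" by (simp only: xy(2,4) distrib_left)
  then show ?thesis using assms(1)[OF xy(1,3)] unfolding scale_def by blast
qed

lemma scale_mult:
  assumes "\<And>x y. x \<in> \<O> \<Longrightarrow> y \<in> I \<Longrightarrow> x * y \<in> I" "x \<in> \<O>" "u \<in> scale c I"
  shows "x * u \<in> scale c I"
proof -
  obtain y where y: "y \<in> I" "u = c * y" using assms(3) unfolding scale_def by blast
  have "x * u = c * (x * y)" by (simp only: y(2) mult_ac)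
  then show ?thesis using assms(1)[OF assms(2) y(1)] unfolding scale_def by blast
qed

text \<open>Hurwitz: if \<open>b\<close> is a nonzero element of \<open>I\<close> of minimal norm, approximate division by \<open>b\<close>
  leaves no remainder, so \<open>M!\<close> times \<open>I\<close> lies in the principal ideal of \<open>b\<close>.\<close>

lemma ideal_class_representative:
  obtains F :: nat where "F > 0" "\<forall>I. int_ideal I \<and> I \<noteq> {0} \<longrightarrow>
    (\<exists>y J. y \<in> K - {0} \<and> int_ideal J \<and> of_nat F \<in> J \<and> I = scale y J)"
proof -
  obtain M :: nat where
    M: "\<forall>x\<in>K. \<exists>t w. 0 < t \<and> t \<le> M \<and> w \<in> \<O> \<and> cmod (Nm (of_nat t * x - w)) < 1"
    by (rule approximate_division)
  \<comment> \<open>Every multiplier up to \<open>M\<close> divides this number, so one factor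
    serves all elements.\<close>
  define F :: nat where "F = fact M"
  have F: "F > 0" by (simp add: F_def)
  have main: "\<exists>y J. y \<in> K - {0} \<and> int_ideal J \<and> of_nat F \<in> J \<and> I = scale y J"
    if I: "int_ideal I" and ne: "I \<noteq> {0}" for I
  proof -
    \<comment> \<open>Norms of integers have integral absolute value; read as natural numbers, they
      attain a minimum.\<close>
    define \<mu> where "\<mu> x = nat \<lfloor>cmod (Nm x)\<rfloor>" for x
    obtain b\<^sub>0 where "b\<^sub>0 \<in> I \<and> b\<^sub>0 \<noteq> 0" using ne int_idealD(2)[OF I] by blast
    then obtain b where b: "b \<in> I" "b \<noteq> 0" and min: "\<forall>x. x \<in> I \<and> x \<noteq> 0 \<longrightarrow> \<mu> b \<le> \<mu> x"
      using ex_has_least_nat[of "\<lambda>x. x \<in> I \<and> x \<noteq> 0" b\<^sub>0 \<mu>] by blast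
    have bO: "b \<in> \<O>" using int_idealD(1)[OF I b(1)] .
    have bK: "b \<in> K" using bO by (rule integers_in_K)
    have \<mu>: "real (\<mu> x) = cmod (Nm x)" if xO: "x \<in> \<O>" for x
    proof -
      obtain z where "Nm x = of_int z" using Nm_Ints[OF xO] by (auto elim!: Ints_cases)
      then have "cmod (Nm x) = real_of_int \<bar>z\<bar>" by simp
      then show ?thesis unfolding \<mu>_def by simp
    qed
    have nb: "Nm b \<noteq> 0" using Nm_eq_0_iff[OF bK] b(2) by simp
    have div: "of_nat F / b * x \<in> \<O>" if x: "x \<in> I" for x
    proof -
      have xO: "x \<in> \<O>" using int_idealD(1)[OF I x] .
      have xb: "x / b \<in> K" using xO bO by (intro divide_closed integers_in_K)
      then obtain t w where t: "0 < t" "t \<le> M" "w \<in> \<O>" "cmod (Nm (of_nat t * (x / b) - w)) < 1"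
        using M by blast
      define y where "y = of_nat t * x - w * b"
      have yI: "y \<in> I"
        unfolding y_def by (intro int_ideal_diff[OF I] int_idealD(4)[OF I] x b(1) t(3) integers_of_nat)
      have "y = (of_nat t * (x / b) - w) * b" using b(2) by (simp add: y_def left_diff_distrib)
      then have "Nm y = Nm (of_nat t * (x / b) - w) * Nm b"
        using xb t(3) bK by (simp only: Nm_mult diff_closed mult_closed of_nat_closed integers_in_K)
      then have "cmod (Nm y) < cmod (Nm b)" using t(4) nb by (simp add: norm_mult)
      then have "\<mu> y < \<mu> b" using \<mu>[OF int_idealD(1)[OF I yI]] \<mu>[OF bO] by linarith
      then have "y = 0" using min yI by (meson leD)
      then have tx: "of_nat t * x = w * b" by (simp add: y_def)
      obtain k where k: "F = t * k" using dvd_fact[of t M] t(1,2) unfolding F_def by (auto elim: dvdE)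
      have "of_nat F / b * x = of_nat k * (of_nat t * x) / b" by (simp add: k mult_ac)
      also have "\<dots> = of_nat k * w" using b(2) by (simp add: tx)
      finally show ?thesis using t(3) by (simp add: integers_mult)
    qed
    \<comment> \<open>The factor maps \<open>I\<close> into \<O> and sends \<open>b\<close> to
      \<open>F\<close>, so all representatives share the element \<open>F\<close>.\<close>
    define J where "J = scale (of_nat F / b) I"
    have "int_ideal J"
      unfolding int_ideal_def
    proof (intro conjI ballI)
      show "J \<subseteq> \<O>" using div by (auto simp: J_def scale_def)
      show "0 \<in> J" unfolding J_def by (rule scale_0[OF int_idealD(2)[OF I]])
      show "x + y \<in> J" if "x \<in> J" "y \<in> J" for x y
        using int_idealD(3)[OF I] that unfolding J_def by (rule scale_add)
      show "x * y \<in> J" if "x \<in> \<O>" "y \<in> J" for x y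
        using int_idealD(4)[OF I] that unfolding J_def by (rule scale_mult)
    qed
    moreover have "of_nat F \<in> J"
      using b by (auto simp: J_def scale_def intro!: image_eqI[of _ _ b])
    moreover have "I = scale (b / of_nat F) J"
    proof -
      have "b / of_nat F * (of_nat F / b) = (1 :: complex)" using b(2) F by simp
      then show ?thesis unfolding J_def scale_scale by (simp add: scale_def)
    qed
    moreover have "b / of_nat F \<in> K - {0}" using b(2) bK F by (auto intro: divide_closed)
    ultimately show ?thesis by blast
  qed
  show ?thesis
  proof (rule that[OF F], intro allI impI)
    fix I assume "int_ideal I \<and> I \<noteq> {0}"
    then show "\<exists>y J. y \<in> K - {0} \<and> int_ideal J \<and> of_nat F \<in> J \<and> I = scale y J"
      using main[of I] by simp
  qed
qed

text \<open>Such an ideal is a union of residue classes modulo \<open>F\<close>, so its intersection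
  with a finite residue system determines it.\<close>

lemma finite_ideals_containing:
  assumes F: "F > 0"
  shows "finite {J. int_ideal J \<and> of_nat F \<in> J}" (is "finite ?S")
proof -
  obtain R where R: "R \<subseteq> \<O>" "finite R"
    "\<forall>x\<in>\<O>. \<exists>r\<in>R. x - r \<in> principal_ideal K (of_nat F)"
    using covered_nat[OF F] .
  have sub: "J \<subseteq> J'" if J: "J \<in> ?S" and J': "J' \<in> ?S" and eq: "J \<inter> R = J' \<inter> R" for J J'
  proof
    fix x assume x: "x \<in> J"
    have IJ: "int_ideal J" "int_ideal J'" using J J' by blast+
    obtain r where r: "r \<in> R" "x - r \<in> principal_ideal K (of_nat F)"
      using R(3) int_idealD(1)[OF IJ(1) x] by blast
    have "x - r \<in> J" "x - r \<in> J'"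
      using r(2) principal_subset[OF IJ(1)] principal_subset[OF IJ(2)] J J' by blast+
    then have "r \<in> J" using int_ideal_diff_iff[OF IJ(1)] x by blast
    then have "r \<in> J'" using eq r(1) by blast
    then show "x \<in> J'" using int_ideal_diff_iff[OF IJ(2) \<open>x - r \<in> J'\<close>] by blast
  qed
  have "inj_on (\<lambda>J. J \<inter> R) ?S"
    by (rule inj_onI, rule subset_antisym) (use sub in \<open>simp_all only:\<close>)
  moreover have "finite ((\<lambda>J. J \<inter> R) ` ?S)"
    by (rule finite_subset[of _ "Pow R"]) (use R(2) in auto)
  ultimately show ?thesis by (rule finite_imageD[rotated])
qed

text \<open>Multiplying by a principal ideal is scaling by its generator. Only closure conditions
  are assumed of \<open>I\<close>, so that the lemma covers scaled ideals, which may leave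
  \<O>.\<close>

lemma principal_coset:
  assumes "0 \<in> I" "\<And>x y. x \<in> I \<Longrightarrow> y \<in> I \<Longrightarrow> x + y \<in> I" "\<And>x y. x \<in> \<O> \<Longrightarrow> y \<in> I \<Longrightarrow> x * y \<in> I"
  shows "ideal_class K I = {scale x I | x. x \<in> K - {0}}"
proof -
  have "ideal_prod (num_ring K) (principal_ideal K x) I = scale x I" for x
  proof (intro subset_antisym subsetI)
    fix y assume "y \<in> ideal_prod (num_ring K) (principal_ideal K x) I"
    then show "y \<in> scale x I"
    proof (rule ideal_prod_subset[rotated 2])
      show "i * j \<in> scale x I" if ij: "i \<in> principal_ideal K x" "j \<in> I" for i j
      proof -
        obtain u where "u \<in> \<O>" "i = u * x" using ij(1) by (auto simp: principal_ideal_def)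
        then have "u * j \<in> I" "i * j = x * (u * j)" using assms(3)[of u j] ij(2) by simp_all
        then show ?thesis unfolding scale_def by blast
      qed
      show "u + v \<in> scale x I" if "u \<in> scale x I" "v \<in> scale x I" for u v
        using assms(2) that by (rule scale_add)
    qed
  next
    fix y assume "y \<in> scale x I"
    then obtain i where i: "i \<in> I" "y = x * i" by (auto simp: scale_def)
    have "x \<in> principal_ideal K x" using principal_idealI[OF integers_1, of x] by simp
    then show "y \<in> ideal_prod (num_ring K) (principal_ideal K x) I"
      using ideal_prod.prod[of x "principal_ideal K x" i I "num_ring K"] i by simp
  qed
  then show ?thesis
    unfolding ideal_class_def r_coset_def principal_ideals_def by (auto simp: ideal_group_def)
qed

lemma ideal_class_scale:
  assumes J: "int_ideal J" and y: "y \<in> K - {0}"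
  shows "ideal_class K (scale y J) = ideal_class K J"
proof -
  have "ideal_class K (scale y J) = {scale x (scale y J) | x. x \<in> K - {0}}"
  proof (rule principal_coset)
    show "0 \<in> scale y J" by (rule scale_0[OF int_idealD(2)[OF J]])
    show "u + v \<in> scale y J" if "u \<in> scale y J" "v \<in> scale y J" for u v
      using int_idealD(3)[OF J] that by (rule scale_add)
    show "u * v \<in> scale y J" if "u \<in> \<O>" "v \<in> scale y J" for u v
      using int_idealD(4)[OF J] that by (rule scale_mult)
  qed
  also have "\<dots> = {scale x J | x. x \<in> K - {0}}"
  proof (intro subset_antisym subsetI)
    fix A assume "A \<in> {scale x (scale y J) | x. x \<in> K - {0}}"
    then obtain x where "x \<in> K - {0}" "A = scale (x * y) J" by (auto simp: scale_scale)
    moreover from this y have "x * y \<in> K - {0}" by (auto intro: mult_closed)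
    ultimately show "A \<in> {scale x J | x. x \<in> K - {0}}" by blast
  next
    fix A assume "A \<in> {scale x J | x. x \<in> K - {0}}"
    then obtain x where x: "x \<in> K - {0}" "A = scale x J" by blast
    have "x = x / y * y" using y by simp
    then have "A = scale (x / y) (scale y J)" using x(2) by (simp add: scale_scale)
    moreover have "x / y \<in> K - {0}" using x y by (auto intro: divide_closed)
    ultimately show "A \<in> {scale x (scale y J) | x. x \<in> K - {0}}" by blast
  qed
  also have "\<dots> = ideal_class K J"
    by (rule principal_coset[symmetric]) (use int_idealD[OF J] in auto)
  finally show ?thesis .
qed

lemma fractional_ideal_scale:
  assumes "fractional_ideal K I"
  obtains d J where "d \<in> K - {0}" "int_ideal J" "J \<noteq> {0}" "I = scale d J"
proof -
  interpret additive_subgroup I "num_ring K" using assms by (simp add: fractional_ideal_def)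
  obtain c where c: "c \<in> \<O> - {0}" "\<forall>y\<in>I. c * y \<in> \<O>"
    using assms unfolding fractional_ideal_def by blast
  have mult: "\<forall>x\<in>\<O>. \<forall>y\<in>I. x * y \<in> I" using assms unfolding fractional_ideal_def by blast
  define J where "J = scale c I"
  have add: "x + y \<in> I" if "x \<in> I" "y \<in> I" for x y using a_closed[OF that] by simp
  have zero: "0 \<in> I" using zero_closed by simp
  have J: "int_ideal J"
    unfolding int_ideal_def
  proof (intro conjI ballI)
    show "J \<subseteq> \<O>" using c by (auto simp: J_def scale_def)
    show "0 \<in> J" unfolding J_def by (rule scale_0[OF zero])
    show "x + y \<in> J" if "x \<in> J" "y \<in> J" for x y
      using add that unfolding J_def by (rule scale_add)
    show "x * y \<in> J" if "x \<in> \<O>" "y \<in> J" for x y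
      using mult[rule_format] that unfolding J_def by (rule scale_mult)
  qed
  have "I \<noteq> {0}" using assms unfolding fractional_ideal_def by blast
  then obtain u where "u \<in> I" "u \<noteq> 0" using zero by blast
  then have "c * u \<in> J" "c * u \<noteq> 0" using c(1) by (auto simp: J_def scale_def)
  then have "J \<noteq> {0}" by blast
  moreover have "I = scale (1 / c) J" unfolding J_def scale_scale using c(1) by (simp add: scale_def)
  moreover have "1 / c \<in> K - {0}" using c(1) by (auto intro: divide_closed)
  ultimately show ?thesis using that J by blast
qed

lemma class_number_pos: "class_number K > 0"
proof -
  obtain F :: nat where F: "F > 0" and rep: "\<forall>I. int_ideal I \<and> I \<noteq> {0} \<longrightarrow>
    (\<exists>y J. y \<in> K - {0} \<and> int_ideal J \<and> of_nat F \<in> J \<and> I = scale y J)"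
    by (rule ideal_class_representative)
  have carrier: "carrier (class_group K) = ideal_class K ` {I. fractional_ideal K I}"
    unfolding class_group_def FactGroup_def RCOSETS_def ideal_class_def
    by (auto simp: ideal_group_def)
  have "carrier (class_group K) \<subseteq> ideal_class K ` {J. int_ideal J \<and> of_nat F \<in> J}"
    unfolding carrier
  proof (rule image_subsetI)
    fix I assume "I \<in> {I. fractional_ideal K I}"
    then obtain d J where J: "d \<in> K - {0}" "int_ideal J" "J \<noteq> {0}" "I = scale d J"
      using fractional_ideal_scale by blast
    obtain y J' where J': "y \<in> K - {0}" "int_ideal J'" "of_nat F \<in> J'" "J = scale y J'"
      using rep J(2,3) by blast
    have "ideal_class K I = ideal_class K J" unfolding J(4) by (rule ideal_class_scale[OF J(2,1)])
    also have "\<dots> = ideal_class K J'" unfolding J'(4) by (rule ideal_class_scale[OF J'(2,1)])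
    finally show "ideal_class K I \<in> ideal_class K ` {J. int_ideal J \<and> of_nat F \<in> J}"
      using J'(2,3) by blast
  qed
  then have "finite (carrier (class_group K))"
    using finite_ideals_containing[OF F] by (rule finite_subset[OF _ finite_imageI])
  \<comment> \<open>A positive order takes a nonempty carrier as well as a finite one; the class of
    \<O> provides it.\<close>
  moreover have "carrier (class_group K) \<noteq> {}"
  proof -
    have "additive_subgroup \<O> (num_ring K)"
    proof (intro additive_subgroup.intro subgroup.intro)
      fix x assume x: "x \<in> \<O>"
      interpret G: abelian_group "num_ring K"
      proof (rule abelian_groupI)
        show "\<exists>y\<in>carrier (num_ring K). y \<oplus>\<^bsub>num_ring K\<^esub> x = \<zero>\<^bsub>num_ring K\<^esub>"
          if "x \<in> carrier (num_ring K)" for x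
          using that by (intro bexI[of _ "- x"]) auto
      qed (auto simp: add.assoc add.commute)
      have "\<ominus>\<^bsub>num_ring K\<^esub> x = - x" using x by (intro G.minus_equality) auto
      then show "inv\<^bsub>add_monoid (num_ring K)\<^esub> x \<in> \<O>" using x by (auto simp: a_inv_def)
    qed (auto simp: integers_add)
    moreover have "\<O> \<noteq> {0}" using integers_1 by (metis singletonD zero_neq_one)
    ultimately have "fractional_ideal K \<O>"
      unfolding fractional_ideal_def by (auto intro!: bexI[of _ 1])
    then show ?thesis unfolding carrier by blast
  qed
  ultimately show ?thesis by (simp add: class_number_def Coset.order_def card_gt_0_iff)
qed

section \<open>Heights\<close>


definition conj_emb :: "(complex \<Rightarrow> complex) \<Rightarrow> complex \<Rightarrow> complex" where
  "conj_emb \<tau> = (\<lambda>x\<in>K. cnj (\<tau> x))"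

lemma conj_emb_in: "\<tau> \<in> embeddings K \<Longrightarrow> conj_emb \<tau> \<in> embeddings K"
  unfolding conj_emb_def by (rule embeddingI) (simp_all add: embedding_simps)

lemma conj_emb_conj_emb: "\<tau> \<in> embeddings K \<Longrightarrow> conj_emb (conj_emb \<tau>) = \<tau>"
  by (rule embedding_ext) (simp_all add: conj_emb_in, simp add: conj_emb_def)

lemma conj_emb_eq_iff:
  assumes "\<tau> \<in> embeddings K"
  shows "conj_emb \<tau> = \<tau> \<longleftrightarrow> \<tau> ` K \<subseteq> \<real>"
proof
  assume eq: "conj_emb \<tau> = \<tau>"
  have "cnj (\<tau> x) = \<tau> x" if "x \<in> K" for x
    using fun_cong[OF eq, of x] that by (simp add: conj_emb_def)
  then show "\<tau> ` K \<subseteq> \<real>" by (auto simp: Reals_cnj_iff)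
next
  assume "\<tau> ` K \<subseteq> \<real>"
  then have "cnj (\<tau> x) = \<tau> x" if "x \<in> K" for x using that by (auto simp: Reals_cnj_iff[symmetric])
  then show "conj_emb \<tau> = \<tau>"
    by (intro embedding_ext conj_emb_in assms) (simp add: conj_emb_def)
qed

text \<open>The square at a complex place accounts for its two conjugate embeddings, which have
  equal absolute values; at a real place the pair collapses to a singleton. Hence the member picked
  by \<open>SOME\<close> is immaterial.\<close>

lemma place_abs_arch:
  assumes \<tau>: "\<tau> \<in> embeddings K" and x: "x \<in> K"
  shows "max 1 (place_abs K (Arch_place {\<tau>, conj_emb \<tau>}) x) =
    (\<Prod>\<rho>\<in>{\<tau>, conj_emb \<tau>}. max 1 (cmod (\<rho> x)))"
proof -
  define s where "s = (SOME s. s \<in> {\<tau>, conj_emb \<tau>})"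
  have "s \<in> {\<tau>, conj_emb \<tau>}" unfolding s_def by (rule someI[of _ \<tau>]) simp
  then have s: "s = \<tau> \<or> s = conj_emb \<tau>" by simp
  have conj: "cmod (conj_emb \<tau> x) = cmod (\<tau> x)" using x by (simp add: conj_emb_def)
  have "s \<in> embeddings K" using s \<tau> conj_emb_in by auto
  then have real: "s ` K \<subseteq> \<real> \<longleftrightarrow> conj_emb \<tau> = \<tau>"
    using s conj_emb_eq_iff conj_emb_conj_emb[OF \<tau>] by metis
  have abs: "cmod (s x) = cmod (\<tau> x)" using s conj by auto
  have "place_abs K (Arch_place {\<tau>, conj_emb \<tau>}) x =
      (if conj_emb \<tau> = \<tau> then cmod (\<tau> x) else (cmod (\<tau> x))\<^sup>2)"
    by (simp only: place_abs.simps Let_def s_def[symmetric] real abs)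
  moreover have "max 1 (t\<^sup>2) = (max 1 t)\<^sup>2" if "t \<ge> 0" for t :: real
    using that one_le_power[of t 2] power_le_one[of t 2]
    by (cases "1 \<le> t") (simp_all add: max_absorb1 max_absorb2)
  ultimately show ?thesis by (auto simp: conj power2_eq_square)
qed

text \<open>The fibres of the map from embeddings to places are the pairs of complex
  conjugates.\<close>

lemma prod_embeddings_eq_prod_arch_places:
  assumes x: "x \<in> K"
  shows "(\<Prod>\<tau>\<in>embeddings K. max 1 (cmod (\<tau> x))) = (\<Prod>v\<in>arch_places K. max 1 (place_abs K v x))"
proof -
  define pl where "pl \<tau> = Arch_place {\<tau>, conj_emb \<tau>}" for \<tau>
  have arch: "arch_places K = pl ` embeddings K"
    by (simp add: arch_places_def pl_def conj_emb_def)
  have "(\<Prod>\<tau>\<in>embeddings K. max 1 (cmod (\<tau> x))) =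
      (\<Prod>v\<in>pl ` embeddings K. \<Prod>\<tau>\<in>{\<tau> \<in> embeddings K. pl \<tau> = v}. max 1 (cmod (\<tau> x)))"
    by (rule prod.image_gen[OF finite_embeddings])
  also have "\<dots> = (\<Prod>v\<in>pl ` embeddings K. max 1 (place_abs K v x))"
  proof (rule prod.cong[OF refl])
    fix v assume "v \<in> pl ` embeddings K"
    then obtain \<tau> where \<tau>: "\<tau> \<in> embeddings K" "v = pl \<tau>" by blast
    have "{\<rho> \<in> embeddings K. pl \<rho> = v} = {\<tau>, conj_emb \<tau>}"
      using \<tau> conj_emb_in[OF \<tau>(1)] conj_emb_conj_emb[OF \<tau>(1)] by (auto simp: pl_def)
    then show "(\<Prod>\<rho>\<in>{\<rho> \<in> embeddings K. pl \<rho> = v}. max 1 (cmod (\<rho> x))) = max 1 (place_abs K v x)"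
      using place_abs_arch[OF \<tau>(1) x] by (simp only: \<tau>(2) pl_def)
  qed
  finally show ?thesis by (simp only: arch)
qed

lemma place_abs_finite_le_1:
  assumes "\<qq> \<in> primes_of K" and x: "x \<in> \<O>" "x \<noteq> 0"
  shows "place_abs K (Finite_place \<qq>) x \<le> 1"
proof -
  define e where "e = nat (ord_at K \<qq> x)"
  have e: "ord_at K \<qq> x = int e"
    using ord_at_props(1)[OF primes_of_int_prime[OF assms(1)] x] by (simp add: e_def)
  define w where "w = ideal_norm K \<qq> ^ e"
  have "place_abs K (Finite_place \<qq>) x = inverse (real w)"
    using x(2) by (simp add: e w_def power_int_minus)
  also have "inverse (real w) \<le> 1"
  \<comment> \<open>\<open>card\<close> assigns 0 to an infinite quotient; the inverse of 0 is 0, so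
    the bound holds for this value too.\<close>
  proof (cases "w = 0")
    case False
    then have "1 \<le> real w" by linarith
    then show ?thesis by (rule inverse_le_1_iff[THEN iffD2, OF disjI2])
  qed simp
  finally show ?thesis .
qed

lemma degree_pos: "field_degree K > 0"
  using ngal_pos ngal_le_degree by linarith

text \<open>Finite places contribute 1 for an algebraic integer, which leaves the archimedean ones;
  omitting those with factor 1 does not change the product.\<close>

lemma height_power:
  assumes x: "x \<in> \<O>" "x \<noteq> 0"
  shows "height K x ^ field_degree K = (\<Prod>\<tau>\<in>embeddings K. max 1 (cmod (\<tau> x)))"
proof -
  define P where "P = (\<Prod>\<tau>\<in>embeddings K. max 1 (cmod (\<tau> x)))"
  define V where "V = {v \<in> places K. max 1 (place_abs K v x) \<noteq> 1}"
  have fin: "finite (arch_places K)" using finite_embeddings by (simp add: arch_places_def)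
  have V: "V \<subseteq> arch_places K"
  proof
    fix v assume v: "v \<in> V"
    have "v \<noteq> Finite_place \<qq>" if "\<qq> \<in> primes_of K" for \<qq>
    proof
      assume "v = Finite_place \<qq>"
      then have "place_abs K v x \<le> 1" using place_abs_finite_le_1[OF that x] by (simp only:)
      then show False using v by (simp add: V_def max_absorb1)
    qed
    then have "v \<notin> Finite_place ` primes_of K" by blast
    then show "v \<in> arch_places K" using v by (simp add: V_def places_def)
  qed
  have "(\<Prod>v\<in>V. max 1 (place_abs K v x)) = (\<Prod>v\<in>arch_places K. max 1 (place_abs K v x))"
    by (rule prod.mono_neutral_left[OF fin V]) (auto simp: V_def places_def)
  also have "\<dots> = P"
    unfolding P_def by (rule prod_embeddings_eq_prod_arch_places[symmetric, OF integers_in_K[OF x(1)]])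
  finally have height: "height K x = P powr (1 / real (field_degree K))"
    by (simp add: height_def V_def)
  have "P > 0" unfolding P_def by (intro prod_pos) auto
  then have "(P powr (1 / real (field_degree K))) ^ field_degree K = P"
    using degree_pos by (simp add: powr_power)
  then show ?thesis by (simp only: height P_def)
qed

lemma gr_pow_in_K: "x \<in> K \<Longrightarrow> gr_pow K x \<epsilon> \<in> K"
  unfolding gr_pow_def by (intro prod_closed power_closed) (rule Gal_closed)

text \<open>Composition with \<rho> permutes the group, so the same product over all conjugates
  bounds every embedding. Replacing each absolute value by its maximum with 1 allows all exponents
  to be raised to 24.\<close>

lemma gr_pow_bound:
  assumes \<rho>: "\<rho> \<in> embeddings K" and x: "x \<in> \<O>" "x \<noteq> 0" and \<epsilon>: "\<epsilon> \<in> group_ring_exps K"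
  shows "cmod (\<rho> (gr_pow K x \<epsilon>)) \<le> (height K x ^ field_degree K) ^ 24"
proof -
  have xK: "x \<in> K" using x(1) by (rule integers_in_K)
  have \<rho>': "\<rho> \<in> Gal K" using \<rho> embeddings_eq_Gal by simp
  have "\<rho> (gr_pow K x \<epsilon>) = (\<Prod>\<sigma>\<in>Gal K. \<rho> (\<sigma> x ^ \<epsilon> \<sigma>))"
    unfolding gr_pow_def using xK by (intro embedding_prod[OF \<rho>]) (auto intro: power_closed)
  also have "\<dots> = (\<Prod>\<sigma>\<in>Gal K. compose K \<rho> \<sigma> x ^ \<epsilon> \<sigma>)"
    using xK by (intro prod.cong refl) (simp add: embedding_power[OF \<rho>] Gal_closed compose_def)
  finally have "cmod (\<rho> (gr_pow K x \<epsilon>)) = (\<Prod>\<sigma>\<in>Gal K. cmod (compose K \<rho> \<sigma> x) ^ \<epsilon> \<sigma>)"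
    by (simp add: norm_power flip: prod_norm)
  also have "\<dots> \<le> (\<Prod>\<sigma>\<in>Gal K. max 1 (cmod (compose K \<rho> \<sigma> x)) ^ 24)"
  proof (intro prod_mono conjI)
    fix \<sigma> assume "\<sigma> \<in> Gal K"
    then have "\<epsilon> \<sigma> \<in> {0, 8, 12, 16, 24}" using \<epsilon> unfolding group_ring_exps_def by (rule PiE_mem[rotated])
    then have "\<epsilon> \<sigma> \<le> 24" by auto
    have "cmod (compose K \<rho> \<sigma> x) ^ \<epsilon> \<sigma> \<le> max 1 (cmod (compose K \<rho> \<sigma> x)) ^ \<epsilon> \<sigma>"
      by (intro power_mono) auto
    also have "\<dots> \<le> max 1 (cmod (compose K \<rho> \<sigma> x)) ^ 24"
      using \<open>\<epsilon> \<sigma> \<le> 24\<close> by (intro power_increasing) auto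
    finally show "cmod (compose K \<rho> \<sigma> x) ^ \<epsilon> \<sigma> \<le> max 1 (cmod (compose K \<rho> \<sigma> x)) ^ 24" .
  qed simp
  also have "\<dots> = (\<Prod>\<sigma>\<in>Gal K. max 1 (cmod (\<sigma> x)) ^ 24)"
    by (rule prod.reindex_bij_betw[OF bij_compose_left[OF \<rho>'], of "\<lambda>\<tau>. max 1 (cmod (\<tau> x)) ^ 24"])
  also have "\<dots> = (height K x ^ field_degree K) ^ 24"
    by (simp add: height_power[OF x] embeddings_eq_Gal prod_power_distrib)
  finally show ?thesis .
qed

section \<open>Adjoining a root of a quadratic polynomial\<close>

text \<open>A non-real root has its conjugate as the other root, and their product is
  \<open>n\<close>. A real root needs a nonnegative discriminant, which the bound on
  \<open>a\<close> allows only to be 0: a double root.\<close>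

lemma FR_root_abs:
  fixes \<beta> :: complex
  assumes a: "\<bar>real_of_int a\<bar> \<le> 2 * sqrt (real n)" and \<beta>: "\<beta>\<^sup>2 + of_int a * \<beta> + of_nat n = 0"
  shows "(cmod \<beta>)\<^sup>2 = real n"
proof -
  define x y where "x = Re \<beta>" and "y = Im \<beta>"
  have re: "x\<^sup>2 - y\<^sup>2 + a * x + n = 0"
    using arg_cong[OF \<beta>, of Re] by (simp add: x_def y_def power2_eq_square)
  have im: "(2 * x + a) * y = 0"
    using arg_cong[OF \<beta>, of Im] by (simp add: x_def y_def power2_eq_square algebra_simps)
  have disc: "(real_of_int a)\<^sup>2 \<le> 4 * real n"
  proof -
    have "\<bar>real_of_int a\<bar>\<^sup>2 \<le> (2 * sqrt (real n))\<^sup>2" using a by (intro power_mono) auto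
    then show ?thesis by (simp add: power_mult_distrib)
  qed
  have "x\<^sup>2 + y\<^sup>2 = real n"
  proof (cases "y = 0")
    case True
    then have "(2 * x + a)\<^sup>2 = (real_of_int a)\<^sup>2 - 4 * real n"
      using re by (simp add: power2_eq_square algebra_simps)
    then have "(2 * x + a)\<^sup>2 = 0" using disc zero_le_power2[of "2 * x + a"] by linarith
    then have "real_of_int a = - 2 * x" by (simp add: add_eq_0_iff)
    then show ?thesis using re True by (simp add: power2_eq_square algebra_simps)
  next
    case False
    then have "real_of_int a = - 2 * x" using im by simp
    then show ?thesis using re by (simp add: power2_eq_square algebra_simps)
  qed
  then show ?thesis by (simp add: cmod_power2 x_def y_def)
qed

lemma adjoin_subfield: "complex_subfield (adjoin K \<beta>)"
proof -
  interpret C: field "num_ring UNIV" by (rule field_num_ring_UNIV)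
  show ?thesis
    unfolding adjoin_def by (intro complex_subfield.intro C.generate_field_is_subfield) simp
qed

lemma adjoin_incl: "\<beta> \<in> adjoin K \<beta>" "x \<in> K \<Longrightarrow> x \<in> adjoin K \<beta>"
  unfolding adjoin_def by (simp_all add: generate_field.incl)

lemma restrict_embedding:
  assumes "\<rho> \<in> embeddings (adjoin K \<beta>)"
  shows "restrict \<rho> K \<in> embeddings K"
proof -
  interpret L: complex_subfield "adjoin K \<beta>" by (rule adjoin_subfield)
  show ?thesis by (rule embeddingI) (simp_all add: L.embedding_simps[OF assms] adjoin_incl(2))
qed

lemma adjoin_embedding_eqI:
  assumes \<rho>: "\<rho> \<in> embeddings (adjoin K \<beta>)" "\<rho>' \<in> embeddings (adjoin K \<beta>)"
    and eq: "restrict \<rho> K = restrict \<rho>' K" "\<rho> \<beta> = \<rho>' \<beta>"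
  shows "\<rho> = \<rho>'"
proof -
  interpret L: complex_subfield "adjoin K \<beta>" by (rule adjoin_subfield)
  \<comment> \<open>Membership is carried through the induction because the embedding laws hold only
    inside the field.\<close>
  have "x \<in> adjoin K \<beta> \<and> \<rho> x = \<rho>' x" if "x \<in> generate_field (num_ring UNIV) (insert \<beta> K)" for x
    using that
  proof (induction rule: generate_field.induct)
    case one
    then show ?case by (simp add: L.embedding_simps[OF \<rho>(1)] L.embedding_simps[OF \<rho>(2)])
  next
    case (incl h)
    then show ?case using eq(2) fun_cong[OF eq(1), of h] adjoin_incl by auto
  next
    case (a_inv h)
    then show ?case by (simp add: L.embedding_uminus[OF \<rho>(1)] L.embedding_uminus[OF \<rho>(2)] L.uminus_closed)
  next
    case (m_inv h)
    then show ?case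
      by (simp add: num_ring_UNIV_m_inv L.inverse_closed
        L.embedding_inverse[OF \<rho>(1)] L.embedding_inverse[OF \<rho>(2)])
  next
    case (eng_add h1 h2)
    then show ?case
      by (simp add: L.add_closed L.embedding_simps[OF \<rho>(1)] L.embedding_simps[OF \<rho>(2)])
  next
    case (eng_mult h1 h2)
    then show ?case
      by (simp add: L.mult_closed L.embedding_simps[OF \<rho>(1)] L.embedding_simps[OF \<rho>(2)])
  qed
  then show ?thesis using L.embedding_ext[OF \<rho>] unfolding adjoin_def by blast
qed

lemma adjoin_embedding_root:
  assumes \<rho>: "\<rho> \<in> embeddings (adjoin K \<beta>)" and \<beta>: "\<beta>\<^sup>2 + of_int a * \<beta> + of_nat n = 0"
  shows "(\<rho> \<beta>)\<^sup>2 + of_int a * \<rho> \<beta> + of_nat n = 0"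
proof -
  interpret L: complex_subfield "adjoin K \<beta>" by (rule adjoin_subfield)
  have "\<rho> (\<beta>\<^sup>2 + of_int a * \<beta> + of_nat n) = (\<rho> \<beta>)\<^sup>2 + of_int a * \<rho> \<beta> + of_nat n"
    by (simp add: L.embedding_simps[OF \<rho>] L.embedding_power[OF \<rho>] L.embedding_of_int[OF \<rho>]
      L.embedding_of_nat[OF \<rho>] adjoin_incl(1) L.add_closed L.mult_closed L.power_closed)
  then show ?thesis using \<beta> L.embedding_simps(4)[OF \<rho>] by simp
qed

text \<open>An embedding is determined by its restriction to \<open>K\<close> and the image of
  \<beta>. Subtracting the two evaluations of the quadratic factors into the two possible images,
  \<beta> and the other root.\<close>

lemma card_embeddings_adjoin:
  assumes \<beta>: "\<beta>\<^sup>2 + of_int a * \<beta> + of_nat n = 0"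
  shows "card (embeddings (adjoin K \<beta>)) \<le> 2 * field_degree K"
proof -
  define f where "f \<rho> = (restrict \<rho> K, \<rho> \<beta>)" for \<rho> :: "complex \<Rightarrow> complex"
  define T where "T = embeddings K \<times> {\<beta>, - of_int a - \<beta>}"
  have "f \<rho> \<in> T" if \<rho>: "\<rho> \<in> embeddings (adjoin K \<beta>)" for \<rho>
  proof -
    have "(\<rho> \<beta> - \<beta>) * (\<rho> \<beta> - (- of_int a - \<beta>)) =
        ((\<rho> \<beta>)\<^sup>2 + of_int a * \<rho> \<beta> + of_nat n) - (\<beta>\<^sup>2 + of_int a * \<beta> + of_nat n)"
      by (simp add: power2_eq_square algebra_simps)
    also have "\<dots> = 0" by (simp only: adjoin_embedding_root[OF \<rho> \<beta>] \<beta> diff_self)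
    finally have "(\<rho> \<beta> - \<beta>) * (\<rho> \<beta> - (- of_int a - \<beta>)) = 0" .
    then show ?thesis using restrict_embedding[OF \<rho>] by (auto simp: f_def T_def)
  qed
  moreover have "inj_on f (embeddings (adjoin K \<beta>))"
    by (rule inj_onI) (simp add: f_def adjoin_embedding_eqI)
  moreover have "finite T" using finite_embeddings by (simp add: T_def)
  ultimately have "card (embeddings (adjoin K \<beta>)) \<le> card T" by (intro card_inj_on_le[of f]) auto
  also have "\<dots> = card (embeddings K) * card {\<beta>, - of_int a - \<beta>}"
    by (simp only: T_def card_cartesian_product)
  also have "\<dots> \<le> field_degree K * 2"
    by (intro mult_le_mono card_embeddings_le) (simp add: card_insert_if)
  finally show ?thesis by simp
qed

text \<open>The exponent 2 e on \<beta> becomes e on \<open>n\<close>, since every conjugate of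
  \<beta> has absolute value the square root of \<open>n\<close>. There may be fewer than 2 n
  embeddings; \<open>1 \<le> B\<close> fills up the missing factors.\<close>

lemma field_norm_adjoin_le:
  assumes a: "\<bar>real_of_int a\<bar> \<le> 2 * sqrt (real n)" and \<beta>: "\<beta>\<^sup>2 + of_int a * \<beta> + of_nat n = 0"
    and y: "y \<in> K" and Y: "\<forall>\<tau>\<in>embeddings K. cmod (\<tau> y) \<le> Y"
    and B: "Y + real n ^ e \<le> B" "1 \<le> B"
  shows "cmod (field_norm (adjoin K \<beta>) (y - \<beta> ^ (2 * e))) \<le> B ^ (2 * field_degree K)"
proof -
  interpret L: complex_subfield "adjoin K \<beta>" by (rule adjoin_subfield)
  have bound: "cmod (\<rho> (y - \<beta> ^ (2 * e))) \<le> B" if \<rho>: "\<rho> \<in> embeddings (adjoin K \<beta>)" for \<rho>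
  proof -
    have "\<rho> (y - \<beta> ^ (2 * e)) = restrict \<rho> K y - \<rho> \<beta> ^ (2 * e)"
      using y by (simp add: L.embedding_diff[OF \<rho>] L.embedding_power[OF \<rho>] adjoin_incl L.power_closed)
    also have "cmod \<dots> \<le> cmod (restrict \<rho> K y) + cmod (\<rho> \<beta> ^ (2 * e))" by (rule norm_triangle_ineq4)
    also have "cmod (\<rho> \<beta> ^ (2 * e)) = real n ^ e"
      using FR_root_abs[OF a adjoin_embedding_root[OF \<rho> \<beta>]] by (simp add: norm_power power_mult)
    also have "cmod (restrict \<rho> K y) + real n ^ e \<le> B"
      using bspec[OF Y restrict_embedding[OF \<rho>]] B(1) by linarith
    finally show ?thesis .
  qed
  have "cmod (field_norm (adjoin K \<beta>) (y - \<beta> ^ (2 * e))) =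
      (\<Prod>\<rho>\<in>embeddings (adjoin K \<beta>). cmod (\<rho> (y - \<beta> ^ (2 * e))))"
    unfolding field_norm_def by (rule prod_norm[symmetric])
  also have "\<dots> \<le> (\<Prod>\<rho>\<in>embeddings (adjoin K \<beta>). B)" using bound by (intro prod_mono) auto
  also have "\<dots> = B ^ card (embeddings (adjoin K \<beta>))" by simp
  also have "\<dots> \<le> B ^ (2 * field_degree K)"
    using card_embeddings_adjoin[OF \<beta>] B(2) by (rule power_increasing)
  finally show ?thesis .
qed

section \<open>The bound\<close>

text \<open>Raising the height to the degree removes the root from the norm, which is at most the
  h-th power of N \<qq>; raising to 24 then turns the exponential factor into
  \<open>C2\<close>.\<close>

lemma generator_height_bound:
  assumes q: "\<qq> \<in> primes_of K" and N: "ideal_norm K \<qq> > 0" and x: "x \<in> \<O>" "x \<noteq> 0"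
    and gen: "ideal_pow \<qq> (class_number K) = principal_ideal K x"
    and height: "height K x \<le> cmod (field_norm K x) powr (1 / real (field_degree K)) *
      exp (C1 K \<delta> * regulator K)"
  shows "(height K x ^ field_degree K) ^ 24 \<le> real (ideal_norm K \<qq>) ^ (24 * class_number K) * C2 K \<delta>"
proof -
  define n where "n = field_degree K"
  have n: "n > 0" using degree_pos by (simp add: n_def)
  define E where "E = exp (C1 K \<delta> * regulator K)"
  have nx: "cmod (Nm x) > 0" using Nm_eq_0_iff[OF integers_in_K[OF x(1)]] x(2) by simp
  have "height K x ^ n \<le> (cmod (Nm x) powr (1 / real n) * E) ^ n"
    using height by (intro power_mono) (simp_all add: n_def E_def field_norm_eq, simp add: height_def)
  also have "\<dots> = cmod (Nm x) * E ^ n"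
    using nx n by (simp add: power_mult_distrib powr_power)
  also have "\<dots> \<le> real (ideal_norm K \<qq>) ^ class_number K * E ^ n"
    using Nm_prime_power_generator[OF primes_of_int_prime[OF q] N x gen]
    by (intro mult_right_mono) (simp_all add: E_def)
  finally have "(height K x ^ n) ^ 24 \<le> (real (ideal_norm K \<qq>) ^ class_number K * E ^ n) ^ 24"
    by (rule power_mono) (simp add: height_def)
  also have "\<dots> = real (ideal_norm K \<qq>) ^ (24 * class_number K) * E ^ (24 * n)"
    by (simp add: power_mult_distrib mult.commute flip: power_mult)
  also have "E ^ (24 * n) = C2 K \<delta>"
    unfolding E_def C2_def by (simp add: n_def mult_ac flip: exp_of_nat_mult)
  finally show ?thesis by (simp only: n_def)
qed

lemma C2_ge_1:
  assumes "\<delta> > 0"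
  shows "C2 K \<delta> \<ge> 1"
proof -
  have "regulator K \<ge> 0" by (simp only: regulator_def Let_def abs_ge_zero)
  moreover have "C1 K \<delta> \<ge> 0" using assms by (simp add: C1_def)
  ultimately show ?thesis by (simp add: C2_def)
qed

end

theorem theorem7p7:
  fixes k :: "complex set"
    and \<delta> A\<^sub>1 :: real
    and S :: "complex set set"
    and \<alpha> :: "complex set \<Rightarrow> complex"
    and p :: nat
  assumes galois: "galois_over_Q k"
    and gap: "height_gap k \<delta>"
    and A1: "A\<^sub>1 > 1"
    and S_fin: "finite S"
    and S_nonempty: "S \<noteq> {}"
    and S_primes: "S \<subseteq> primes_of k"
    and S_split: "\<And>\<qq>. \<qq> \<in> S \<Longrightarrow>
      \<exists>l. Factorial_Ring.prime l \<and> lies_over \<qq> l \<and> splits_completely k l"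
    and S_norm: "\<And>\<qq>. \<qq> \<in> S \<Longrightarrow>
      real (ideal_norm k \<qq>) \<le> 2 * cmod (discriminant k) powr (A\<^sub>1 * real (class_number k))"
    and S_generates: "generate (class_group k) (ideal_class k ` S) = carrier (class_group k)"
    and \<alpha>_int: "\<And>\<qq>. \<qq> \<in> S \<Longrightarrow> \<alpha> \<qq> \<in> integers k - {0}"
    and \<alpha>_gen: "\<And>\<qq>. \<qq> \<in> S \<Longrightarrow>
      \<qq> [^]\<^bsub>ideal_group k\<^esub> class_number k = principal_ideal k (\<alpha> \<qq>)"
    and \<alpha>_height: "\<And>\<qq>. \<qq> \<in> S \<Longrightarrow>
      height k (\<alpha> \<qq>) \<le> cmod (field_norm k (\<alpha> \<qq>)) powr (1 / real (field_degree k))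
                          * exp (C1 k \<delta> * regulator k)"
    and p: "p \<in> N1_new k S \<alpha>"
  shows "real p \<le> C_bound k \<delta> (2 * cmod (discriminant k) powr (A\<^sub>1 * real (class_number k)))"
proof -
  interpret galois_number_field k using galois by unfold_locales
  define h where "h = class_number k"
  define D where "D = cmod (discriminant k)"
  define a where "a = 2 * D powr (A\<^sub>1 * real h)"
  define B where "B = a ^ (24 * h) * C2 k \<delta> + a ^ (12 * h)"
  have h: "h \<ge> 1" using class_number_pos by (simp add: h_def)
  have D: "D \<ge> 1" unfolding D_def by (rule discriminant_ge_1)
  have C2: "C2 k \<delta> \<ge> 1" using gap by (intro C2_ge_1) (simp add: height_gap_def)
  have "1 \<le> A\<^sub>1 * real h" using A1 h mult_mono[of 1 A\<^sub>1 1 "real h"] by simp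
  then have "D powr 1 \<le> D powr (A\<^sub>1 * real h)" using D by (rule powr_mono)
  then have Da: "2 * D \<le> a" using D by (simp add: a_def)
  then have a: "a \<ge> 2" using D by linarith
  have a24: "a \<le> a ^ (24 * h)" and a12: "a \<le> a ^ (12 * h)"
    using a h by (simp_all add: self_le_power)
  have "a ^ (24 * h) * 1 \<le> a ^ (24 * h) * C2 k \<delta>" using a C2 by (intro mult_left_mono) auto
  \<comment> \<open>With \<open>a\<close> at least 2 this gives \<open>B\<close> at least 4, room
    for the primes 2 and 3; it also covers primes below \<open>S\<close>, at most \<open>a\<close>,
    and ramified primes, at most half of \<open>a\<close>.\<close>
  then have aB: "2 * a \<le> B" using a24 a12 unfolding B_def by linarith
  have B_pow: "B \<le> B ^ (2 * field_degree k)"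
    using aB a degree_pos by (intro self_le_power) auto
  have goal: "C_bound k \<delta> a = B ^ (2 * field_degree k)" by (simp add: C_bound_def B_def h_def)
  have norm_prime: "ideal_norm k \<qq> = l" if "\<qq> \<in> S" "lies_over \<qq> l" "splits_completely k l" for \<qq> l
    using that S_primes unfolding splits_completely_def by blast
  have norm_le: "real (ideal_norm k \<qq>) \<le> a" if "\<qq> \<in> S" for \<qq>
    using S_norm[OF that] by (simp only: a_def h_def D_def)
  consider "p \<in> N0_new k S \<alpha>" | \<qq> where "Factorial_Ring.prime p" "\<qq> \<in> S" "lies_over \<qq> p"
    | "p = 2 \<or> p = 3" | "p \<in> Ram k"
    using p unfolding N1_new_def T_new_def by blast
  then have "real p \<le> B ^ (2 * field_degree k)"
  proof cases
    case 1
    then obtain M c where M: "M \<in> M2_new k S \<alpha>" "M = of_nat p * of_int c" unfolding N0_new_def by blast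
    obtain \<qq> \<epsilon> \<beta> where q: "\<qq> \<in> S" "\<epsilon> \<in> group_ring_exps k" "\<beta> \<in> FR (ideal_norm k \<qq>)"
      and M_eq: "M = field_norm (adjoin k \<beta>) (gr_pow k (\<alpha> \<qq>) \<epsilon> - \<beta> ^ (24 * class_number k))"
      using M(1) unfolding M2_new_def by blast
    have "M \<noteq> 0" using M(1) unfolding M2_new_def by blast
    obtain l where l: "Factorial_Ring.prime l" "lies_over \<qq> l" "splits_completely k l"
      using S_split[OF q(1)] by blast
    have N: "ideal_norm k \<qq> > 0"
      using norm_prime[OF q(1) l(2,3)] prime_gt_0_nat[OF l(1)] by simp
    have \<alpha>: "\<alpha> \<qq> \<in> integers k" "\<alpha> \<qq> \<noteq> 0" using \<alpha>_int[OF q(1)] by blast+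
    obtain b where b: "\<bar>real_of_int b\<bar> \<le> 2 * sqrt (real (ideal_norm k \<qq>))"
      "\<beta>\<^sup>2 + of_int b * \<beta> + of_nat (ideal_norm k \<qq>) = 0"
      using q(3) unfolding FR_def by blast
    have q': "\<qq> \<in> primes_of k" using q(1) S_primes by blast
    define Y where "Y = real (ideal_norm k \<qq>) ^ (24 * h) * C2 k \<delta>"
    have "(height k (\<alpha> \<qq>) ^ field_degree k) ^ 24 \<le> Y"
      unfolding Y_def h_def
      by (rule generator_height_bound[OF q' N \<alpha> \<alpha>_gen[OF q(1)] \<alpha>_height[OF q(1)]])
    then have Y: "\<forall>\<tau>\<in>embeddings k. cmod (\<tau> (gr_pow k (\<alpha> \<qq>) \<epsilon>)) \<le> Y"
      using order_trans[OF gr_pow_bound[OF _ \<alpha> q(2)]] by blast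
    have "Y \<le> a ^ (24 * h) * C2 k \<delta>"
      unfolding Y_def using norm_le[OF q(1)] C2 by (intro mult_right_mono power_mono) auto
    moreover have "real (ideal_norm k \<qq>) ^ (12 * h) \<le> a ^ (12 * h)"
      using norm_le[OF q(1)] by (intro power_mono) auto
    ultimately have YB: "Y + real (ideal_norm k \<qq>) ^ (12 * h) \<le> B" unfolding B_def by linarith
    have "1 \<le> B" using aB a by linarith
    \<comment> \<open>The exponent is split so that the square of the absolute value of \<beta> can
      be replaced by N \<qq>.\<close>
    have "24 * class_number k = 2 * (12 * h)" by (simp add: h_def)
    then have "cmod M \<le> B ^ (2 * field_degree k)"
      unfolding M_eq
      using field_norm_adjoin_le[of b "ideal_norm k \<qq>" \<beta> "gr_pow k (\<alpha> \<qq>) \<epsilon>" Y "12 * h" B,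
        OF b gr_pow_in_K[OF integers_in_K[OF \<alpha>(1)]] Y YB \<open>1 \<le> B\<close>]
      by (simp only:)
    moreover have "real p \<le> cmod M"
    proof -
      have "c \<noteq> 0" using M(2) \<open>M \<noteq> 0\<close> by auto
      then have "1 \<le> \<bar>real_of_int c\<bar>" by linarith
      then have "real p * 1 \<le> real p * \<bar>real_of_int c\<bar>" by (intro mult_left_mono) auto
      then show ?thesis by (simp add: M(2) norm_mult)
    qed
    ultimately show ?thesis by linarith
  next
    case (2 \<qq>)
    obtain l where l: "Factorial_Ring.prime l" "lies_over \<qq> l" "splits_completely k l"
      using S_split[OF 2(2)] by blast
    \<comment> \<open>The prime \<open>p\<close> and the completely split prime \<open>l\<close> lie
      below the same \<qq>, hence coincide; this makes \<open>p\<close> equal to the norm of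
      \<qq>.\<close>
    have "(of_nat l :: complex) \<in> \<qq> \<inter> \<int>"
      using l(2) unfolding lies_over_def by (auto intro!: exI[of _ 1])
    then obtain z where "z \<in> \<int>" "of_nat l = of_nat p * (z :: complex)"
      using 2(3) unfolding lies_over_def by blast
    then obtain c :: int where "of_nat l = of_nat p * (of_int c :: complex)" by (auto elim: Ints_cases)
    then have "(of_int (int l) :: complex) = of_int (int p * c)" by simp
    then have "int l = int p * c" by (simp only: of_int_eq_iff)
    then have "int p dvd int l" by simp
    then have "p = l" using l(1) 2(1) by (simp add: primes_dvd_imp_eq)
    then have "real p \<le> a" using norm_le[OF 2(2)] norm_prime[OF 2(2) l(2,3)] by simp
    then show ?thesis using aB a B_pow by linarith
  next
    case 3
    then have "real p \<le> 3" by auto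
    then show ?thesis using aB a B_pow by linarith
  next
    case 4
    then have "real p \<le> D" unfolding D_def by (rule ramified_le_discriminant)
    then show ?thesis using Da aB a D B_pow by linarith
  qed
  then show ?thesis unfolding goal[symmetric] by (simp only: a_def h_def D_def)
qed

end
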